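(* Let $B$ be a bouquet of $n$ circles and $\mathcal F=\pi_1 B$, a free group of rank $n$. If $\mathcal H\le\mathcal F$ is a finitely generated generalized echelon subgroup, then $\mathcal H$ is inert, i.e. $\mathrm{rank}(\mathcal H\cap\mathcal K)\le\mathrm{rank}(\mathcal K)$ for every subgroup $\mathcal K\le\mathcal F$.
   Context: Graphs: a graph $\Gamma$ is a $1$-dimensional CW-complex with vertex set $\Gamma^0$ and edge set $\Gamma^1$ (open $1$-cells), each edge $e$ being oriented from its origin $o(e)$ to its terminus $\tau(e)$. A morphism sends vertices to vertices and edges homeomorphically to edges (compatibly with $o,\tau$); an immersion is a locally injective morphism. A bouquet of $n$ circles is a graph with one vertex and $n$ edges. An immersion $\ell:H\to B$ is viewed as labelling the edges of $H$ by edges of $B$; $\ell(S)$ denotes the set of labels of edges in $S$. The degree of a vertex counts loops twice. $H^*$ is the set of vertices of degree $\ge 3$. Each finitely generated $\mathcal H\le\mathcal F$ is represented by an immersion $\ell:(H,v)\to B$ of a finite connected based graph with $\ell_*\pi_1(H,v)=\mathcal H$, obtained by wedging at a base vertex subdivided labelled circles reading a finite generating set of $\mathcal H$ and performing all possible foldings. Ranks: the rank of a group is the minimal cardinality of a generating set. $\chi(\Gamma)=|\Gamma^0|-|\Gamma^1|$; the reduced rank of a finite graph with components $\Gamma_i$ is $\widetilde{\mathrm{rank}}(\Gamma)=\sum_i\max\{0,-\chi(\Gamma_i)\}$. Essential sets: $\mathcal E\subset H^1$ is essential if $\widetilde{\mathrm{rank}}(H-\mathcal E)=\widetilde{\mathrm{rank}}(H)-|\mathcal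 E|$ (open edges removed); it is maximal essential if in addition $|\mathcal E|=\widetilde{\mathrm{rank}}(H)$. An arc of $H$ is a connected component of $H-H^*$. Generalized echelon: given a maximal essential set $\mathcal E=\{e_1,\dots,e_m\}$ of $H$ (listed in some order), let $A_i$ be the arc containing $e_i$, $C_i$ the connected component of $H-\bigcup_{j\ne i}A_j$ containing $e_i$, and $H_i=\bigcup_{j=1}^i C_j$. The immersion $\ell:H\to B$ is generalized echelon if $H$ has a maximal essential set $\mathcal E=\{e_1,\dots,e_m\}$ such that (1) $\ell|_{\mathcal E}$ is injective, and (2) $\ell(H_i)\cap\ell(\{e_{i+1},\dots,e_m\})=\emptyset$ for every $1\le i\le m$. A finitely generated subgroup $\mathcal H\le\mathcal F$ is generalized echelon if the immersion $H\to B$ representing it is generalized echelon. *)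

theory Defs
  imports "Graph_Theory.Digraph_Component" "HOL-Algebra.Generated_Groups" "HOL-Library.Extended_Nat"
begin

section \<open>Groups: rank and inertness\<close>

(* Every infinite cardinality is collapsed to \<infinity>.  In a countable group, such as the fundamental
   group of a finite graph, this loses nothing: all infinite generating sets are countable. *)
definition group_rank :: "('g, 'm) monoid_scheme \<Rightarrow> enat" where
  "group_rank G =
     (INF S \<in> {S. S \<subseteq> carrier G \<and> generate G S = carrier G}. if finite S then enat (card S) else \<infinity>)"

definition finitely_generated :: "('g, 'm) monoid_scheme \<Rightarrow> bool" where
  "finitely_generated G \<longleftrightarrow> (\<exists>S. finite S \<and> S \<subseteq> carrier G \<and> generate G S = carrier G)"

definition inert :: "('g, 'm) monoid_scheme \<Rightarrow> 'g set \<Rightarrow> bool" where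
  "inert G H \<longleftrightarrow> (\<forall>K. subgroup K G \<longrightarrow>
     group_rank (G\<lparr>carrier := H \<inter> K\<rparr>) \<le> group_rank (G\<lparr>carrier := K\<rparr>))"


section \<open>Edge paths and the fundamental group of a graph\<close>

text \<open>
  A graph, that is a 1-dimensional CW-complex with oriented edges, is given combinatorially by a
  \<^typ>\<open>('v, 'a) pre_digraph\<close> satisfying \<^term>\<open>wf_digraph\<close>: loops and parallel edges are allowed,
  \<^term>\<open>tail\<close> is the origin and \<^term>\<open>head\<close> the terminus.  Edges may be traversed in both
  directions: \<open>(e, True)\<close> runs from the origin of \<open>e\<close> to its terminus, \<open>(e, False)\<close> backwards.
\<close>

type_synonym 'a dart = "'a \<times> bool"

definition dart_inv :: "'a dart \<Rightarrow> 'a dart" where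
  "dart_inv d = (fst d, \<not> snd d)"

definition double :: "('v, 'a) pre_digraph \<Rightarrow> ('v, 'a dart) pre_digraph" where
  "double \<Gamma> = \<lparr> verts = verts \<Gamma>, arcs = arcs \<Gamma> \<times> UNIV,
     tail = (\<lambda>(e, s). if s then tail \<Gamma> e else head \<Gamma> e),
     head = (\<lambda>(e, s). if s then head \<Gamma> e else tail \<Gamma> e) \<rparr>"

definition edge_path :: "('v, 'a) pre_digraph \<Rightarrow> 'v \<Rightarrow> 'a dart list \<Rightarrow> 'v \<Rightarrow> bool" where
  "edge_path \<Gamma> = pre_digraph.awalk (double \<Gamma>)"

definition reduced :: "'a dart list \<Rightarrow> bool" where
  "reduced p \<longleftrightarrow> (\<forall>i. Suc i < length p \<longrightarrow> p ! Suc i \<noteq> dart_inv (p ! i))"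

fun push :: "'a dart \<Rightarrow> 'a dart list \<Rightarrow> 'a dart list" where
  "push d [] = [d]"
| "push d (c # p) = (if c = dart_inv d then p else d # c # p)"

definition reduce :: "'a dart list \<Rightarrow> 'a dart list" where
  "reduce p = foldr push p []"

text \<open>
  Homotopy classes of closed edge paths are represented by their unique reduced member.
\<close>

definition pi1 :: "('v, 'a) pre_digraph \<Rightarrow> 'v \<Rightarrow> 'a dart list monoid" where
  "pi1 \<Gamma> v = \<lparr> carrier = {p. edge_path \<Gamma> v p v \<and> reduced p},
     mult = (\<lambda>p q. reduce (p @ q)), one = [] \<rparr>"

definition pi1_map :: "('a \<Rightarrow> 'b) \<Rightarrow> 'a dart list \<Rightarrow> 'b dart list" where
  "pi1_map l p = reduce (map (map_prod l id) p)"

lemma dart_inv_dart_inv [simp]: "dart_inv (dart_inv d) = d"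
  by (simp add: dart_inv_def)

lemma dart_inv_neq [simp]: "dart_inv d \<noteq> d"
  by (cases d) (simp add: dart_inv_def)

lemma reduced_Nil [simp]: "reduced []"
  by (simp add: reduced_def)

lemma reduced_Cons:
  "reduced (d # p) \<longleftrightarrow> reduced p \<and> (p = [] \<or> hd p \<noteq> dart_inv d)"
proof (cases p)
  case (Cons c q)
  show ?thesis
    unfolding reduced_def Cons
  proof (intro iffI conjI allI impI, goal_cases)
    case (1 i)
    then show ?case by (auto dest: spec[of _ "Suc i"])
  next
    case 2
    then show ?case by (auto dest: spec[of _ 0])
  next
    case (3 i)
    then show ?case by (cases i) auto
  qed
qed (simp add: reduced_def)

lemma reduced_push: "reduced p \<Longrightarrow> reduced (push d p)"
  by (cases p) (auto simp: reduced_Cons)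

lemma reduced_foldr_push: "reduced q \<Longrightarrow> reduced (foldr push p q)"
  by (induction p) (auto intro: reduced_push)

lemma reduced_reduce: "reduced (reduce p)"
  by (simp add: reduce_def reduced_foldr_push)

lemma reduce_reduced: "reduced p \<Longrightarrow> reduce p = p"
proof (induction p)
  case (Cons d p)
  then show ?case by (cases p) (auto simp: reduce_def reduced_Cons)
qed (simp add: reduce_def)

lemma push_push_inv: "reduced p \<Longrightarrow> push d (push (dart_inv d) p) = p"
proof (cases p)
  case (Cons c q)
  assume "reduced p"
  then show ?thesis unfolding Cons by (cases q) (auto simp: reduced_Cons)
qed simp

lemma foldr_push_push:
  assumes "reduced q"
  shows "foldr push (push d p) q = push d (foldr push p q)"
  using assms by (cases p) (auto simp: push_push_inv reduced_foldr_push)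

lemma foldr_push_reduce: "reduced q \<Longrightarrow> foldr push (reduce p) q = foldr push p q"
  by (induction p) (simp_all add: reduce_def foldr_push_push)

lemma reduce_append: "reduce (p @ q) = foldr push p (reduce q)"
  by (simp add: reduce_def)

lemma reduce_append_reduce:
  "reduce (reduce p @ q) = reduce (p @ q)" "reduce (p @ reduce q) = reduce (p @ q)"
  by (simp_all add: reduce_append foldr_push_reduce reduced_reduce reduce_reduced)

lemma wf_double: "wf_digraph \<Gamma> \<Longrightarrow> wf_digraph (double \<Gamma>)"
  by (unfold_locales) (auto simp: double_def wf_digraph.wellformed split: if_splits)

lemma edge_path_Nil: "edge_path \<Gamma> u [] v \<longleftrightarrow> u \<in> verts \<Gamma> \<and> u = v"
  by (simp add: edge_path_def pre_digraph.awalk_def pre_digraph.cas.simps double_def)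

lemma edge_path_Cons:
  assumes "wf_digraph \<Gamma>"
  shows "edge_path \<Gamma> u (d # p) v \<longleftrightarrow>
    d \<in> arcs (double \<Gamma>) \<and> tail (double \<Gamma>) d = u \<and> edge_path \<Gamma> (head (double \<Gamma>) d) p v"
  using wf_digraph.wellformed[OF wf_double[OF assms], of d]
  by (auto simp: edge_path_def pre_digraph.awalk_def pre_digraph.cas.simps simp del: split_paired_All)

lemma edge_path_append:
  assumes "wf_digraph \<Gamma>"
  shows "edge_path \<Gamma> u p v \<Longrightarrow> edge_path \<Gamma> v q w \<Longrightarrow> edge_path \<Gamma> u (p @ q) w"
  by (induction p arbitrary: u) (auto simp: edge_path_Nil edge_path_Cons[OF assms])

lemma double_dart_inv:
  "dart_inv d \<in> arcs (double \<Gamma>) \<longleftrightarrow> d \<in> arcs (double \<Gamma>)"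
  "tail (double \<Gamma>) (dart_inv d) = head (double \<Gamma>) d"
  "head (double \<Gamma>) (dart_inv d) = tail (double \<Gamma>) d"
  by (cases d; auto simp: double_def dart_inv_def)+

lemma edge_path_push:
  assumes "wf_digraph \<Gamma>" "edge_path \<Gamma> u (d # p) v"
  shows "edge_path \<Gamma> u (push d p) v"
  using assms(2) by (cases p) (auto simp: edge_path_Cons[OF assms(1)] double_dart_inv)

lemma edge_path_start: "edge_path \<Gamma> u p v \<Longrightarrow> u \<in> verts \<Gamma>"
  by (simp add: edge_path_def pre_digraph.awalk_def double_def)

lemma edge_path_reduce:
  assumes "wf_digraph \<Gamma>"
  shows "edge_path \<Gamma> u p v \<Longrightarrow> edge_path \<Gamma> u (reduce p) v"
proof (induction p arbitrary: u)
  case (Cons d p)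
  then have "edge_path \<Gamma> u (d # reduce p) v"
    by (simp add: edge_path_Cons[OF assms])
  from edge_path_push[OF assms this] show ?case by (simp add: reduce_def)
qed (simp add: reduce_def)

lemma edge_path_rev:
  assumes "wf_digraph \<Gamma>"
  shows "edge_path \<Gamma> u p v \<Longrightarrow> edge_path \<Gamma> v (rev (map dart_inv p)) u"
proof (induction p arbitrary: u)
  case (Cons d p)
  then have "edge_path \<Gamma> (head (double \<Gamma>) d) [dart_inv d] u"
    using wf_digraph.wellformed[OF wf_double[OF assms], of d]
    by (auto simp: edge_path_Cons[OF assms] edge_path_Nil double_dart_inv) (simp add: double_def)
  moreover have "edge_path \<Gamma> v (rev (map dart_inv p)) (head (double \<Gamma>) d)"
    using Cons by (simp add: edge_path_Cons[OF assms])
  ultimately show ?case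
    using edge_path_append[OF assms] by simp
qed (simp add: edge_path_Nil)

lemma reduce_rev_append: "reduce (rev (map dart_inv p) @ p) = []"
proof -
  have "foldr push (rev (map dart_inv p)) (foldr push p q) = q" if "reduced q" for q
    using that
  proof (induction p arbitrary: q)
    case (Cons d p)
    have "push (dart_inv d) (push d (foldr push p q)) = foldr push p q"
      using push_push_inv[of "foldr push p q" "dart_inv d"] Cons.prems
      by (simp add: reduced_foldr_push)
    with Cons show ?case by simp
  qed simp
  then show ?thesis by (simp add: reduce_def)
qed

lemma group_pi1:
  assumes wf: "wf_digraph \<Gamma>" and v: "v \<in> verts \<Gamma>"
  shows "group (pi1 \<Gamma> v)"
proof (rule groupI)
  fix p q r
  assume p: "p \<in> carrier (pi1 \<Gamma> v)" and q: "q \<in> carrier (pi1 \<Gamma> v)"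
    and r: "r \<in> carrier (pi1 \<Gamma> v)"
  show "p \<otimes>\<^bsub>pi1 \<Gamma> v\<^esub> q \<in> carrier (pi1 \<Gamma> v)"
    using p q by (auto simp: pi1_def reduced_reduce intro!: edge_path_reduce[OF wf]
        edge_path_append[OF wf])
  show "(p \<otimes>\<^bsub>pi1 \<Gamma> v\<^esub> q) \<otimes>\<^bsub>pi1 \<Gamma> v\<^esub> r = p \<otimes>\<^bsub>pi1 \<Gamma> v\<^esub> (q \<otimes>\<^bsub>pi1 \<Gamma> v\<^esub> r)"
    by (simp add: pi1_def reduce_append_reduce)
next
  show "\<one>\<^bsub>pi1 \<Gamma> v\<^esub> \<in> carrier (pi1 \<Gamma> v)"
    using v by (simp add: pi1_def edge_path_Nil)
next
  fix p assume p: "p \<in> carrier (pi1 \<Gamma> v)"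
  then show "\<one>\<^bsub>pi1 \<Gamma> v\<^esub> \<otimes>\<^bsub>pi1 \<Gamma> v\<^esub> p = p"
    by (simp add: pi1_def reduce_reduced)
  have "reduce (rev (map dart_inv p)) \<in> carrier (pi1 \<Gamma> v)"
    using p by (simp add: pi1_def reduced_reduce edge_path_reduce[OF wf] edge_path_rev[OF wf])
  moreover have "reduce (rev (map dart_inv p)) \<otimes>\<^bsub>pi1 \<Gamma> v\<^esub> p = \<one>\<^bsub>pi1 \<Gamma> v\<^esub>"
    by (simp add: pi1_def reduce_append_reduce reduce_rev_append)
  ultimately show "\<exists>q \<in> carrier (pi1 \<Gamma> v). q \<otimes>\<^bsub>pi1 \<Gamma> v\<^esub> p = \<one>\<^bsub>pi1 \<Gamma> v\<^esub>" ..
qed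


section \<open>Immersions\<close>

definition graph_morphism ::
  "('v, 'a) pre_digraph \<Rightarrow> ('w, 'b) pre_digraph \<Rightarrow> ('v \<Rightarrow> 'w) \<Rightarrow> ('a \<Rightarrow> 'b) \<Rightarrow> bool" where
  "graph_morphism \<Gamma> \<Delta> f l \<longleftrightarrow>
     f ` verts \<Gamma> \<subseteq> verts \<Delta> \<and> l ` arcs \<Gamma> \<subseteq> arcs \<Delta> \<and>
     (\<forall>e \<in> arcs \<Gamma>. tail \<Delta> (l e) = f (tail \<Gamma> e) \<and> head \<Delta> (l e) = f (head \<Gamma> e))"

(* Local injectivity at v: the two ends of a loop are never identified by a morphism, since one is
   outgoing and the other incoming, so injectivity may be tested on each kind of end separately. *)
definition immersion ::
  "('v, 'a) pre_digraph \<Rightarrow> ('w, 'b) pre_digraph \<Rightarrow> ('v \<Rightarrow> 'w) \<Rightarrow> ('a \<Rightarrow> 'b) \<Rightarrow> bool" where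
  "immersion \<Gamma> \<Delta> f l \<longleftrightarrow> graph_morphism \<Gamma> \<Delta> f l \<and>
     (\<forall>v \<in> verts \<Gamma>. inj_on l (out_arcs \<Gamma> v) \<and> inj_on l (in_arcs \<Gamma> v))"

definition bouquet :: "nat \<Rightarrow> ('v, 'a) pre_digraph \<Rightarrow> 'v \<Rightarrow> bool" where
  "bouquet n B b \<longleftrightarrow> fin_digraph B \<and> verts B = {b} \<and> card (arcs B) = n"


section \<open>Wedges of circles and folding\<close>

text \<open>
  For a set \<open>S\<close> of words, the wedge of subdivided circles reading them: the circle of \<open>w\<close> has the
  edges \<open>(w, 0), \<dots>, (w, length w - 1)\<close> and, apart from the base vertex \<open>([], 0)\<close>, the vertices
  \<open>(w, 1), \<dots>, (w, length w - 1)\<close>.  The edge \<open>(w, i)\<close> lies between the \<open>i\<close>-th and the \<open>i + 1\<close>-st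
  position of the circle and is oriented according to the sign of the letter \<open>w ! i\<close>.
\<close>

definition wedge_vertex :: "'e dart list \<Rightarrow> nat \<Rightarrow> 'e dart list \<times> nat" where
  "wedge_vertex w i = (if i = 0 \<or> i = length w then ([], 0) else (w, i))"

definition wedge :: "'e dart list set \<Rightarrow> ('e dart list \<times> nat, 'e dart list \<times> nat) pre_digraph" where
  "wedge S = \<lparr>
     verts = insert ([], 0) {wedge_vertex w i |w i. w \<in> S \<and> i < length w},
     arcs = {(w, i). w \<in> S \<and> i < length w},
     tail = (\<lambda>(w, i). if snd (w ! i) then wedge_vertex w i else wedge_vertex w (Suc i)),
     head = (\<lambda>(w, i). if snd (w ! i) then wedge_vertex w (Suc i) else wedge_vertex w i) \<rparr>"

definition wedge_label :: "'e dart list \<times> nat \<Rightarrow> 'e" where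
  "wedge_label = (\<lambda>(w, i). fst (w ! i))"

definition merge_vertex :: "'v \<Rightarrow> 'v \<Rightarrow> 'v \<Rightarrow> 'v" where
  "merge_vertex x y = (\<lambda>z. if z = y then x else z)"

(* The quotient of \<Gamma> in which the edge e' is identified with e and the vertex y with x. *)
definition identify :: "'a \<Rightarrow> 'v \<Rightarrow> 'v \<Rightarrow> ('v, 'a) pre_digraph \<Rightarrow> ('v, 'a) pre_digraph" where
  "identify e' x y \<Gamma> = \<lparr> verts = merge_vertex x y ` verts \<Gamma>, arcs = arcs \<Gamma> - {e'},
     tail = merge_vertex x y \<circ> tail \<Gamma>, head = merge_vertex x y \<circ> head \<Gamma> \<rparr>"

inductive fold_step ::
  "('a \<Rightarrow> 'e) \<Rightarrow> ('v, 'a) pre_digraph \<times> 'v \<Rightarrow> ('v, 'a) pre_digraph \<times> 'v \<Rightarrow> bool"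
  for l :: "'a \<Rightarrow> 'e" where
  fold_out: "\<lbrakk>e \<in> arcs \<Gamma>; e' \<in> arcs \<Gamma>; e \<noteq> e'; l e = l e'; tail \<Gamma> e = tail \<Gamma> e'\<rbrakk> \<Longrightarrow>
     fold_step l (\<Gamma>, v) (identify e' (head \<Gamma> e) (head \<Gamma> e') \<Gamma>, merge_vertex (head \<Gamma> e) (head \<Gamma> e') v)"
| fold_in: "\<lbrakk>e \<in> arcs \<Gamma>; e' \<in> arcs \<Gamma>; e \<noteq> e'; l e = l e'; head \<Gamma> e = head \<Gamma> e'\<rbrakk> \<Longrightarrow>
     fold_step l (\<Gamma>, v) (identify e' (tail \<Gamma> e) (tail \<Gamma> e') \<Gamma>, merge_vertex (tail \<Gamma> e) (tail \<Gamma> e') v)"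

(* All possible foldings have been performed exactly when the labelling is an immersion. *)
definition represents ::
  "('e dart list \<times> nat, 'e dart list \<times> nat) pre_digraph \<Rightarrow> 'e dart list \<times> nat \<Rightarrow>
   ('w, 'e) pre_digraph \<Rightarrow> 'w \<Rightarrow> 'e dart list set \<Rightarrow> bool" where
  "represents \<Gamma> v B b H \<longleftrightarrow>
     fin_digraph \<Gamma> \<and> Digraph_Component.connected \<Gamma> \<and> v \<in> verts \<Gamma> \<and>
     immersion \<Gamma> B (\<lambda>_. b) wedge_label \<and>
     pi1_map wedge_label ` carrier (pi1 \<Gamma> v) = H \<and>
     (\<exists>S. finite S \<and> S \<subseteq> carrier (pi1 B b) \<and> generate (pi1 B b) S = H \<and>
          (fold_step wedge_label)\<^sup>*\<^sup>* (wedge S, ([], 0)) (\<Gamma>, v))"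


section \<open>Reduced rank, arcs and essential sets\<close>

text \<open>
  The subspaces of a graph that occur below are unions of open cells, but not always subgraphs
  (an arc, for instance, need not contain its end vertices).  They are represented by their sets of
  cells, \<open>Inl v\<close> being a vertex and \<open>Inr e\<close> an open edge.  The connected components of such a
  subspace are the classes of its cells under the relation generated by incidence of an edge with
  its end vertices.
\<close>

definition cells :: "('v, 'a) pre_digraph \<Rightarrow> ('v + 'a) set" where
  "cells \<Gamma> = Inl ` verts \<Gamma> \<union> Inr ` arcs \<Gamma>"

definition incidence :: "('v, 'a) pre_digraph \<Rightarrow> ('v + 'a) rel" where
  "incidence \<Gamma> = (\<Union>e \<in> arcs \<Gamma>. \<Union>v \<in> {tail \<Gamma> e, head \<Gamma> e}. {(Inr e, Inl v), (Inl v, Inr e)})"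

definition component :: "('v, 'a) pre_digraph \<Rightarrow> ('v + 'a) set \<Rightarrow> 'v + 'a \<Rightarrow> ('v + 'a) set" where
  "component \<Gamma> X x = {y \<in> X. (x, y) \<in> (incidence \<Gamma> \<inter> X \<times> X)\<^sup>*}"

definition components :: "('v, 'a) pre_digraph \<Rightarrow> ('v + 'a) set \<Rightarrow> ('v + 'a) set set" where
  "components \<Gamma> X = component \<Gamma> X ` X"

definition euler_char :: "('v + 'a) set \<Rightarrow> int" where
  "euler_char X = int (card (Inl -` X)) - int (card (Inr -` X))"

definition reduced_rank :: "('v, 'a) pre_digraph \<Rightarrow> ('v + 'a) set \<Rightarrow> int" where
  "reduced_rank \<Gamma> X = (\<Sum>C \<in> components \<Gamma> X. max 0 (- euler_char C))"

definition essential :: "('v, 'a) pre_digraph \<Rightarrow> 'a set \<Rightarrow> bool" where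
  "essential \<Gamma> E \<longleftrightarrow> E \<subseteq> arcs \<Gamma> \<and>
     reduced_rank \<Gamma> (cells \<Gamma> - Inr ` E) = reduced_rank \<Gamma> (cells \<Gamma>) - int (card E)"

definition maximal_essential :: "('v, 'a) pre_digraph \<Rightarrow> 'a set \<Rightarrow> bool" where
  "maximal_essential \<Gamma> E \<longleftrightarrow> essential \<Gamma> E \<and> int (card E) = reduced_rank \<Gamma> (cells \<Gamma>)"

definition branch_vertices :: "('v, 'a) pre_digraph \<Rightarrow> 'v set" where
  "branch_vertices \<Gamma> = {v \<in> verts \<Gamma>. in_degree \<Gamma> v + out_degree \<Gamma> v \<ge> 3}"

definition arc_of :: "('v, 'a) pre_digraph \<Rightarrow> 'a \<Rightarrow> ('v + 'a) set" where
  "arc_of \<Gamma> e = component \<Gamma> (cells \<Gamma> - Inl ` branch_vertices \<Gamma>) (Inr e)"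


section \<open>Generalized echelon immersions and subgroups\<close>

text \<open>
  A maximal essential set is listed as \<open>es = [e\<^sub>1, \<dots>, e\<^sub>m]\<close>; as list positions start at 0,
  \<open>echelon_comp \<Gamma> es i\<close> and \<open>echelon_part \<Gamma> es i\<close> are \<open>C\<close> and \<open>H\<close> of index \<open>i + 1\<close>.
\<close>

definition echelon_comp :: "('v, 'a) pre_digraph \<Rightarrow> 'a list \<Rightarrow> nat \<Rightarrow> ('v + 'a) set" where
  "echelon_comp \<Gamma> es i =
     component \<Gamma> (cells \<Gamma> - (\<Union>j \<in> {..<length es} - {i}. arc_of \<Gamma> (es ! j))) (Inr (es ! i))"

definition echelon_part :: "('v, 'a) pre_digraph \<Rightarrow> 'a list \<Rightarrow> nat \<Rightarrow> ('v + 'a) set" where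
  "echelon_part \<Gamma> es i = (\<Union>j \<le> i. echelon_comp \<Gamma> es j)"

definition generalized_echelon :: "('v, 'a) pre_digraph \<Rightarrow> ('a \<Rightarrow> 'e) \<Rightarrow> bool" where
  "generalized_echelon \<Gamma> l \<longleftrightarrow>
     (\<exists>es. distinct es \<and> maximal_essential \<Gamma> (set es) \<and> inj_on l (set es) \<and>
        (\<forall>i < length es. l ` (Inr -` echelon_part \<Gamma> es i) \<inter> l ` set (drop (Suc i) es) = {}))"

definition generalized_echelon_subgroup ::
  "('w, 'e) pre_digraph \<Rightarrow> 'w \<Rightarrow> 'e dart list set \<Rightarrow> bool" where
  "generalized_echelon_subgroup B b H \<longleftrightarrow>
     (\<exists>\<Gamma> v. represents \<Gamma> v B b H \<and> generalized_echelon \<Gamma> wedge_label)"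

end

theory Submission
  imports Defs
begin

text \<open>
  Fix a left-invariant total order on the free group and extend it to the edges of its Cayley tree,
  comparing labels first.  Following Mineyev and Dicks, call an edge of a finite immersed graph
  order-essential if it is the largest edge of some bi-infinite reduced path.  The number of
  order-essential edges is the reduced rank, order-essential edges of a fibre product project to
  order-essential edges of both factors, and an edge of the fibre product is determined by its
  projections.  Hence a subgroup is inert as soon as its order-essential edges carry different
  labels.  For a generalized echelon immersion, order the labels so that those of \<open>e\<^sub>1, \<dots>, e\<^sub>m\<close>
  come last and in this order.  Removing all \<open>e\<^sub>j\<close> with \<open>j \<noteq> i\<close> leaves an order-essential edge, and its
  lines pass \<open>e\<^sub>i\<close> and stay in \<open>C\<^sub>i\<close>, so by the echelon condition it has the label of \<open>e\<^sub>i\<close>.  As there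
  are only \<open>m\<close> order-essential edges, their labels are distinct.
\<close>

text \<open>Neither the Cayley tree nor an infinite line is ever built. A lift of a path is given by
  the words read along it, and keys of edges are compared up to translation, so left invariance
  makes "largest on this path" a property of the label word alone. This is why label-preserving maps
  transport order-essential edges; comparing labels first is harmless, since translations preserve
  labels. The count of order-essential edges consists of two inequalities of different nature:
  \<open>card_le_ess\<close> holds for every finite deterministic graph, while
  \<open>card_ess_le\<close> needs connectedness and would fail for trees, whence its hypothesis
  that an order-essential edge exists. The rank of the intersection is bounded by explicit
  generators. The rank of \<open>K\<close> enters through finite generating sets \<open>S\<close>,
  for which the graph of \<open>K\<close> must have at most |S| - 1 more edges than vertices; this
  is proved by counting modulo 2 instead of by tracking foldings.\<close>

section \<open>Free reduction and inverse words\<close>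

definition winv :: "'a dart list \<Rightarrow> 'a dart list" where
  "winv p = rev (map dart_inv p)"

lemma winv_simps [simp]: "winv [] = []" "winv (p @ q) = winv q @ winv p"
  "winv (d # p) = winv p @ [dart_inv d]" "winv (winv p) = p" "length (winv p) = length p"
  "winv p = [] \<longleftrightarrow> p = []"
  by (simp_all add: winv_def rev_map o_def)

lemma reduce_winv_append [simp]: "reduce (winv p @ p) = []" "reduce (p @ winv p) = []"
  using reduce_rev_append[of p] reduce_rev_append[of "winv p"] by (simp_all flip: winv_def)

lemma reduce_append_cong: "reduce p = reduce p' \<Longrightarrow> reduce q = reduce q' \<Longrightarrow> reduce (p @ q) = reduce (p' @ q')"
  by (metis reduce_append_reduce)

lemma reduce_cancel [simp]: "reduce (p @ winv q @ q @ r) = reduce (p @ r)" "reduce (p @ q @ winv q @ r) = reduce (p @ r)"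
proof -
  have "reduce (s @ r) = reduce r" if "reduce s = []" for s
    using reduce_append_reduce(1)[of s r] that by simp
  from this[of "winv q @ q"] this[of "q @ winv q"]
  show "reduce (p @ winv q @ q @ r) = reduce (p @ r)" "reduce (p @ q @ winv q @ r) = reduce (p @ r)"
    by (auto intro: reduce_append_cong)
qed

lemma reduce_eq_iff: "reduce p = reduce q \<longleftrightarrow> reduce (p @ winv q) = []"
proof
  assume "reduce p = reduce q"
  then show "reduce (p @ winv q) = []"
    using reduce_append_cong[of p q "winv q" "winv q"] by simp
next
  assume "reduce (p @ winv q) = []"
  then have "reduce ((p @ winv q) @ q) = reduce ([] @ q)"
    by (intro reduce_append_cong) (simp_all add: reduce_def)
  then show "reduce p = reduce q"
    using reduce_cancel(1)[of p q "[]"] by simp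
qed

lemma reduced_append:
  "reduced (p @ q) \<longleftrightarrow> reduced p \<and> reduced q \<and> (p = [] \<or> q = [] \<or> hd q \<noteq> dart_inv (last p))"
  by (induction p) (auto simp: reduced_Cons)

lemma dart_inv_eq_iff: "dart_inv c = d \<longleftrightarrow> c = dart_inv d"
  by auto

lemma reduced_winv [simp]: "reduced (winv p) \<longleftrightarrow> reduced p"
proof -
  have "reduced (winv p)" if "reduced p" for p :: "'a dart list"
    using that
    by (induction p) (auto simp: reduced_append reduced_Cons winv_def last_rev hd_map dart_inv_eq_iff)
  from this[of p] this[of "winv p"] show ?thesis by auto
qed

text \<open>Being reduced only concerns neighbouring darts, so two reduced words that overlap in one
  dart can be spliced there.\<close>

lemma reduced_glue: "reduced (p @ [c]) \<Longrightarrow> reduced (c # q) \<Longrightarrow> reduced (p @ c # q)"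
  by (auto simp: reduced_append)

section \<open>A left-invariant order on the free group\<close>

text \<open>
  The Magnus expansion: on power series in noncommuting variables, the generator \<open>x\<close> acts as left
  multiplication by \<open>1 + x\<close> (\<open>mmul x\<close>, with inverse \<open>mdiv x\<close>).  The sign of the coefficient at the
  first monomial, by length and then lexicographically, orders the series; it is invariant because
  all factors have constant term 1.
\<close>

type_synonym series = "nat list \<Rightarrow> int"

fun mdiv :: "nat \<Rightarrow> series \<Rightarrow> series" where
  "mdiv x t [] = t []"
| "mdiv x t (y # w) = t (y # w) - (if y = x then mdiv x t w else 0)"

fun mmul :: "nat \<Rightarrow> series \<Rightarrow> series" where
  "mmul x t [] = t []"
| "mmul x t (y # w) = t (y # w) + (if y = x then t w else 0)"

definition mact :: "nat dart \<Rightarrow> series \<Rightarrow> series" where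
  "mact d = (if snd d then mmul (fst d) else mdiv (fst d))"

definition mone :: series where "mone w = (if w = [] then 1 else 0)"

definition magnus :: "nat dart list \<Rightarrow> series" where "magnus p = foldr mact p mone"

lemma mdiv_mmul: "mdiv x (mmul x t) w = t w"
  by (induction w) auto

lemma mmul_mdiv: "mmul x (mdiv x t) w = t w"
  by (cases w) auto

lemma mact_inv: "mact d (mact (dart_inv d) t) = t"
  by (auto simp: mact_def dart_inv_def mdiv_mmul mmul_mdiv)

lemma foldr_mact_push: "foldr mact (push d p) t = mact d (foldr mact p t)"
  by (cases p) (auto simp: mact_inv)

lemma foldr_mact_reduce: "foldr mact (reduce p) t = foldr mact p t"
  by (induction p) (simp_all add: reduce_def foldr_mact_push)

lemma magnus_cong: "reduce p = reduce q \<Longrightarrow> magnus p = magnus q"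
  unfolding magnus_def by (metis foldr_mact_reduce)

lemma magnus_append: "magnus (p @ q) = foldr mact p (magnus q)"
  by (simp add: magnus_def)

definition spos :: "series \<Rightarrow> bool" where
  "spos t \<longleftrightarrow> (\<exists>w. t w > 0 \<and> (\<forall>u. (u, w) \<in> lenlex less_than \<longrightarrow> t u = 0))"

definition slt :: "series \<Rightarrow> series \<Rightarrow> bool" where
  "slt s t \<longleftrightarrow> spos (\<lambda>w. t w - s w)"

lemma lenlex_cases: "(u, w) \<in> lenlex less_than \<or> u = w \<or> (w, u) \<in> lenlex (less_than :: nat rel)"
  using total_lenlex[OF total_less_than] by (auto simp: total_on_def)

lemma lenlex_trans: "(u, v) \<in> lenlex less_than \<Longrightarrow> (v, w) \<in> lenlex less_than \<Longrightarrow> (u, w) \<in> lenlex (less_than :: nat rel)"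
  using lenlex_transI[OF trans_less_than] by (blast dest: transD)

lemma spos_add: assumes "spos s" "spos t" shows "spos (\<lambda>w. s w + t w)"
proof -
  obtain u v where u: "s u > 0" "\<forall>z. (z, u) \<in> lenlex less_than \<longrightarrow> s z = 0"
    and v: "t v > 0" "\<forall>z. (z, v) \<in> lenlex less_than \<longrightarrow> t z = 0"
    using assms by (auto simp: spos_def)
  consider "(u, v) \<in> lenlex less_than" | "u = v" | "(v, u) \<in> lenlex less_than"
    using lenlex_cases by blast
  then show ?thesis
  proof cases
    case 1 with u v show ?thesis unfolding spos_def by (intro exI[of _ u]) (auto dest: lenlex_trans)
  next
    case 2 with u v show ?thesis unfolding spos_def by (intro exI[of _ u]) auto
  next
    case 3 with u v show ?thesis unfolding spos_def by (intro exI[of _ v]) (auto dest: lenlex_trans)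
  qed
qed

lemma slt_trans: "slt s t \<Longrightarrow> slt t u \<Longrightarrow> slt s u"
  unfolding slt_def by (drule (1) spos_add) (simp add: add.commute)

lemma slt_irrefl [simp]: "\<not> slt s s"
  by (simp add: slt_def spos_def)

lemma slt_total: assumes "s \<noteq> t" shows "slt s t \<or> slt t s"
proof -
  have wf: "wf (lenlex (less_than :: nat rel))" by (simp add: wf_lenlex)
  from assms obtain x where x: "x \<in> {w. s w \<noteq> t w}" by auto
  obtain w where w: "s w \<noteq> t w" "\<And>u. (u, w) \<in> lenlex less_than \<Longrightarrow> s u = t u"
    by (rule wfE_min[OF wf x]) simp
  show ?thesis
  proof (cases "s w < t w")
    case True
    with w(2) show ?thesis
      unfolding slt_def spos_def by (intro disjI1 exI[of _ w]) simp
  next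
    case False
    with w show ?thesis
      unfolding slt_def spos_def by (intro disjI2 exI[of _ w]) simp
  qed
qed

lemma mdiv_lead: "(\<And>u. length u < length w \<Longrightarrow> t u = 0) \<Longrightarrow> mdiv x t w = t w"
proof (induction w)
  case (Cons y w)
  have "mdiv x t w = t w" by (rule Cons.IH) (simp add: Cons.prems)
  then show ?case using Cons.prems[of w] by simp
qed simp

lemma mmul_lead: "(\<And>u. length u < length w \<Longrightarrow> t u = 0) \<Longrightarrow> mmul x t w = t w"
  by (cases w) auto

lemma spos_mact: assumes "spos t" shows "spos (mact d t)"
proof -
  obtain w where w: "t w > 0" "\<And>u. (u, w) \<in> lenlex less_than \<Longrightarrow> t u = 0"
    using assms by (auto simp: spos_def)
  have short: "t u = 0" if "length u < length w" for u
    using w(2) that by (simp add: lenlex_conv)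
  \<comment> \<open>Equality is needed up to the length of \<open>w\<close> itself, because
    \<open>lenlex\<close> also puts words of that length before \<open>w\<close>.\<close>
  have eq: "mact d t u = t u" if "length u \<le> length w" for u
    using short that unfolding mact_def by (auto intro!: mdiv_lead mmul_lead)
  then show ?thesis
    unfolding spos_def using w by (intro exI[of _ w]) (auto simp: lenlex_conv)
qed

lemma mdiv_diff: "mdiv x (\<lambda>w. s w - t w) w = mdiv x s w - mdiv x t w"
  by (induction w) auto

lemma mact_diff: "mact d (\<lambda>w. s w - t w) = (\<lambda>w. mact d s w - mact d t w)"
proof
  fix w show "mact d (\<lambda>w. s w - t w) w = mact d s w - mact d t w"
    unfolding mact_def by (cases w) (auto simp: mdiv_diff)
qed

lemma slt_mact: "slt s t \<Longrightarrow> slt (mact d s) (mact d t)"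
  unfolding slt_def by (drule spos_mact[of _ d]) (simp add: mact_diff)

lemma slt_foldr_mact: "slt s t \<Longrightarrow> slt (foldr mact p s) (foldr mact p t)"
  by (induction p) (auto intro: slt_mact)

lemma mact_other: "(case w of [] \<Rightarrow> True | y # _ \<Rightarrow> y \<noteq> fst d) \<Longrightarrow> mact d t w = t w"
  by (cases w) (auto simp: mact_def)

text \<open>Multiplication by 1 + x adds the old coefficient at the tail; division subtracts the new
  one.\<close>

lemma mact_same:
  "mact d t (fst d # w) = t (fst d # w) + (if snd d then t w else - mact d t w)"
  by (auto simp: mact_def)

text \<open>
  In the expansion of a reduced word with syllables \<open>x\<^sub>1\<^sup>a\<^sup>1 \<dots> x\<^sub>k\<^sup>a\<^sup>k\<close>, the coefficient at
  \<open>x\<^sub>1 \<dots> x\<^sub>k\<close> is the product of the exponents, and no longer word without repeated neighbours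
  occurs.
\<close>
lemma magnus_syllables:
  assumes "reduced ((x, s) # p)"
  shows "\<exists>u c a. magnus ((x, s) # p) u = c \<and> c \<noteq> 0 \<and> a > 0 \<and> distinct_adj (x # u) \<and>
    magnus ((x, s) # p) (x # u) = (if s then a * c else - (a * c)) \<and>
    (\<forall>v. v \<noteq> [] \<longrightarrow> distinct_adj (v @ x # u) \<longrightarrow> magnus ((x, s) # p) (v @ x # u) = 0)"
  using assms
proof (induction p arbitrary: x s)
  case Nil
  have [simp]: "magnus [(x, s)] [] = 1" "magnus [(x, s)] [x] = (if s then 1 else -1)"
    by (simp_all add: magnus_def mact_def mone_def)
  have "magnus [(x, s)] (v @ [x]) = 0" if "v \<noteq> []" "distinct_adj (v @ [x])" for v
  proof -
    obtain y v' where v: "v = y # v'" using \<open>v \<noteq> []\<close> by (cases v) auto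
    show ?thesis
    proof (cases "y = x")
      case True
      with that v obtain z v'' where v': "v' = z # v''" "z \<noteq> x" by (cases v') auto
      then show ?thesis by (auto simp: v magnus_def mact_def mone_def)
    qed (auto simp: v magnus_def mact_def mone_def)
  qed
  then show ?case by (intro exI[of _ "[]"] exI[of _ 1]) auto
next
  case (Cons d p)
  obtain y s' where d: "d = (y, s')" by (cases d)
  let ?t = "magnus (d # p)"
  have m: "magnus ((x, s) # d # p) = mact (x, s) ?t" by (simp add: magnus_def)
  from Cons.prems have "reduced ((y, s') # p)" by (simp add: reduced_Cons d)
  from Cons.IH[OF this] obtain u c a where IH: "?t u = c" "c \<noteq> 0" "a > 0" "distinct_adj (y # u)"
    "?t (y # u) = (if s' then a * c else - (a * c))"
    "\<And>v. v \<noteq> [] \<Longrightarrow> distinct_adj (v @ y # u) \<Longrightarrow> ?t (v @ y # u) = 0"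
    by (auto simp: d)
  show ?case
  proof (cases "x = y")
    \<comment> \<open>The letter prolongs the first syllable: only its exponent changes, from
      \<open>a\<close> to \<open>a + 1\<close> in absolute value.\<close>
    case True
    with Cons.prems have s: "s = s'" by (auto simp: reduced_Cons d dart_inv_def)
    have u: "mact (x, s) ?t u = ?t u"
      using IH(4) by (subst mact_other) (auto simp: True split: list.split)
    have xu: "mact (x, s) ?t (x # u) = (if s then (a + 1) * c else - ((a + 1) * c))"
      using mact_same[of "(x, s)" ?t u] u IH(1,5) by (cases s) (simp_all add: True s algebra_simps)
    have "mact (x, s) ?t (v @ x # u) = 0" if "v \<noteq> []" "distinct_adj (v @ x # u)" for v
    proof -
      obtain z v' where v: "v = z # v'" using \<open>v \<noteq> []\<close> by (cases v) auto
      show ?thesis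
      proof (cases "z = x")
        case z: True
        with that v obtain z' v'' where v': "v' = z' # v''" "z' \<noteq> x" by (cases v') auto
        have "?t (v @ x # u) = 0" using IH(6)[of v] that by (simp add: True)
        moreover have "?t (v' @ x # u) = 0"
          using IH(6)[of v'] that v' by (simp add: True v)
        moreover have "mact (x, s) ?t (v' @ x # u) = ?t (v' @ x # u)"
          using v' by (subst mact_other) auto
        ultimately show ?thesis using mact_same[of "(x, s)" ?t "v' @ x # u"] by (cases s) (simp_all add: v z)
      next
        case False
        then have "mact (x, s) ?t (v @ x # u) = ?t (v @ x # u)"
          by (subst mact_other) (auto simp: v)
        then show ?thesis using IH(6)[of v] that by (simp add: True)
      qed
    qed
    then show ?thesis
      unfolding m using IH(1-4) u xu True by (intro exI[of _ u] exI[of _ c] exI[of _ "a + 1"]) simp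
  next
    case False
    \<comment> \<open>A new syllable with exponent 1 or -1 begins, so the former coefficient at
      \<open>y # u\<close> takes the role of \<open>c\<close>.\<close>
    let ?u = "y # u"
    have u: "mact (x, s) ?t ?u = ?t ?u" using False by (subst mact_other) auto
    have "?t (x # ?u) = 0" using IH(6)[of "[x]"] IH(4) False by simp
    then have xu: "mact (x, s) ?t (x # ?u) = (if s then ?t ?u else - ?t ?u)"
      using mact_same[of "(x, s)" ?t ?u] u by (cases s) simp_all
    have "mact (x, s) ?t (v @ x # ?u) = 0" if "v \<noteq> []" "distinct_adj (v @ x # ?u)" for v
    proof -
      obtain z v' where v: "v = z # v'" using \<open>v \<noteq> []\<close> by (cases v) auto
      have 1: "?t (v @ x # ?u) = 0" using IH(6)[of "v @ [x]"] that by simp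
      show ?thesis
      proof (cases "z = x")
        case z: True
        with that v obtain z' v'' where v': "v' = z' # v''" "z' \<noteq> x" by (cases v') auto
        have "?t (v' @ x # ?u) = 0"
          using IH(6)[of "v' @ [x]"] that v' by (simp add: v)
        moreover have "mact (x, s) ?t (v' @ x # ?u) = ?t (v' @ x # ?u)"
          using v' by (subst mact_other) auto
        ultimately show ?thesis using 1 mact_same[of "(x, s)" ?t "v' @ x # ?u"] by (cases s) (simp_all add: v z)
      next
        case False
        then have "mact (x, s) ?t (v @ x # ?u) = ?t (v @ x # ?u)"
          by (subst mact_other) (auto simp: v)
        then show ?thesis using 1 by simp
      qed
    qed
    then show ?thesis
      unfolding m using IH(2-5) u xu False
      by (intro exI[of _ ?u] exI[of _ "?t ?u"] exI[of _ 1]) simp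
  qed
qed

lemma magnus_neq_one: assumes "reduced p" "p \<noteq> []" shows "magnus p \<noteq> magnus []"
proof -
  obtain x s q where p: "p = (x, s) # q" using assms(2) by (cases p) auto
  from magnus_syllables[of x s q] assms p obtain u c a where
    "c \<noteq> 0" "a > (0::int)" "magnus p (x # u) = (if s then a * c else - (a * c))" by blast
  then have "magnus p (x # u) \<noteq> magnus [] (x # u)" by (auto simp: magnus_def mone_def)
  then show ?thesis by auto
qed

section \<open>Keys of edges\<close>

text \<open>
  The edge of the Cayley tree that the dart \<open>d\<close> traverses from the vertex \<open>g\<close> is recorded by its
  label and the expansion of its origin, so \<open>d\<close> and its inverse give the same key.
\<close>

type_synonym key = "nat \<times> series"

definition ekey :: "nat dart list \<Rightarrow> nat dart \<Rightarrow> key" where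
  "ekey g d = (fst d, magnus (if snd d then g else g @ [d]))"

definition kless :: "key \<Rightarrow> key \<Rightarrow> bool" where
  "kless k k' \<longleftrightarrow> fst k < fst k' \<or> fst k = fst k' \<and> slt (snd k) (snd k')"

definition translate :: "nat dart list \<Rightarrow> key \<Rightarrow> key" where
  "translate p k = (fst k, foldr mact p (snd k))"

lemma kless_trans: "kless k k' \<Longrightarrow> kless k' k'' \<Longrightarrow> kless k k''"
  by (auto simp: kless_def intro: slt_trans)

lemma kless_irrefl [simp]: "\<not> kless k k"
  by (simp add: kless_def)

lemma kless_total: "k \<noteq> k' \<Longrightarrow> kless k k' \<or> kless k' k"
  unfolding kless_def by (metis linorder_neqE_nat prod.expand slt_total)

lemma kless_max:
  assumes "finite A" "A \<noteq> {}" shows "\<exists>m\<in>A. \<forall>k\<in>A. k \<noteq> m \<longrightarrow> kless k m"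
  using assms
proof (induction rule: finite_ne_induct)
  case (insert x F)
  then obtain m where "m \<in> F" "\<forall>k\<in>F. k \<noteq> m \<longrightarrow> kless k m" by blast
  with insert.hyps kless_total[of x m] show ?case
    by (metis insert_iff kless_trans)
qed simp

lemma kless_min:
  assumes "finite A" "A \<noteq> {}" shows "\<exists>m\<in>A. \<forall>k\<in>A. \<not> kless k m"
  using assms
proof (induction rule: finite_ne_induct)
  case (insert x F)
  then obtain m where "m \<in> F" "\<forall>k\<in>F. \<not> kless k m" by blast
  then show ?case
    by (metis insert_iff kless_irrefl kless_trans)
qed simp

lemma ekey_append: "ekey (p @ g) d = translate p (ekey g d)"
  by (simp add: ekey_def translate_def magnus_append)

lemma kless_translate: "kless k k' \<Longrightarrow> kless (translate p k) (translate p k')"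
  by (auto simp: kless_def translate_def slt_foldr_mact)

lemma kless_translate_iff: "kless (translate p k) (translate p k') \<longleftrightarrow> kless k k'"
proof -
  have "translate (winv p) (translate p k) = k" for k
  proof -
    have "foldr mact (winv p) (foldr mact p t) = t" for t
      using foldr_mact_reduce[of "winv p @ p" t] by simp
    then show ?thesis by (simp add: translate_def)
  qed
  then show ?thesis by (metis kless_translate)
qed

lemma ekey_cong: "reduce g = reduce h \<Longrightarrow> ekey g d = ekey h d"
  unfolding ekey_def by (auto intro!: magnus_cong reduce_append_cong)

lemma ekey_inv: "ekey (g @ [d]) (dart_inv d) = ekey g d"
proof -
  have "magnus (g @ [d, dart_inv d]) = magnus g"
    using reduce_cancel(2)[of g "[d]" "[]"] by (intro magnus_cong) simp
  then show ?thesis by (cases "snd d") (auto simp: ekey_def dart_inv_def)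
qed

text \<open>Equal keys have origins with equal expansions, and the word joining these origins is
  reduced, so by \<open>magnus_neq_one\<close> it is empty. Only a path that turns back at once is
  left, and this is not reduced.\<close>

lemma ekey_neq:
  assumes "reduced (d # q @ [c])" shows "ekey [] d \<noteq> ekey (d # q) c"
proof
  assume eq: "ekey [] d = ekey (d # q) c"
  let ?r = "if snd c then q else q @ [c]"
  have r: "reduced (d # ?r)" "reduced ?r"
    using assms by (auto simp: reduced_Cons reduced_append)
  show False
  proof (cases "snd d")
    case True
    then have "magnus (d # ?r) = magnus []" using eq by (auto simp: ekey_def)
    with r magnus_neq_one show False by blast
  next
    case False
    then have "magnus (d # ?r) = magnus ([d] @ [])" using eq by (auto simp: ekey_def)
    then have "mact (dart_inv d) (mact d (magnus ?r)) = mact (dart_inv d) (mact d (magnus []))"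
      unfolding magnus_append by (simp add: magnus_def)
    then have "magnus ?r = magnus []" using mact_inv[of "dart_inv d"] by simp
    with r magnus_neq_one have "?r = []" by blast
    then have "q = []" "snd c" by (auto split: if_splits)
    moreover have "fst c = fst d" using eq by (simp add: ekey_def)
    ultimately show False using assms False by (auto simp: reduced_Cons dart_inv_def prod_eq_iff)
  qed
qed

text \<open>\<open>fall d q\<close>: on the edge path \<open>d # q\<close> of the Cayley tree, the first edge is the largest.\<close>
definition fall :: "nat dart \<Rightarrow> nat dart list \<Rightarrow> bool" where
  "fall d q \<longleftrightarrow> (\<forall>q1 c q2. q = q1 @ c # q2 \<longrightarrow> kless (ekey (d # q1) c) (ekey [] d))"

lemma fallD: "fall d (q1 @ c # q2) \<Longrightarrow> kless (ekey (d # q1) c) (ekey [] d)"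
  unfolding fall_def by blast

lemma fall_prefix: "fall d (q @ r) \<Longrightarrow> fall d q"
  by (auto simp: fall_def)

text \<open>The largest of the finitely many keys cuts the path at \<open>c\<close>. Both halves are
  described as seen from \<open>c\<close>, so that they can be prolonged independently.\<close>

lemma ex_largest_edge:
  assumes "reduced y" "y \<noteq> []"
  shows "\<exists>y1 c y2. y = y1 @ c # y2 \<and> fall c y2 \<and> fall (dart_inv c) (winv y1)"
proof -
  define K where "K i = ekey (take i y) (y ! i)" for i
  have K: "K (length p) = ekey p c" if "y = p @ c # q" for p c q
    using that by (simp add: K_def)
  \<comment> \<open>This makes the maximum strict among positions on the path, not only among
    keys.\<close>
  have neq: "K i \<noteq> K j" if "i < j" "j < length y" for i j
  proof -
    define p where "p = take i y"
    have 1: "y = p @ y ! i # drop (Suc i) y"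
      using that by (simp add: p_def id_take_nth_drop)
    have 2: "drop (Suc i) y = take (j - Suc i) (drop (Suc i) y) @ y ! j # drop (Suc j) y"
      using that id_take_nth_drop[of "j - Suc i" "drop (Suc i) y"] by simp
    note ij = that
    obtain q c r where y: "y = p @ y ! i # q @ c # r" "j = length (p @ y ! i # q)"
    proof
      show "y = p @ y ! i # take (j - Suc i) (drop (Suc i) y) @ y ! j # drop (Suc j) y"
        using 1 unfolding 2[symmetric] .
    qed (use ij in \<open>simp add: p_def\<close>)
    have "reduced (p @ (y ! i # q @ [c]) @ r)"
      using assms(1) y(1) by (metis append.assoc append_Cons append_Nil)
    then have "reduced (y ! i # q @ [c])"
      using reduced_append[of p "(y ! i # q @ [c]) @ r"] reduced_append[of "y ! i # q @ [c]" r] by blast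
    from ekey_neq[OF this] have "translate p (ekey [] (y ! i)) \<noteq> translate p (ekey (y ! i # q) c)"
      by (metis kless_irrefl kless_total kless_translate_iff)
    then have "ekey p (y ! i) \<noteq> ekey (p @ y ! i # q) c"
      by (metis append_Nil2 ekey_append)
    with K[of p "y ! i" "q @ c # r"] K[of "p @ y ! i # q" c r] y that show ?thesis
      by (simp add: p_def)
  qed
  obtain i where i: "i < length y" "\<forall>j<length y. K j \<noteq> K i \<longrightarrow> kless (K j) (K i)"
    using kless_max[of "K ` {..<length y}"] assms(2) by auto
  have max: "kless (K j) (K i)" if "j < length y" "j \<noteq> i" for j
    using i neq[of i j] neq[of j i] that by (cases "i < j") auto
  define y1 c y2 where "y1 = take i y" and "c = y ! i" and "y2 = drop (Suc i) y"
  have y: "y = y1 @ c # y2" "i = length y1"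
    using i(1) by (simp_all add: y1_def y2_def c_def id_take_nth_drop)
  have "fall c y2"
    unfolding fall_def
  proof (intro allI impI)
    fix q1 e q2 assume "y2 = q1 @ e # q2"
    then have "kless (ekey (y1 @ c # q1) e) (ekey (y1 @ []) c)"
      using K[of "y1 @ c # q1" e q2] K[of y1 c y2] max[of "length (y1 @ c # q1)"] y by simp
    then show "kless (ekey (c # q1) e) (ekey [] c)"
      by (simp only: ekey_append kless_translate_iff)
  qed
  moreover have "fall (dart_inv c) (winv y1)"
    unfolding fall_def
  proof (intro allI impI)
    fix q1 e q2 assume "winv y1 = q1 @ e # q2"
    then have y1: "y1 = winv q2 @ dart_inv e # winv q1"
      by (metis append.assoc append_Cons append_Nil winv_simps(2,3,4))
    have "kless (ekey (winv q2) (dart_inv e)) (ekey y1 c)"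
      using K[of "winv q2" "dart_inv e" "winv q1 @ c # y2"] K[of y1 c y2]
        max[of "length (winv q2)"] y y1 by simp
    \<comment> \<open>The end of \<open>c\<close> is the base point from which the reversed half is
      read; both keys get the prefix \<open>y1 @ [c]\<close>, which cancels by invariance.\<close>
    moreover have "ekey y1 c = ekey ((y1 @ [c]) @ []) (dart_inv c)"
      by (simp add: ekey_inv)
    moreover have "ekey (winv q2) (dart_inv e) = ekey ((y1 @ [c]) @ (dart_inv c # q1)) e"
    proof -
      have "reduce ((y1 @ [c]) @ (dart_inv c # q1)) = reduce (y1 @ q1)"
        using reduce_cancel(2)[of y1 "[c]" q1] by simp
      also have "\<dots> = reduce (winv q2 @ [dart_inv e])"
        using reduce_cancel(1)[of "winv q2 @ [dart_inv e]" q1 "[]"] by (simp add: y1)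
      finally show ?thesis
        using ekey_cong[of "(y1 @ [c]) @ (dart_inv c # q1)" "winv q2 @ [dart_inv e]" e]
          ekey_inv[of "winv q2" "dart_inv e"] by simp
    qed
    ultimately show "kless (ekey (dart_inv c # q1) e) (ekey [] (dart_inv c))"
      by (simp only: ekey_append kless_translate_iff)
  qed
  ultimately show ?thesis using y(1) by blast
qed

section \<open>Walks in labelled graphs\<close>

text \<open>Labelled graphs are sets of triples, which merges parallel edges with equal labels; an
  immersed graph over a bouquet has none.\<close>

definition traverse :: "('v \<times> 'l \<times> 'v) set \<Rightarrow> 'v \<Rightarrow> 'l dart \<Rightarrow> 'v \<Rightarrow> bool" where
  "traverse E u d w \<longleftrightarrow> (if snd d then (u, fst d, w) \<in> E else (w, fst d, u) \<in> E)"

fun walk :: "('v \<times> 'l \<times> 'v) set \<Rightarrow> 'v \<Rightarrow> 'l dart list \<Rightarrow> 'v \<Rightarrow> bool" where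
  "walk E u [] v \<longleftrightarrow> u = v"
| "walk E u (d # p) v \<longleftrightarrow> (\<exists>w. traverse E u d w \<and> walk E w p v)"

text \<open>As darts run both ways, this is the immersion condition: labels are injective on the
  outgoing and on the incoming edges of each vertex.\<close>

definition det :: "('v \<times> 'l \<times> 'v) set \<Rightarrow> bool" where
  "det E \<longleftrightarrow> (\<forall>u d w w'. traverse E u d w \<longrightarrow> traverse E u d w' \<longrightarrow> w = w')"

lemma detD: "det E \<Longrightarrow> traverse E u d w \<Longrightarrow> traverse E u d w' \<Longrightarrow> w = w'"
  unfolding det_def by blast

lemma det_subset: "det E \<Longrightarrow> E' \<subseteq> E \<Longrightarrow> det E'"
  unfolding det_def traverse_def by (metis subsetD)

lemma traverse_inv [simp]: "traverse E u (dart_inv d) w \<longleftrightarrow> traverse E w d u"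
  by (simp add: traverse_def dart_inv_def)

lemma walk_append [simp]: "walk E u (p @ q) v \<longleftrightarrow> (\<exists>w. walk E u p w \<and> walk E w q v)"
  by (induction p arbitrary: u) auto

lemma walk_winv [simp]: "walk E u (winv p) v \<longleftrightarrow> walk E v p u"
  by (induction p arbitrary: v) auto

lemma walk_det: "det E \<Longrightarrow> walk E u p v \<Longrightarrow> walk E u p v' \<Longrightarrow> v = v'"
  by (induction p arbitrary: u) (auto dest: detD)

lemma traverse_morphism:
  assumes "\<And>u x w. (u, x, w) \<in> E \<Longrightarrow> (f u, h x, f w) \<in> E'"
  shows "traverse E u d w \<Longrightarrow> traverse E' (f u) (map_prod h id d) (f w)"
  using assms by (auto simp: traverse_def split: if_splits)

lemma walk_morphism:
  assumes "\<And>u x w. (u, x, w) \<in> E \<Longrightarrow> (f u, h x, f w) \<in> E'"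
  shows "walk E u p v \<Longrightarrow> walk E' (f u) (map (map_prod h id) p) (f v)"
  by (induction p arbitrary: u) (auto intro: traverse_morphism[OF assms])

lemma walk_mono: "walk E u p v \<Longrightarrow> E \<subseteq> E' \<Longrightarrow> walk E' u p v"
  by (induction p arbitrary: u) (auto simp: traverse_def split: if_splits)

text \<open>In a deterministic graph a pair of inverse darts returns to the vertex it left, so
  cancelling it keeps both end vertices.\<close>

lemma walk_reduce:
  assumes "det E" shows "walk E u p v \<Longrightarrow> walk E u (reduce p) v"
proof (induction p arbitrary: u)
  case (Cons d p)
  then obtain w where w: "traverse E u d w" "walk E w (reduce p) v" by auto
  have "walk E u (push d q) v" if "walk E w q v" for q
    using that w(1) by (cases q) (auto dest: detD[OF assms])
  with w(2) show ?case by (simp add: reduce_def)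
qed (simp add: reduce_def)

section \<open>Order-essential edges\<close>

text \<open>\<open>v\<close> stands for the end of \<open>d\<close>, from which \<open>q\<close>
  continues; \<open>N\<close> does not count \<open>d\<close> itself.\<close>

definition falls :: "('v \<times> nat \<times> 'v) set \<Rightarrow> nat dart \<Rightarrow> 'v \<Rightarrow> nat \<Rightarrow> bool" where
  "falls E d v N \<longleftrightarrow> (\<exists>q b. length q = N \<and> walk E v q b \<and> reduced (d # q) \<and> fall d q)"

definition deep :: "('v \<times> nat \<times> 'v) set \<Rightarrow> nat dart \<Rightarrow> 'v \<Rightarrow> bool" where
  "deep E d v \<longleftrightarrow> (\<forall>N. falls E d v N)"

text \<open>
  The edges that are largest on some bi-infinite reduced path; by compactness, arbitrarily long
  paths to both sides suffice in a finite graph.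
\<close>
definition ess :: "('v \<times> nat \<times> 'v) set \<Rightarrow> ('v \<times> nat \<times> 'v) set" where
  "ess E = {(u, x, w) \<in> E. deep E (x, True) w \<and> deep E (x, False) u}"

lemma ess_subset: "ess E \<subseteq> E"
  by (auto simp: ess_def)

lemma falls_le:
  assumes "falls E d v M" "N \<le> M" shows "falls E d v N"
proof -
  obtain q b where q: "length q = M" "walk E v q b" "reduced (d # q)" "fall d q"
    using assms(1) unfolding falls_def by blast
  have "\<exists>b. walk E v (take N q) b" using q(2) walk_append[of E v "take N q" "drop N q" b] by auto
  moreover have "reduced (d # take N q)"
    using q(3) reduced_append[of "d # take N q" "drop N q"] by simp
  moreover have "fall d (take N q)" using q(4) fall_prefix[of d "take N q" "drop N q"] by simp
  ultimately show ?thesis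
    using q(1) assms(2) unfolding falls_def by (intro exI[of _ "take N q"]) auto
qed

lemma deepI:
  assumes "\<And>N. \<exists>q b. length q \<ge> N \<and> walk E v q b \<and> reduced (d # q) \<and> fall d q"
  shows "deep E d v"
  unfolding deep_def using assms by (metis falls_def falls_le)

text \<open>Reducedness and \<open>fall\<close> depend on the label word alone, so any
  label-preserving map carries falling paths to falling paths.\<close>

lemma deep_morphism:
  assumes "\<And>u x w. (u, x, w) \<in> E \<Longrightarrow> (f u, x, f w) \<in> E'"
  assumes "deep E d v" shows "deep E' d (f v)"
  unfolding deep_def falls_def
proof
  fix N
  obtain q b where q: "length q = N" "walk E v q b" "reduced (d # q)" "fall d q"
    using assms(2) unfolding deep_def falls_def by blast
  have "walk E' (f v) q (f b)"
    using walk_morphism[of E f id E' v q b] assms(1) q(2) by (simp add: map_prod.id)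
  with q show "\<exists>q b. length q = N \<and> walk E' (f v) q b \<and> reduced (d # q) \<and> fall d q"
    by blast
qed

lemma ess_morphism:
  assumes "\<And>u x w. (u, x, w) \<in> E \<Longrightarrow> (f u, x, f w) \<in> E'"
  shows "(u, x, w) \<in> ess E \<Longrightarrow> (f u, x, f w) \<in> ess E'"
  using assms deep_morphism[of E f E'] by (auto simp: ess_def)

lemma ess_mono: "E \<subseteq> E' \<Longrightarrow> ess E \<subseteq> ess E'"
  using ess_morphism[of E id E'] by (auto simp: subset_iff)

text \<open>The continuation beyond \<open>d\<close> stays below \<open>d\<close>, and
  \<open>d\<close> is below \<open>c\<close> by \<open>fall c z\<close>; transitivity does the rest
  after splicing at the shared dart \<open>d\<close>.\<close>

lemma deep_extend:
  assumes "walk E t z w" "reduced (c # z)" "last (c # z) = d" "fall c z" "deep E d w"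
  shows "deep E c t"
proof (cases "z = []")
  case False
  then obtain z' where z: "z = z' @ [d]" using assms(3) by (metis append_butlast_last_id last_ConsR)
  show ?thesis
  proof (rule deepI)
    fix N
    obtain q b where q: "length q = N" "walk E w q b" "reduced (d # q)" "fall d q"
      using assms(5) unfolding deep_def falls_def by blast
    have "reduced (c # z @ q)"
      using reduced_glue[of "c # z'" d q] q(3) assms(2) by (simp add: z)
    moreover have "fall c (z @ q)"
      unfolding fall_def
    proof (intro allI impI)
      fix q1 e q2 assume eq: "z @ q = q1 @ e # q2"
      show "kless (ekey (c # q1) e) (ekey [] c)"
      proof (cases "length q1 < length z")
        case True
        then have "z = q1 @ e # take (length z - Suc (length q1)) q2"
          using arg_cong[OF eq, of "take (length z)"] by (simp add: take_Cons')
        then show ?thesis using assms(4) unfolding fall_def by blast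
      next
        case False
        then have "\<exists>q1'. q1 = z @ q1' \<and> q = q1' @ e # q2"
          using eq by (auto simp: append_eq_append_conv2)
        then obtain q1' where q1: "q1 = z @ q1'" "q = q1' @ e # q2" by blast
        have "kless (ekey ((c # z') @ d # q1') e) (ekey ((c # z') @ []) d)"
          unfolding ekey_append kless_translate_iff using q(4) q1(2) by (auto dest: fallD)
        moreover have "kless (ekey (c # z') d) (ekey [] c)"
          using assms(4) z by (auto dest: fallD)
        ultimately show ?thesis using q1(1) z by (auto intro: kless_trans)
      qed
    qed
    ultimately show "\<exists>q b. length q \<ge> N \<and> walk E t q b \<and> reduced (c # q) \<and> fall c q"
      using q assms(1) by (intro exI[of _ "z @ q"]) auto
  qed
qed (use assms in auto)

section \<open>Existence and number of order-essential edges\<close>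

lemma long_reduced_walk:
  assumes "\<And>v d. v \<in> V \<Longrightarrow> \<exists>d' w. d' \<noteq> d \<and> traverse E v d' w" "E \<subseteq> V \<times> UNIV \<times> V"
  shows "traverse E u d w \<Longrightarrow> \<exists>q b. length q = N \<and> walk E w q b \<and> reduced (d # q)"
proof (induction N arbitrary: u d w)
  case (Suc N)
  have "w \<in> V" using Suc.prems assms(2) by (auto simp: traverse_def split: if_splits)
  then obtain d' w' where d': "d' \<noteq> dart_inv d" "traverse E w d' w'" using assms(1) by blast
  from Suc.IH[OF d'(2)] obtain q b where "length q = N" "walk E w' q b" "reduced (d' # q)" by blast
  with d' show ?case by (intro exI[of _ "d' # q"]) (auto simp: reduced_Cons)
next
  case 0
  show ?case by (intro exI[of _ "[]"] exI[of _ w]) (simp add: reduced_Cons)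
qed

text \<open>Otherwise finiteness gives one length \<open>M\<close> that no dart attains. But on a
  reduced path of 2M + 1 darts the largest edge has at least \<open>M\<close> darts on one of its
  sides.\<close>

lemma ex_deep:
  assumes "finite E" "E \<noteq> {}" "E \<subseteq> V \<times> UNIV \<times> V"
    and deg: "\<And>v d. v \<in> V \<Longrightarrow> \<exists>d' w. d' \<noteq> d \<and> traverse E v d' w"
  shows "\<exists>s c t. traverse E s c t \<and> deep E c t"
proof (rule ccontr)
  assume contra: "\<not> ?thesis"
  define Z where "Z = {(s, c, t). traverse E s c t}"
  have "Z \<subseteq> (\<lambda>((u, x, w), s). if s then (u, (x, True), w) else (w, (x, False), u)) ` (E \<times> UNIV)"
    by (force simp: Z_def traverse_def split: if_splits)
  then have fin: "finite Z" using assms(1) by (meson finite_SigmaI finite_UNIV finite_imageI finite_subset)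
  have "\<forall>z\<in>Z. \<exists>N. \<not> falls E (fst (snd z)) (snd (snd z)) N"
    using contra by (auto simp: Z_def deep_def)
  from bchoice[OF this] obtain N where "\<forall>z\<in>Z. \<not> falls E (fst (snd z)) (snd (snd z)) (N z)" ..
  note N = this
  have N: "\<not> falls E c t (N (s, c, t))" if "traverse E s c t" for s c t
    using that bspec[OF N, of "(s, c, t)"] by (simp add: Z_def)
  define M where "M = Max (N ` Z)"
  have none: "\<not> falls E c t M" if "traverse E s c t" for s c t
  proof
    assume "falls E c t M"
    moreover have "N (s, c, t) \<le> M" using fin that by (auto simp: M_def Z_def)
    ultimately have "falls E c t (N (s, c, t))" by (rule falls_le)
    then show False using N[OF that] by simp
  qed
  obtain u x w where "(u, x, w) \<in> E" using assms(2) by auto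
  then have st: "traverse E u (x, True) w" by (simp add: traverse_def)
  have "\<exists>q b. length q = 2 * M \<and> walk E w q b \<and> reduced ((x, True) # q)"
    by (rule long_reduced_walk[OF deg assms(3) st])
  then obtain q b where q: "length q = 2 * M" "walk E w q b" "reduced ((x, True) # q)" by blast
  obtain y1 c y2 where y: "(x, True) # q = y1 @ c # y2" "fall c y2" "fall (dart_inv c) (winv y1)"
    using ex_largest_edge[OF q(3)] by blast
  have "walk E u (y1 @ c # y2) b" using st q(2) by (subst y(1)[symmetric]) auto
  then obtain s t where st: "walk E u y1 s" "traverse E s c t" "walk E t y2 b" by auto
  have red: "reduced (c # y2)" "reduced (dart_inv c # winv y1)"
    using q(3) reduced_winv[of "y1 @ [c]"] by (auto simp: y(1) reduced_append reduced_Cons)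
  have "length y1 + length y2 = 2 * M" using arg_cong[OF y(1), of length] q(1) by simp
  then consider "length y2 \<ge> M" | "length y1 \<ge> M" by linarith
  then show False
  proof cases
    case 1
    have "falls E c t (length y2)" unfolding falls_def using st y red by blast
    from falls_le[OF this 1] show False using none[OF st(2)] by simp
  next
    case 2
    have "falls E (dart_inv c) s (length (winv y1))"
      unfolding falls_def using st y red walk_winv[of E s y1 u] by blast
    then show False using none[of t "dart_inv c" s] st(2) falls_le[of E "dart_inv c" s _ M] 2 by simp
  qed
qed

lemma essI: "traverse E s c t \<Longrightarrow> deep E c t \<Longrightarrow> deep E (dart_inv c) s \<Longrightarrow>
    (if snd c then (s, fst c, t) else (t, fst c, s)) \<in> ess E"
  by (cases c) (auto simp: ess_def traverse_def dart_inv_def split: if_splits)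

text \<open>
  Two paths that both end with a falling ray \<open>d\<close> are joined to a line whose largest edge exists.
\<close>
lemma ess_of_deep:
  assumes "deep E d w" "walk E w y w" "reduced y" "y \<noteq> []" "hd y = dart_inv d" "last y = d"
  shows "ess E \<noteq> {}"
proof -
  obtain y1 c y2 where y: "y = y1 @ c # y2" "fall c y2" "fall (dart_inv c) (winv y1)"
    using ex_largest_edge[OF assms(3,4)] by blast
  from assms(2) obtain s t where st: "walk E w y1 s" "traverse E s c t" "walk E t y2 w" by (auto simp: y(1))
  have red: "reduced (c # y2)" "reduced (dart_inv c # winv y1)"
    using assms(3) reduced_winv[of "y1 @ [c]"] by (auto simp: y(1) reduced_append reduced_Cons)
  have "deep E c t"
    using deep_extend[OF st(3) red(1) _ y(2) assms(1)] assms(6) y(1) by simp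
  moreover have "deep E (dart_inv c) s"
  proof (rule deep_extend[OF _ red(2) _ y(3) assms(1)])
    show "walk E s (winv y1) w" using st(1) by simp
    show "last (dart_inv c # winv y1) = d"
      using assms(5) y(1) by (cases y1) auto
  qed
  ultimately show ?thesis using essI[OF st(2)] by blast
qed

text \<open>
  In a minimal counterexample there is no vertex of degree at most one.  Moreover every dart can be
  reversed by a reduced path: otherwise, the darts reachable from it form a circle component, which
  has Euler characteristic 0 and could be removed.
\<close>
lemma ess_nonempty:
  assumes "finite E" "finite V" "det E" "E \<subseteq> V \<times> UNIV \<times> V" "card V < card E"
  shows "ess E \<noteq> {}"
  using assms
proof (induction "card V" arbitrary: V E rule: less_induct)
  case less
  note fin = less.prems(1,2) and det = less.prems(3) and EV = less.prems(4)
  \<comment> \<open>Deleting some vertices, and at most as many edges, leads back to the induction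
    hypothesis, since \<open>ess\<close> is monotone.\<close>
  have shrink: "ess E \<noteq> {}"
    if "V' \<subset> V" "E' \<subseteq> E" "E' \<subseteq> V' \<times> UNIV \<times> V'" "card V' < card E'" for V' E'
  proof -
    have "ess E' \<noteq> {}"
      using less.hyps[of V' E'] that fin det by (meson det_subset finite_subset psubset_card_mono psubset_imp_subset)
    then show ?thesis using ess_mono[OF that(2)] by blast
  qed
  show ?case
  proof (cases "\<exists>v\<in>V. \<exists>d. \<forall>d' w. traverse E v d' w \<longrightarrow> d' = d")
    case True
    then obtain v d where v: "v \<in> V" "\<And>d' w. traverse E v d' w \<Longrightarrow> d' = d" by blast
    define I where "I = {(u, x, w) \<in> E. u = v \<or> w = v}"
    \<comment> \<open>All edges at \<open>v\<close> are crossed by the single dart \<open>d\<close>,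
      so determinism leaves at most one of them; a loop would show up as two darts.\<close>
    have T: "(v, x, w) \<in> E \<Longrightarrow> d = (x, True)" and F: "(w, x, v) \<in> E \<Longrightarrow> d = (x, False)" for x w
      using v(2)[of "(x, True)" w] v(2)[of "(x, False)" w] by (auto simp: traverse_def)
    have I: "\<exists>w. traverse E v d w \<and> e = (if snd d then (v, fst d, w) else (w, fst d, v))"
      if eI: "e \<in> I" for e
    proof -
      obtain u x w where e: "e = (u, x, w)" "(u, x, w) \<in> E" "u = v \<or> w = v"
        using eI by (auto simp: I_def)
      then show ?thesis using T[of x w] F[of u x] by (auto simp: traverse_def)
    qed
    have "e = e'" if "e \<in> I" "e' \<in> I" for e e'
      using I[OF that(1)] I[OF that(2)] detD[OF det, of v d] by auto
    moreover have finI: "finite I" by (rule finite_subset[OF _ fin(1)]) (auto simp: I_def)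
    ultimately have "card I \<le> 1" by (simp add: card_le_Suc0_iff_eq)
    then have "card E - 1 \<le> card (E - I)"
      using diff_card_le_card_Diff[OF finI, of E] by simp
    moreover have "card (V - {v}) = card V - 1" using v(1) fin by simp
    moreover have "card V > 0" using v(1) fin card_gt_0_iff by blast
    ultimately show ?thesis
      using shrink[of "V - {v}" "E - I"] v(1) EV less.prems(5) by (force simp: I_def)
  next
    case False
    then have deg: "\<exists>d' w. d' \<noteq> d \<and> traverse E v d' w" if "v \<in> V" for v d
      using that by blast
    have "E \<noteq> {}" using less.prems(5) by auto
    have "\<exists>s c t. traverse E s c t \<and> deep E c t"
      by (rule ex_deep[OF fin(1) \<open>E \<noteq> {}\<close> EV deg])
    then obtain u0 d0 w0 where d0: "traverse E u0 d0 w0" "deep E d0 w0" by blast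
    \<comment> \<open>Leaving \<open>w0\<close> through the inverse of \<open>d0\<close> and
      returning through \<open>d0\<close> gives a loop whose two ends both continue with the falling
      paths of \<open>d0\<close>, as \<open>ess_of_deep\<close> requires.\<close>
    define d where "d = dart_inv d0"
    define Z where "Z = {(s, c, t). \<exists>p. walk E w0 p s \<and> traverse E s c t \<and> reduced (p @ [c]) \<and> hd (p @ [c]) = d}"
    have d: "(w0, d, u0) \<in> Z"
      using d0(1) by (auto simp: Z_def d_def reduced_Cons intro!: exI[of _ "[]"])
    have step: "(t, c', t') \<in> Z" if "(s, c, t) \<in> Z" "traverse E t c' t'" "c' \<noteq> dart_inv c" for s c t c' t'
    proof -
      obtain p where "walk E w0 p s" "traverse E s c t" "reduced (p @ [c])" "hd (p @ [c]) = d"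
        using \<open>(s, c, t) \<in> Z\<close> by (auto simp: Z_def)
      with that(2,3) show ?thesis
        unfolding Z_def by (auto simp: reduced_append reduced_Cons hd_append intro!: exI[of _ "p @ [c]"])
    qed
    show ?thesis
    proof (cases "\<exists>s c t. (s, c, t) \<in> Z \<and> (t, dart_inv c, s) \<in> Z")
      case True
      then obtain s c t p p' where p: "walk E w0 p s" "traverse E s c t" "reduced (p @ [c])" "hd (p @ [c]) = d"
        "walk E w0 p' t" "reduced (p' @ [dart_inv c])" "hd (p' @ [dart_inv c]) = d"
        by (auto simp: Z_def)
      let ?y = "p @ c # winv p'"
      have "walk E w0 ?y w0" using p by auto
      moreover have "reduced ?y"
      proof (rule reduced_glue[OF p(3)])
        have "reduced (winv (p' @ [dart_inv c]))" using p(6) by (simp only: reduced_winv)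
        then show "reduced (c # winv p')" by simp
      qed
      moreover have "hd ?y = dart_inv d0" using p(4) by (cases p) (auto simp: d_def)
      moreover have "last ?y = d0" using p(7) by (cases p') (auto simp: d_def dart_inv_eq_iff)
      ultimately show ?thesis using ess_of_deep[OF d0(2), of ?y] by blast
    next
      case norev: False
      define X where "X = (\<lambda>(s, c, t). t) ` Z"
      define ed where "ed = (\<lambda>(s, c, t). if snd c then (s, fst c, t) else (t, fst c, s :: 'a)) ` Z"
      have traverseZ: "traverse E s c t" if "(s, c, t) \<in> Z" for s c t using that by (auto simp: Z_def)
      \<comment> \<open>Of two arrivals at the same vertex through different darts, one could be
        prolonged by the inverse of the other, against \<open>norev\<close>. Hence the edges in
        \<open>ed\<close> are at most as many as the vertices in \<open>X\<close>.\<close>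
      have inj: "inj_on (\<lambda>(s, c, t). t) Z"
      proof (rule inj_onI)
        fix z z' assume z: "z \<in> Z" "z' \<in> Z" "(\<lambda>(s, c, t). t) z = (\<lambda>(s, c, t). t) z'"
        obtain s c t s' c' where zz: "z = (s, c, t)" "z' = (s', c', t)"
          using z(3) by (cases z, cases z') auto
        note Z = z(1,2)[unfolded zz]
        have "c = c'"
        proof (rule ccontr)
          assume "c \<noteq> c'"
          then have "(t, dart_inv c, s) \<in> Z"
            using step[OF Z(2), of "dart_inv c" s] traverseZ[OF Z(1)] by (auto simp: dart_inv_eq_iff)
          with Z(1) norev show False by blast
        qed
        moreover have "s = s'"
          using detD[OF det, of t "dart_inv c" s s'] traverseZ[OF Z(1)] traverseZ[OF Z(2)] \<open>c = c'\<close> by simp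
        ultimately show "z = z'" by (simp add: zz)
      qed
      have X: "X \<subseteq> V" using EV by (auto simp: X_def dest!: traverseZ simp: traverse_def split: if_splits)
      then have finZ: "finite Z"
        using inj finite_imageD[of "\<lambda>(s, c, t). t" Z] fin(2) by (auto simp: X_def dest: finite_subset)
      have "card ed \<le> card X"
        using card_image_le[OF finZ] card_image[OF inj] by (simp add: X_def ed_def)
      moreover have "card E - card ed \<le> card (E - ed)"
        by (rule diff_card_le_card_Diff) (simp add: ed_def finZ)
      moreover have "card (V - X) = card V - card X" "card X \<le> card V"
        using X fin by (simp_all add: card_Diff_subset card_mono finite_subset)
      moreover have "u0 \<in> X" using d by (force simp: X_def)
      moreover have "E - ed \<subseteq> (V - X) \<times> UNIV \<times> (V - X)"
      proof -
        \<comment> \<open>A dart leaving \<open>X\<close> either turns back along an arriving dart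
          or prolongs it; both ways its edge lies in \<open>ed\<close>. So deleting \<open>X\<close>
          and \<open>ed\<close> leaves a graph.\<close>
        have in_ed: "(if snd c' then (t, fst c', t') else (t', fst c', t)) \<in> ed"
          if t: "t \<in> X" and c': "traverse E t c' t'" for t c' t'
        proof -
          obtain s c where Z: "(s, c, t) \<in> Z" using t by (auto simp: X_def)
          show ?thesis
          proof (cases "c' = dart_inv c")
            case True
            then have "t' = s" using detD[OF det c', of s] traverseZ[OF Z] by simp
            with Z True show ?thesis by (force simp: ed_def dart_inv_def)
          next
            case False
            from step[OF Z c' False] show ?thesis by (force simp: ed_def)
          qed
        qed
        have "u \<notin> X \<and> w \<notin> X" if "(u, x, w) \<in> E - ed" for u x w
          using in_ed[of u "(x, True)" w] in_ed[of w "(x, False)" u] that by (auto simp: traverse_def)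
        then show ?thesis using EV by auto
      qed
      ultimately have "V - X \<subset> V" "card (V - X) < card (E - ed)"
        "E - ed \<subseteq> (V - X) \<times> UNIV \<times> (V - X)"
        using X less.prems(5) by (blast, linarith, blast)
      then show ?thesis by (intro shrink[of "V - X" "E - ed"]) auto
    qed
  qed
qed

text \<open>If the order-essential edges were too few, deleting them would leave more edges than
  vertices, hence an order-essential edge of the rest; by monotonicity it is order-essential in
  \<open>E\<close>, yet it was deleted.\<close>

theorem card_le_ess:
  assumes "finite E" "finite V" "det E" "E \<subseteq> V \<times> UNIV \<times> V"
  shows "card E \<le> card V + card (ess E)"
proof (rule ccontr)
  assume "\<not> ?thesis"
  moreover have "card (E - ess E) = card E - card (ess E)"
    using assms(1) ess_subset[of E] by (simp add: card_Diff_subset finite_subset)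
  ultimately have "card V < card (E - ess E)" by simp
  then have "ess (E - ess E) \<noteq> {}"
    using assms by (intro ess_nonempty[of _ V]) (auto intro: det_subset)
  moreover have "ess (E - ess E) \<subseteq> ess E" "ess (E - ess E) \<subseteq> E - ess E"
    using ess_mono[of "E - ess E" E] ess_subset by auto
  ultimately show False by blast
qed

section \<open>Trees\<close>

text \<open>Phrased by closed vertex sets instead of paths, because it is mostly applied to such
  sets; \<open>conn_if_reachable\<close> obtains it from paths.\<close>

definition conn :: "'v set \<Rightarrow> ('v \<times> 'l \<times> 'v) set \<Rightarrow> bool" where
  "conn V E \<longleftrightarrow> (\<forall>U\<subseteq>V. U \<noteq> {} \<longrightarrow> (\<forall>(u, x, w)\<in>E. u \<in> U \<longleftrightarrow> w \<in> U) \<longrightarrow> U = V)"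

lemma connD:
  "conn V E \<Longrightarrow> U \<subseteq> V \<Longrightarrow> U \<noteq> {} \<Longrightarrow> (\<And>u x w. (u, x, w) \<in> E \<Longrightarrow> u \<in> U \<longleftrightarrow> w \<in> U) \<Longrightarrow> U = V"
  unfolding conn_def by blast

lemma closed_walk:
  assumes "\<And>u x w. (u, x, w) \<in> E \<Longrightarrow> u \<in> U \<longleftrightarrow> w \<in> U"
  shows "walk E u p v \<Longrightarrow> u \<in> U \<longleftrightarrow> v \<in> U"
proof (induction p arbitrary: u)
  case (Cons d p)
  then obtain w where w: "traverse E u d w" "w \<in> U \<longleftrightarrow> v \<in> U" by auto
  then show ?case using assms[of u "fst d" w] assms[of w "fst d" u] by (auto simp: traverse_def split: if_splits)
qed simp

lemma conn_if_reachable: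
  assumes "\<And>v. v \<in> V \<Longrightarrow> \<exists>p. walk E z p v" shows "conn V E"
  unfolding conn_def
proof (intro allI impI)
  fix U assume U: "U \<subseteq> V" "U \<noteq> {}" "\<forall>(u, x, w)\<in>E. u \<in> U \<longleftrightarrow> w \<in> U"
  have iff: "z \<in> U \<longleftrightarrow> v \<in> U" if "v \<in> V" for v
  proof -
    obtain p where "walk E z p v" using assms \<open>v \<in> V\<close> by blast
    then show ?thesis by (rule closed_walk[rotated]) (use U(3) in auto)
  qed
  obtain v where "v \<in> U" using U(2) by auto
  with iff U(1) show "U = V" by blast
qed

text \<open>The tree is grown one vertex at a time. Instead of acyclicity it records what is used
  later: the edge count, and that each edge of \<open>T\<close> becomes trivial when closed up by
  the chosen paths.\<close>

lemma spanning_tree: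
  assumes "finite V" "E \<subseteq> V \<times> UNIV \<times> V" "conn V E" "z \<in> V"
  obtains T pth where "T \<subseteq> E" "finite T" "card T + 1 = card V" "pth z = []"
    "\<And>v. v \<in> V \<Longrightarrow> walk E z (pth v) v"
    "\<And>u x w. (u, x, w) \<in> T \<Longrightarrow> reduce (pth u @ (x, True) # winv (pth w)) = []"
proof -
  have grow: "\<exists>U T pth. z \<in> U \<and> U \<subseteq> V \<and> card U = n \<and> T \<subseteq> E \<and> T \<subseteq> U \<times> UNIV \<times> U \<and> finite T \<and> card T + 1 = n \<and>
     pth z = [] \<and> (\<forall>v\<in>U. walk E z (pth v) v) \<and>
     (\<forall>(u, x, w)\<in>T. reduce (pth u @ (x, True) # winv (pth w)) = [])"
    if "1 \<le> n" "n \<le> card V" for n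
    using that
  proof (induction n rule: nat_induct_at_least)
    case base
    show ?case
      by (rule exI[of _ "{z}"], rule exI[of _ "{}"], rule exI[of _ "\<lambda>_. []"]) (use assms(4) in auto)
  next
    case (Suc n)
    then obtain U T pth where *: "z \<in> U" "U \<subseteq> V" "card U = n" "T \<subseteq> E" "T \<subseteq> U \<times> UNIV \<times> U" "finite T"
      "card T + 1 = n" "pth z = []" "\<forall>v\<in>U. walk E z (pth v) v"
      "\<forall>(u, x, w)\<in>T. reduce (pth u @ (x, True) # winv (pth w)) = []" by (auto simp: Suc_le_eq)
    have finU: "finite U" using *(2) assms(1) finite_subset by blast
    have "U \<noteq> V" using *(3) Suc.prems by auto
    then obtain u x w where e: "(u, x, w) \<in> E" "(u \<in> U) \<noteq> (w \<in> U)"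
      using connD[OF assms(3) *(2)] *(1) by blast
    then have uw: "u \<in> V" "w \<in> V" using assms(2) by auto
    define p where "p = (if u \<in> U then pth u @ [(x, True)] else pth w @ [(x, False)])"
    define t where "t = (if u \<in> U then w else u)"
    have t: "t \<notin> U" "t \<in> V" "t \<noteq> z" using e(2) uw *(1) by (auto simp: t_def)
    have p: "walk E z p t" using e *(9) by (auto simp: p_def t_def traverse_def)
    let ?pth = "pth(t := p)"
    have old: "?pth v = pth v" if "v \<in> U" for v using that t by auto
    have "reduce (?pth u @ (x, True) # winv (?pth w)) = []"
    proof (cases "u \<in> U")
      case True
      then have "t = w" "w \<noteq> u" using e(2) by (auto simp: t_def)
      then show ?thesis
        using True reduce_winv_append(2)[of p] by (simp add: p_def)
    next
      case False
      then have "t = u" "w \<noteq> u" using e(2) by (auto simp: t_def)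
      then show ?thesis
        using False reduce_cancel(1)[of "pth w" "[(x, True)]" "winv (pth w)"] by (simp add: p_def dart_inv_def)
    qed
    moreover have "reduce (?pth u @ (x, True) # winv (?pth w)) = []" if "(u, x, w) \<in> T" for u x w
    proof -
      have "u \<in> U" "w \<in> U" using that *(5) by auto
      then show ?thesis using bspec[OF *(10) that] old by simp
    qed
    moreover have "(u, x, w) \<notin> T" using *(5) e(2) by auto
    ultimately show ?case
      using * e t p finU uw
      by (intro exI[of _ "insert t U"] exI[of _ "insert (u, x, w) T"] exI[of _ ?pth])
        (auto simp: t_def split: if_splits)
  qed
  have "1 \<le> card V" using assms(1,4) by (auto simp: Suc_le_eq card_gt_0_iff)
  from grow[OF this order_refl] obtain U T pth where *: "U \<subseteq> V" "card U = card V" "T \<subseteq> E" "finite T"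
    "card T + 1 = card V" "pth z = []" "\<forall>v\<in>U. walk E z (pth v) v"
    "\<forall>(u, x, w)\<in>T. reduce (pth u @ (x, True) # winv (pth w)) = []"
    by (elim exE conjE) (rule that)
  then have "U = V" using assms(1) by (simp add: card_subset_eq)
  then show ?thesis by (intro that[of T pth]) (use * in auto)
qed

text \<open>Take a smallest closed vertex set that has fewer edges than vertices. If it split into
  two closed parts, one of them would inherit the deficit; hence it is connected.\<close>

lemma ex_tree_component:
  assumes "finite V" "finite E" "E \<subseteq> V \<times> UNIV \<times> V" "card E < card V"
  obtains U EU where "U \<subseteq> V" "U \<noteq> {}" "EU = {(u, x, w) \<in> E. u \<in> U}" "EU \<subseteq> U \<times> UNIV \<times> U"
    "\<And>u x w. (u, x, w) \<in> E \<Longrightarrow> u \<in> U \<longleftrightarrow> w \<in> U" "conn U EU" "card EU < card U"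
proof -
  define R where "R U = {(u, x, w) \<in> E. u \<in> U}" for U
  define P where "P U \<longleftrightarrow> U \<subseteq> V \<and> (\<forall>(u, x, w)\<in>E. u \<in> U \<longleftrightarrow> w \<in> U) \<and> card (R U) < card U" for U
  have "R V = E" using assms(3) by (auto simp: R_def)
  then have "P V" using assms(3,4) by (auto simp: P_def)
  then obtain U where U: "P U" "\<And>U'. card U' < card U \<Longrightarrow> \<not> P U'"
    using ex_has_least_nat[of P V card] by (metis leD)
  have finU: "finite U" using U(1) assms(1) finite_subset by (auto simp: P_def)
  have conn: "conn U (R U)"
    unfolding conn_def
  proof (intro allI impI, rule ccontr)
    fix U1 assume U1: "U1 \<subseteq> U" "U1 \<noteq> {}" "\<forall>(u, x, w)\<in>R U. u \<in> U1 \<longleftrightarrow> w \<in> U1" "U1 \<noteq> U"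
    have cl: "u \<in> U1 \<longleftrightarrow> w \<in> U1" "u \<in> U \<longleftrightarrow> w \<in> U" if "(u, x, w) \<in> E" for u x w
    proof -
      show 1: "u \<in> U \<longleftrightarrow> w \<in> U" using U(1) that by (auto simp: P_def)
      show "u \<in> U1 \<longleftrightarrow> w \<in> U1"
      proof (cases "u \<in> U")
        case True then show ?thesis using U1(3) that by (auto simp: R_def)
      next
        case False then show ?thesis using 1 U1(1) by auto
      qed
    qed
    have "card U1 < card U" "card (U - U1) < card U"
      using U1(1,2,4) finU by (auto intro!: psubset_card_mono)
    then have "\<not> P U1" "\<not> P (U - U1)" using U(2) by auto
    moreover have "U1 \<subseteq> V" "U - U1 \<subseteq> V" using U(1) U1(1) by (auto simp: P_def)
    moreover have "\<forall>(u, x, w)\<in>E. u \<in> U1 \<longleftrightarrow> w \<in> U1" "\<forall>(u, x, w)\<in>E. u \<in> U - U1 \<longleftrightarrow> w \<in> U - U1"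
      using cl by auto
    ultimately have "card U1 \<le> card (R U1)" "card (U - U1) \<le> card (R (U - U1))"
      unfolding P_def by (meson not_less)+
    moreover have "card (R U) = card (R U1) + card (R (U - U1))"
    proof -
      have "finite (R W)" for W by (rule finite_subset[OF _ assms(2)]) (auto simp: R_def)
      moreover have "R U = R U1 \<union> R (U - U1)" "R U1 \<inter> R (U - U1) = {}"
        using U1(1) by (auto simp: R_def)
      ultimately show ?thesis by (simp add: card_Un_disjoint)
    qed
    moreover have "card U = card U1 + card (U - U1)"
      using finU U1(1) by (simp add: card_Diff_subset card_mono finite_subset)
    ultimately show False using U(1) by (auto simp: P_def)
  qed
  have "R U \<subseteq> U \<times> UNIV \<times> U" using U(1) by (auto simp: P_def R_def)
  moreover have "U \<noteq> {}" using U(1) by (auto simp: P_def)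
  moreover have "u \<in> U \<longleftrightarrow> w \<in> U" if "(u, x, w) \<in> E" for u x w
    using U(1) that by (auto simp: P_def)
  moreover have "U \<subseteq> V" "card (R U) < card U" using U(1) by (simp_all add: P_def)
  ultimately show ?thesis using conn by (intro that[of U "R U"]) (simp_all add: R_def)
qed

text \<open>Along every edge, \<open>pth\<close> changes by exactly that edge up to reduction, so
  the class of a walk depends only on its end.\<close>

lemma walk_homotopic:
  assumes "walk E z p v" "pth z = []"
    and "\<And>u x w. (u, x, w) \<in> E \<Longrightarrow> reduce (pth u @ (x, True) # winv (pth w)) = []"
  shows "reduce p = reduce (pth v)"
  using assms(1)
proof (induction p arbitrary: v rule: rev_induct)
  case (snoc d p)
  then obtain u where u: "walk E z p u" "traverse E u d v" by auto
  have "reduce (pth u @ [d]) = reduce (pth v)"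
  proof (cases "snd d")
    case True
    then show ?thesis
      using assms(3)[of u "fst d" v] u(2) by (cases d) (simp add: traverse_def reduce_eq_iff)
  next
    case False
    then have "reduce (pth v @ (fst d, True) # winv (pth u)) = []"
      using assms(3)[of v "fst d" u] u(2) by (simp add: traverse_def)
    then have "reduce (pth v @ [dart_inv d]) = reduce (pth u)"
      using False by (simp add: reduce_eq_iff dart_inv_def)
    then have "reduce ((pth v @ [dart_inv d]) @ [d]) = reduce (pth u @ [d])"
      by (intro reduce_append_cong) simp_all
    then show ?thesis using reduce_cancel(1)[of "pth v" "[d]" "[]"] by simp
  qed
  moreover have "reduce (p @ [d]) = reduce (pth u @ [d])"
    using snoc.IH[OF u(1)] by (rule reduce_append_cong) simp
  ultimately show ?case by simp
qed (simp add: assms(2))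

lemma walk_subset:
  assumes "E \<subseteq> V \<times> UNIV \<times> V" "walk E u p v" "u \<in> V" shows "v \<in> V"
proof -
  have "traverse E u d w \<Longrightarrow> w \<in> V" for u d w using assms(1) by (auto simp: traverse_def split: if_splits)
  with assms(2,3) show ?thesis by (induction p arbitrary: u) auto
qed

text \<open>A longer walk visits some vertex twice. The section between the two visits is
  homotopically trivial, although it is reduced and nonempty.\<close>

lemma reduced_walk_in_tree_short:
  assumes "finite U" "E \<subseteq> U \<times> UNIV \<times> U" "z \<in> U" "pth z = []" "\<And>v. v \<in> U \<Longrightarrow> walk E z (pth v) v"
    and triv: "\<And>u x w. (u, x, w) \<in> E \<Longrightarrow> reduce (pth u @ (x, True) # winv (pth w)) = []"
    and q: "walk E u q v" "reduced q" "u \<in> U"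
  shows "length q < card U"
proof (rule ccontr)
  assume "\<not> ?thesis"
  have "\<forall>i. \<exists>w. walk E u (take i q) w \<and> walk E w (drop i q) v"
    using q(1) by (metis append_take_drop_id walk_append)
  then obtain f where f: "\<And>i. walk E u (take i q) (f i)" "\<And>i. walk E (f i) (drop i q) v" by metis
  have "f ` {..length q} \<subseteq> U" using walk_subset[OF assms(2) f(1) q(3)] by blast
  then have "\<not> inj_on f {..length q}"
    using \<open>\<not> _\<close> card_inj_on_le[of f "{..length q}" U] assms(1) by auto
  then obtain i j where ij: "i < j" "j \<le> length q" "f i = f j"
    unfolding inj_on_def by (metis atMost_iff linorder_neqE_nat)
  define r where "r = drop i (take j q)"
  have split: "take j q = take i q @ r"
    unfolding r_def using ij(1) by (metis append_take_drop_id less_imp_le_nat min.absorb1 take_take)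
  have "reduced (take i q @ r)"
    using q(2) reduced_append[of "take j q" "drop j q"] unfolding split[symmetric] by simp
  then have r: "r \<noteq> []" "reduced r"
    using ij by (auto simp: reduced_append r_def)
  have hom: "reduce p = reduce (pth v)" if "walk E z p v" for p v
    by (rule walk_homotopic[of E, OF that]) (use assms(4) triv in auto)
  have "reduce (pth u @ take k q) = reduce (pth (f k))" for k
    by (rule hom) (use f(1)[of k] assms(5)[OF q(3)] in auto)
  from this[of j] this[of i]
  have "reduce (pth u @ take i q @ r) = reduce (pth (f j))" "reduce (pth u @ take i q) = reduce (pth (f i))"
    unfolding split by simp_all
  have "reduce (winv (pth u @ take i q) @ ((pth u @ take i q) @ r)) =
      reduce (winv (pth u @ take i q) @ (pth u @ take i q))"
    by (rule reduce_append_cong) (use ij(3) \<open>reduce (pth u @ take i q @ r) = _\<close> \<open>reduce (pth u @ take i q) = _\<close> in simp_all)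
  then have "reduce r = []"
    using reduce_cancel(1)[of "[]" "pth u @ take i q" r] by simp
  with r show False by (simp add: reduce_reduced)
qed

text \<open>
  If a component of the complement of the order-essential edges is a tree, then the smallest edge
  \<open>e\<close> leaving it is not largest on any line: such a line has to leave the tree again.
\<close>
theorem card_ess_le:
  assumes "finite E" "finite V" "det E" "E \<subseteq> V \<times> UNIV \<times> V" "conn V E" "ess E \<noteq> {}"
  shows "card V + card (ess E) \<le> card E"
proof (rule ccontr)
  assume "\<not> ?thesis"
  moreover have "card (E - ess E) = card E - card (ess E)" "card (ess E) \<le> card E"
    using assms(1) ess_subset[of E] by (simp_all add: card_Diff_subset finite_subset card_mono)
  ultimately have less: "card (E - ess E) < card V" by simp
  obtain U EU where U: "U \<subseteq> V" "U \<noteq> {}" "EU = {(u, x, w) \<in> E - ess E. u \<in> U}" "EU \<subseteq> U \<times> UNIV \<times> U"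
    and closed: "\<And>u x w. (u, x, w) \<in> E - ess E \<Longrightarrow> u \<in> U \<longleftrightarrow> w \<in> U"
    and "conn U EU" and card: "card EU < card U"
  proof (rule ex_tree_component[OF _ _ _ less])
    show "finite V" "finite (E - ess E)" "E - ess E \<subseteq> V \<times> UNIV \<times> V" using assms by auto
  qed (rule that)
  have finU: "finite U" using U(1) assms(2) finite_subset by blast
  obtain z where z: "z \<in> U" using U(2) by blast
  obtain T pth where T: "T \<subseteq> EU" "card T + 1 = card U" "pth z = []"
    and pth: "\<And>v. v \<in> U \<Longrightarrow> walk EU z (pth v) v"
    and triv: "\<And>u x w. (u, x, w) \<in> T \<Longrightarrow> reduce (pth u @ (x, True) # winv (pth w)) = []"
    by (rule spanning_tree[OF finU U(4) \<open>conn U EU\<close> z]) blast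
  have "finite EU" using assms(1) by (auto simp: U(3) intro: finite_subset)
  \<comment> \<open>A connected graph with fewer edges than vertices is its own spanning
    tree.\<close>
  then have "T = EU" using T(1,2) card by (intro card_seteq) auto
  note triv = triv[unfolded this]
  define Bd where "Bd = {(u, d, w). u \<in> U \<and> traverse (ess E) u d w}"
  \<comment> \<open>Otherwise connectedness gives \<open>U = V\<close>, and then any order-essential
    edge starts in \<open>U\<close> after all.\<close>
  have "Bd \<noteq> {}"
  proof
    assume "Bd = {}"
    then have "u \<notin> U \<and> w \<notin> U" if "(u, x, w) \<in> ess E" for u x w
      using that unfolding Bd_def traverse_def by (metis (mono_tags, lifting) case_prodI empty_Collect_eq fst_conv snd_conv)
    with closed have "u \<in> U \<longleftrightarrow> w \<in> U" if "(u, x, w) \<in> E" for u x w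
      using that by (cases "(u, x, w) \<in> ess E") blast+
    then have "U = V" using connD[OF assms(5) U(1,2)] by blast
    moreover obtain u x w where e: "(u, x, w) \<in> ess E" using assms(6) by auto
    moreover have "u \<in> V" using e ess_subset[of E] assms(4) by auto
    ultimately show False using \<open>_ \<Longrightarrow> u \<notin> U \<and> w \<notin> U\<close> by blast
  qed
  moreover have "finite Bd"
  proof (rule finite_subset)
    show "Bd \<subseteq> (\<lambda>((u, x, w), s). if s then (u, (x, True), w) else (w, (x, False), u)) ` (ess E \<times> UNIV)"
      by (force simp: Bd_def traverse_def split: if_splits)
    show "finite ((\<lambda>((u, x, w), s). if s then (u, (x, True), w) else (w, (x, False), u)) ` (ess E \<times> UNIV))"
      using assms(1) ess_subset[of E] by (auto dest: finite_subset)
  qed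
  \<comment> \<open>\<open>pth\<close> lifts the tree to the Cayley tree, and the smallest key is
    taken among the lifted order-essential darts that start in it.\<close>
  ultimately obtain u d w where Bd: "(u, d, w) \<in> Bd"
    and min: "\<And>u' d' w'. (u', d', w') \<in> Bd \<Longrightarrow> \<not> kless (ekey (pth u') d') (ekey (pth u) d)"
    using kless_min[of "(\<lambda>(u, d, w). ekey (pth u) d) ` Bd"] by fastforce
  have u: "u \<in> U" and "deep E (dart_inv d) u"
    using Bd by (cases d; auto simp: Bd_def traverse_def ess_def dart_inv_def split: if_splits)+
  \<comment> \<open>One dart more than a reduced walk in a tree on \<open>U\<close> can
    have.\<close>
  then obtain q b where q: "length q = card U" "walk E u q b" "reduced (dart_inv d # q)" "fall (dart_inv d) q"
    unfolding deep_def falls_def by blast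
  \<comment> \<open>The falling path can never use an order-essential dart: its key would not be
    below that of \<open>d\<close>, by minimality. So it is trapped in the tree.\<close>
  have "\<exists>v. walk EU u (take i q) v" if "i \<le> length q" for i
    using that
  proof (induction i)
    case (Suc i)
    then obtain v where v: "walk EU u (take i q) v" by auto
    have "EU \<subseteq> E" using U(3) by auto
    then have "walk E u (take i q) v" using v by (rule walk_mono[rotated])
    moreover have qi: "q = take i q @ q ! i # drop (Suc i) q" using Suc.prems by (simp add: id_take_nth_drop)
    then obtain v' t where "walk E u (take i q) v'" "traverse E v' (q ! i) t" using q(2)
      by (metis walk.simps(2) walk_append)
    ultimately have st: "traverse E v (q ! i) t" using walk_det[OF assms(3)] by blast
    have vU: "v \<in> U" using walk_subset[OF U(4) v u] .
    have "traverse EU v (q ! i) t"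
    proof (cases "traverse (ess E) v (q ! i) t")
      case True
      then have "(v, q ! i, t) \<in> Bd" using vU by (simp add: Bd_def)
      from min[OF this] have "\<not> kless (ekey (pth v) (q ! i)) (ekey (pth u) d)" .
      moreover have "ekey (pth v) (q ! i) = ekey ((pth u @ [d]) @ dart_inv d # take i q) (q ! i)"
      proof (rule ekey_cong)
        have "reduce (pth v) = reduce (pth u @ take i q)"
        proof (rule walk_homotopic[of EU z "pth u @ take i q" v pth, symmetric])
          show "walk EU z (pth u @ take i q) v" using pth[OF u] v by auto
        qed (use T(3) triv in auto)
        then show "reduce (pth v) = reduce ((pth u @ [d]) @ dart_inv d # take i q)"
          using reduce_cancel(2)[of "pth u" "[d]" "take i q"] by simp
      qed
      moreover have "ekey (pth u) d = ekey ((pth u @ [d]) @ []) (dart_inv d)"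
        by (simp add: ekey_inv)
      ultimately have "\<not> kless (ekey (dart_inv d # take i q) (q ! i)) (ekey [] (dart_inv d))"
        by (simp only: ekey_append kless_translate_iff not_False_eq_True)
      moreover have "fall (dart_inv d) (take i q @ q ! i # drop (Suc i) q)" using q(4) qi by simp
      ultimately show ?thesis by (auto dest: fallD)
    next
      case False
      then show ?thesis
        using st vU closed[of v "fst (q ! i)" t] closed[of t "fst (q ! i)" v]
        by (auto simp: traverse_def U(3) split: if_splits)
    qed
    with v show ?case using Suc.prems by (auto simp: take_Suc_conv_app_nth)
  qed auto
  from this[of "length q"] obtain v where "walk EU u q v" by auto
  moreover have "reduced q" using q(3) by (simp add: reduced_Cons)
  ultimately have "length q < card U"
    using reduced_walk_in_tree_short[OF finU U(4) z T(3) pth triv _ _ u] by blast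
  with q(1) show False by simp
qed

section \<open>Subgroups of the fundamental group of a bouquet\<close>

lemma reduce_reduce [simp]: "reduce (reduce p) = reduce p"
  by (simp add: reduce_reduced reduced_reduce)

lemma reduce_winv: "reduce (winv p) = winv (reduce p)"
proof -
  have "reduce (winv p @ reduce p) = []" by (simp add: reduce_append_reduce)
  then have "reduce (winv p) = reduce (winv (reduce p))" by (simp add: reduce_eq_iff)
  then show ?thesis by (simp add: reduce_reduced reduced_reduce)
qed

lemma set_winv: "set (winv p) = dart_inv ` set p"
  by (simp add: winv_def)

lemma fst_dart_inv [simp]: "fst (dart_inv d) = fst d"
  by (simp add: dart_inv_def)

locale bouquet_graph =
  fixes n :: nat and B :: "('w, 'e) pre_digraph" and b :: 'w
  assumes bouquet: "bouquet n B b"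
begin

abbreviation "G \<equiv> pi1 B b"

lemma wf_B: "wf_digraph B"
  using bouquet by (simp add: bouquet_def fin_digraph_def)

lemma group_G: "group G"
  using bouquet by (intro group_pi1[OF wf_B]) (simp add: bouquet_def)

lemma edge_path_iff: "edge_path B b p b \<longleftrightarrow> fst ` set p \<subseteq> arcs B"
proof (induction p)
  case (Cons d p)
  have "tail B e = b \<and> head B e = b" if "e \<in> arcs B" for e
    using that bouquet wf_digraph.wellformed[OF wf_B] by (auto simp: bouquet_def)
  then have "head (double B) d = b \<and> tail (double B) d = b" if "fst d \<in> arcs B"
    using that by (cases d) (simp add: double_def)
  moreover have "d \<in> arcs (double B) \<longleftrightarrow> fst d \<in> arcs B" by (cases d) (simp add: double_def)
  ultimately show ?case using Cons by (auto simp: edge_path_Cons[OF wf_B])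
qed (use bouquet in \<open>simp add: edge_path_Nil bouquet_def\<close>)

lemma carrier_G: "carrier G = {p. fst ` set p \<subseteq> arcs B \<and> reduced p}"
  by (simp add: pi1_def edge_path_iff)

lemma G_simps [simp]: "p \<otimes>\<^bsub>G\<^esub> q = reduce (p @ q)" "\<one>\<^bsub>G\<^esub> = []"
  by (simp_all add: pi1_def)

lemma inv_G: assumes "p \<in> carrier G" shows "inv\<^bsub>G\<^esub> p = winv p"
proof (rule group.inv_equality[OF group_G _ assms])
  show "winv p \<in> carrier G"
    using assms by (simp add: carrier_G set_winv image_image)
qed simp

lemma subgroup_memD: "subgroup K G \<Longrightarrow> k \<in> K \<Longrightarrow> reduced k"
  using subgroup.mem_carrier[of K G k] by (simp add: carrier_G)

lemma subgroup_reduce: "subgroup K G \<Longrightarrow> k \<in> K \<Longrightarrow> reduce k = k"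
  by (simp add: reduce_reduced subgroup_memD)

text \<open>The generators are the edges outside a spanning tree, closed up to loops by tree paths;
  there are |E| - (|V| - 1) of them.\<close>

lemma group_rank_le:
  assumes J: "subgroup J G" "J = {k. reduced k \<and> walk E z k z}"
    and E: "finite E" "finite V" "det E" "E \<subseteq> V \<times> UNIV \<times> V" "conn V E" "z \<in> V"
  shows "group_rank (G\<lparr>carrier := J\<rparr>) \<le> enat (card E + 1 - card V)"
proof -
  obtain T pth where T: "T \<subseteq> E" "finite T" "card T + 1 = card V" "pth z = []"
    and pth: "\<And>v. v \<in> V \<Longrightarrow> walk E z (pth v) v"
    and triv: "\<And>u x w. (u, x, w) \<in> T \<Longrightarrow> reduce (pth u @ (x, True) # winv (pth w)) = []"
    by (rule spanning_tree[OF E(2,4,5,6)]) blast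
  define g where "g = (\<lambda>(u, x, w). reduce (pth u @ (x, True) # winv (pth w)))"
  define S where "S = g ` (E - T)"
  have "g e \<in> J" if eE: "e \<in> E" for e
  proof -
    obtain u x w where e: "e = (u, x, w)" "(u, x, w) \<in> E" using eE by (cases e) auto
    then have "u \<in> V" "w \<in> V" using E(4) by auto
    then have "walk E z (pth u @ (x, True) # winv (pth w)) z"
      using pth e(2) by (auto simp: traverse_def)
    then show ?thesis by (simp add: J(2) e(1) g_def reduced_reduce walk_reduce[OF E(3)])
  qed
  then have SJ: "S \<subseteq> J" by (auto simp: S_def)
  have SG: "S \<subseteq> carrier G" using SJ J(1) subgroup.subset by blast
  \<comment> \<open>Telescoping: each further dart contributes one factor, which is a generator, the
    inverse of one, or trivial for an edge of \<open>T\<close>.\<close>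
  have gen: "reduce (p @ winv (pth v)) \<in> generate G S" if "walk E z p v" for p v
    using that
  proof (induction p arbitrary: v rule: rev_induct)
    case Nil
    then have "pth v = []" using T(4) by simp
    then show ?case using generate.one[of G S] by (simp add: reduce_reduced)
  next
    case (snoc d p)
    then obtain u where u: "walk E z p u" "traverse E u d v" by auto
    let ?h = "reduce (pth u @ d # winv (pth v))"
    have "?h \<in> generate G S"
    proof (cases "snd d")
      case True
      then have e: "(u, fst d, v) \<in> E" "?h = g (u, fst d, v)"
        using u(2) by (cases d; simp add: traverse_def g_def)+
      show ?thesis
      proof (cases "(u, fst d, v) \<in> T")
        case True
        then have "?h = []" using triv e(2) by (simp add: g_def)
        then show ?thesis using generate.one[of G S] by simp
      next
        case False
        then have "?h \<in> S" using e by (auto simp: S_def)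
        then show ?thesis by (rule generate.incl)
      qed
    next
      case False
      have "?h = reduce (winv (pth v @ dart_inv d # winv (pth u)))" by simp
      also have "\<dots> = winv (g (v, fst d, u))"
        using False by (cases d) (simp only: reduce_winv g_def case_prod_conv dart_inv_def fst_conv snd_conv simp_thms)
      finally have h: "?h = winv (g (v, fst d, u))" .
      have e: "(v, fst d, u) \<in> E" using u(2) False by (simp add: traverse_def)
      show ?thesis
      proof (cases "(v, fst d, u) \<in> T")
        case True
        then have "?h = []" using triv h by (simp add: g_def)
        then show ?thesis using generate.one[of G S] by simp
      next
        case False
        then have "g (v, fst d, u) \<in> S" using e by (auto simp: S_def)
        then show ?thesis using generate.inv[of "g (v, fst d, u)" S G] inv_G SG h by auto
      qed
    qed
    from generate.eng[OF snoc.IH[OF u(1)] this]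
    have "reduce (p @ winv (pth u) @ pth u @ d # winv (pth v)) \<in> generate G S"
      by (simp add: reduce_append_reduce)
    then show ?case by simp
  qed
  have "generate G S = J"
  proof
    show "generate G S \<subseteq> J" using group.generate_subgroup_incl[OF group_G SJ J(1)] .
    show "J \<subseteq> generate G S"
    proof
      fix p assume "p \<in> J"
      then show "p \<in> generate G S" using gen[of p z] T(4) by (simp add: J(2) reduce_reduced)
    qed
  qed
  then have "generate (G\<lparr>carrier := J\<rparr>) S = J"
    using group.generate_consistent[OF group_G SJ J(1)] by simp
  moreover have "finite S" using E(1) by (simp add: S_def)
  moreover have "card S \<le> card E + 1 - card V"
  proof -
    have "card S \<le> card (E - T)" unfolding S_def using E(1) by (intro card_image_le) simp
    also have "\<dots> = card E - card T" using T(1,2) by (simp add: card_Diff_subset)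
    finally show ?thesis using T(3) by simp
  qed
  ultimately show ?thesis
    unfolding group_rank_def using SJ by (intro INF_lower2[of S]) auto
qed

lemma generate_induct_words [consumes 2, case_names one incl inv eng]:
  assumes "k \<in> generate G S" "S \<subseteq> carrier G"
    and "P []" "\<And>s. s \<in> S \<Longrightarrow> P s" "\<And>s. s \<in> S \<Longrightarrow> P (winv s)"
    and "\<And>p q. P p \<Longrightarrow> P q \<Longrightarrow> P (reduce (p @ q))"
  shows "P k"
  using assms(1)
proof induction
  case (inv h)
  then show ?case using assms(2,5) inv_G[of h] by auto
qed (use assms in auto)

end

text \<open>
  The double cover of a graph in which precisely the edges from \<open>F\<close> change the sheet; it computes
  the number of edges from \<open>F\<close> modulo 2 along a path.
\<close>
definition cover :: "('v \<times> 'l \<times> 'v) set \<Rightarrow> ('v \<times> 'l \<times> 'v) set \<Rightarrow> (('v \<times> bool) \<times> 'l \<times> ('v \<times> bool)) set" where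
  "cover E F = {((u, a), x, (w, a')) |u x w a a'. (u, x, w) \<in> E \<and> (a' \<longleftrightarrow> a \<noteq> ((u, x, w) \<in> F))}"

lemma traverse_cover_iff:
  "traverse (cover E F) (u, a) d (w, a') \<longleftrightarrow> traverse E u d w \<and>
    (a' \<longleftrightarrow> a \<noteq> ((if snd d then (u, fst d, w) else (w, fst d, u)) \<in> F))"
  by (auto simp: traverse_def cover_def)

lemma det_cover: "det E \<Longrightarrow> det (cover E F)"
  unfolding det_def
proof (intro allI impI)
  fix v d w w'
  assume det: "\<forall>u d w w'. traverse E u d w \<longrightarrow> traverse E u d w' \<longrightarrow> w = w'"
    and st: "traverse (cover E F) v d w" "traverse (cover E F) v d w'"
  obtain u a w1 a1 w2 a2 where eq: "v = (u, a)" "w = (w1, a1)" "w' = (w2, a2)"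
    by (cases v, cases w, cases w') blast
  have "w1 = w2" using det st unfolding eq traverse_cover_iff by blast
  then show "w = w'" using st by (simp add: eq traverse_cover_iff)
qed

lemma walk_cover_lift: "walk E u p v \<Longrightarrow> \<exists>a'. walk (cover E F) (u, a) p (v, a')"
proof (induction p arbitrary: u a)
  case (Cons d p)
  then obtain w where w: "traverse E u d w" "walk E w p v" by auto
  define a1 where "a1 = (a \<noteq> ((if snd d then (u, fst d, w) else (w, fst d, u)) \<in> F))"
  have "traverse (cover E F) (u, a) d (w, a1)" using w(1) by (simp add: traverse_cover_iff a1_def)
  moreover obtain a' where "walk (cover E F) (w, a1) p (v, a')" using Cons.IH[OF w(2)] by blast
  ultimately show ?case by auto
qed auto

text \<open>Exchanging the two sheets is an automorphism of the cover.\<close>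

lemma walk_cover_flip: "walk (cover E F) (u, a) p (v, a') \<Longrightarrow> walk (cover E F) (u, \<not> a) p (v, \<not> a')"
proof (induction p arbitrary: u a)
  case (Cons d p)
  then obtain w a1 where "traverse (cover E F) (u, a) d (w, a1)" "walk (cover E F) (w, a1) p (v, a')" by auto
  with Cons.IH[of w a1] show ?case
    by (auto simp: traverse_cover_iff intro!: exI[of _ w] exI[of _ "\<not> a1"])
qed auto

lemma walk_cover_shift: "walk (cover E F) (u, a) p (v, a') \<Longrightarrow> walk (cover E F) (u, a \<noteq> c) p (v, a' \<noteq> c)"
  using walk_cover_flip[of E F u a p v a'] by (cases c) auto

section \<open>Lower bound for the number of generators\<close>

context bouquet_graph
begin

text \<open>A set \<open>F\<close> of edges is a cochain modulo 2. Its parities along the paths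
  \<open>pth v\<close> and along the generators determine its parity on every loop at
  \<open>z\<close>, and thereby \<open>F\<close>. So 2^|D| is at most 2^(|V| - 1 + |S|).\<close>

lemma card_edges_le_generators:
  assumes "finite D" "finite V" "det D" "D \<subseteq> V \<times> UNIV \<times> V" "z \<in> V" "finite S" "S \<subseteq> carrier G"
    and reach: "\<And>v. v \<in> V \<Longrightarrow> \<exists>p. walk D z p v"
    and S: "\<And>s. s \<in> S \<Longrightarrow> walk D z s z"
    and gen: "\<And>p. walk D z p z \<Longrightarrow> reduce p \<in> generate G S"
  shows "card D + 1 \<le> card V + card S"
proof -
  have "\<forall>v\<in>V - {z}. \<exists>p. walk D z p v" using reach by blast
  then obtain pth0 where pth0: "\<And>v. v \<in> V \<Longrightarrow> v \<noteq> z \<Longrightarrow> walk D z (pth0 v) v" by (metis DiffI singletonD)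
  define pth where "pth = pth0(z := [])"
  have pth: "walk D z (pth v) v" if "v \<in> V" for v using pth0 that by (simp add: pth_def)
  define \<phi> where "\<phi> F = ({v \<in> V - {z}. walk (cover D F) (z, False) (pth v) (v, True)},
      {s \<in> S. walk (cover D F) (z, False) s (z, True)})" for F
  have "inj_on \<phi> (Pow D)"
  proof (rule inj_onI)
    fix F F' assume F: "F \<in> Pow D" "F' \<in> Pow D" "\<phi> F = \<phi> F'"
    define agree where "agree p v \<longleftrightarrow> (\<exists>a. walk (cover D F) (z, False) p (v, a) \<and> walk (cover D F') (z, False) p (v, a))" for p v
    have det: "det (cover D F)" "det (cover D F')" using det_cover assms(3) by blast+
    have agreeI: "agree p v" if p: "walk D z p v"
      and iff: "walk (cover D F) (z, False) p (v, True) \<longleftrightarrow> walk (cover D F') (z, False) p (v, True)" for p v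
    proof -
      obtain a a' where "walk (cover D F) (z, False) p (v, a)" "walk (cover D F') (z, False) p (v, a')"
        using walk_cover_lift[OF p] by metis
      with iff show ?thesis unfolding agree_def by (cases a; cases a') auto
    qed
    have 1: "agree (pth v) v" if "v \<in> V" for v
    proof (cases "v = z")
      case False
      then show ?thesis using that F(3) pth by (intro agreeI) (auto simp: \<phi>_def set_eq_iff)
    next
      case True
      then show ?thesis unfolding agree_def by (intro exI[of _ False]) (simp add: pth_def)
    qed
    have 2: "agree s z" if "s \<in> S" for s
      using that F(3) S by (intro agreeI) (auto simp: \<phi>_def set_eq_iff)
    \<comment> \<open>Parity is additive under concatenation and unchanged by reduction, so
      agreement spreads from \<open>S\<close> to the generated group.\<close>
    have 3: "agree k z" if "k \<in> generate G S" for k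
      using that assms(7)
    proof (induction rule: generate_induct_words)
      case (inv s)
      then obtain a where "walk (cover D F) (z, a) (winv s) (z, False)" "walk (cover D F') (z, a) (winv s) (z, False)"
        using 2 by (auto simp: agree_def)
      from this[THEN walk_cover_shift[where c = a]] show ?case by (auto simp: agree_def)
    next
      case (eng p q)
      then obtain a c where *: "walk (cover D F) (z, False) p (z, a)" "walk (cover D F') (z, False) p (z, a)"
        "walk (cover D F) (z, False) q (z, c)" "walk (cover D F') (z, False) q (z, c)"
        by (auto simp: agree_def)
      from *(3,4)[THEN walk_cover_shift[where c = a]] *(1,2)
      have "walk (cover D F) (z, False) (p @ q) (z, c \<noteq> a)" "walk (cover D F') (z, False) (p @ q) (z, c \<noteq> a)"
        by auto
      from this(1)[THEN walk_reduce[OF det(1)]] this(2)[THEN walk_reduce[OF det(2)]]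
      show ?case unfolding agree_def by blast
    next
      case one
      show ?case by (auto simp: agree_def)
    qed (rule 2)
    have "(u, x, w) \<in> F \<longleftrightarrow> (u, x, w) \<in> F'" if e: "(u, x, w) \<in> D" for u x w
    proof -
      let ?p = "pth u @ (x, True) # winv (pth w)"
      have uw: "u \<in> V" "w \<in> V" using e assms(4) by auto
      obtain \<alpha> \<gamma> where ag: "walk (cover D F) (z, False) (pth u) (u, \<alpha>)" "walk (cover D F') (z, False) (pth u) (u, \<alpha>)"
        "walk (cover D F) (z, False) (pth w) (w, \<gamma>)" "walk (cover D F') (z, False) (pth w) (w, \<gamma>)"
        using 1 uw unfolding agree_def by blast
      \<comment> \<open>The loop through the edge ends in the sheet given by the parities of both
        paths and the membership of the edge in \<open>A\<close>; the first two are known, so the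
        third can be read off.\<close>
      have end_at: "walk (cover D A) (z, False) (reduce ?p) (z, \<gamma> \<noteq> (\<alpha> \<noteq> ((u, x, w) \<in> A)))"
        if "walk (cover D A) (z, False) (pth u) (u, \<alpha>)" "walk (cover D A) (z, False) (pth w) (w, \<gamma>)" for A
      proof (rule walk_reduce[OF det_cover[OF assms(3)]])
        let ?\<beta> = "\<alpha> \<noteq> ((u, x, w) \<in> A)"
        have "walk (cover D A) (w, \<gamma>) (winv (pth w)) (z, False)" using that(2) by simp
        from walk_cover_shift[OF this, of "\<gamma> \<noteq> ?\<beta>"]
        have "walk (cover D A) (w, ?\<beta>) (winv (pth w)) (z, \<gamma> \<noteq> ?\<beta>)"
          by (cases \<gamma>; cases ?\<beta>) simp_all
        moreover have "traverse (cover D A) (u, \<alpha>) (x, True) (w, ?\<beta>)"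
          unfolding traverse_cover_iff using e by (simp add: traverse_def)
        ultimately show "walk (cover D A) (z, False) ?p (z, \<gamma> \<noteq> ?\<beta>)"
          using that(1) by auto
      qed
      have "walk D z ?p z" using pth uw e by (auto simp: traverse_def)
      then have "agree (reduce ?p) z" using gen 3 by blast
      then obtain a where a: "walk (cover D F) (z, False) (reduce ?p) (z, a)"
        "walk (cover D F') (z, False) (reduce ?p) (z, a)" by (auto simp: agree_def)
      have "(z, a) = (z, \<gamma> \<noteq> (\<alpha> \<noteq> ((u, x, w) \<in> F)))"
        using walk_det[OF det(1) a(1) end_at[OF ag(1,3)]] .
      moreover have "(z, a) = (z, \<gamma> \<noteq> (\<alpha> \<noteq> ((u, x, w) \<in> F')))"
        using walk_det[OF det(2) a(2) end_at[OF ag(2,4)]] .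
      ultimately show ?thesis by blast
    qed
    with F(1,2) show "F = F'" by auto
  qed
  moreover have "\<phi> ` Pow D \<subseteq> Pow (V - {z}) \<times> Pow S" by (auto simp: \<phi>_def)
  ultimately have "card (Pow D) \<le> card (Pow (V - {z}) \<times> Pow S)"
    using assms(2,6) by (intro card_inj_on_le[of \<phi>]) auto
  then have "2 ^ card D \<le> (2::nat) ^ (card (V - {z}) + card S)"
    using assms(1,2,6) by (simp add: card_Pow card_cartesian_product power_add)
  then have "card D \<le> card (V - {z}) + card S" by (rule power_le_imp_le_exp[rotated]) simp
  moreover have "card (V - {z}) + 1 = card V" using assms(2,5) by (metis Suc_eq_plus1 card_Suc_Diff1)
  ultimately show ?thesis by simp
qed

text \<open>The graph is the part of the Schreier coset graph of \<open>K\<close> covered by the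
  loops of the generators. Cosets make it deterministic at once, and
  \<open>card_edges_le_generators\<close> supplies the edge count.\<close>

lemma ex_schreier_graph:
  assumes K: "subgroup K G" and S: "finite S" "S \<subseteq> K" "generate G S = K"
  obtains D :: "('e dart list set \<times> 'e \<times> 'e dart list set) set" and V z where
    "finite D" "finite V" "det D" "D \<subseteq> V \<times> arcs B \<times> V" "conn V D" "z \<in> V"
    "card D + 1 \<le> card V + card S" "K = {k. reduced k \<and> walk D z k z}"
proof -
  define c where "c p = (\<lambda>k. reduce (k @ p)) ` K" for p
  have SG: "S \<subseteq> carrier G" using S(2) K subgroup.subset by blast
  have c_cong: "c p = c q" if "reduce p = reduce q" for p q
    using that unfolding c_def by (auto intro!: image_cong reduce_append_cong)
  have c_snoc: "c (p @ [d]) = (\<lambda>k. reduce (k @ [d])) ` c p" for p d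
    by (simp add: c_def image_image reduce_append_reduce)
  have c_eqD: "reduce (p @ winv q) \<in> K" if eq: "c p = c q" for p q
  proof -
    have "reduce p \<in> c p" using subgroup.one_closed[OF K] by (force simp: c_def)
    then obtain k where k: "k \<in> K" "reduce p = reduce (k @ q)" unfolding eq by (auto simp: c_def)
    then have "reduce (p @ winv q) = reduce ((k @ q) @ winv q)" by (intro reduce_append_cong) simp_all
    also have "\<dots> = reduce k" using reduce_cancel(2)[of k q "[]"] by simp
    finally show ?thesis using k(1) subgroup_reduce[OF K] by simp
  qed
  have c_mem: "c k = c []" if "k \<in> K" for k
  proof
    show "c k \<subseteq> c []"
    proof
      fix p assume "p \<in> c k"
      then obtain l where l: "l \<in> K" "p = reduce (l @ k)" by (auto simp: c_def)
      then have "p \<in> K" using subgroup.m_closed[OF K l(1) that] by simp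
      then show "p \<in> c []" using subgroup_reduce[OF K] by (force simp: c_def)
    qed
    have "winv k \<in> K" using subgroup.m_inv_closed[OF K that] inv_G subgroup.mem_carrier[OF K that] by simp
    show "c [] \<subseteq> c k"
    proof
      fix p assume "p \<in> c []"
      then obtain l where l: "l \<in> K" "p = reduce l" by (auto simp: c_def)
      then have "reduce (l @ winv k) \<in> K" using subgroup.m_closed[OF K l(1) \<open>winv k \<in> K\<close>] by simp
      moreover have "p = reduce (reduce (l @ winv k) @ k)"
        using reduce_cancel(1)[of l k "[]"] l(2) by (simp add: reduce_append_reduce)
      ultimately show "p \<in> c k" by (auto simp: c_def)
    qed
  qed
  \<comment> \<open>The edge crossed by the letter \<open>i\<close> of the loop reading
    \<open>s\<close>; here \<open>c p\<close> is the right coset of \<open>p\<close>, and the sign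
    of the letter fixes the orientation.\<close>
  define ed where "ed = (\<lambda>(s, i). let p = take i s; d = s ! i in
      if snd d then (c p, fst d, c (p @ [d])) else (c (p @ [d]), fst d, c p))"
  define D where "D = ed ` (SIGMA s:S. {..<length s})"
  define V where "V = insert (c []) (fst ` D \<union> (snd \<circ> snd) ` D)"
  have fin: "finite D" "finite V" using S(1) by (auto simp: D_def V_def)
  have traverseD: "\<exists>p. C = c p \<and> C' = c (p @ [d])" if st: "traverse D C d C'" for C d C'
  proof -
    obtain s i where si: "s \<in> S" "i < length s" "ed (s, i) = (if snd d then (C, fst d, C') else (C', fst d, C))"
      using st by (auto simp: traverse_def D_def split: if_splits)
    show ?thesis
    proof (cases "snd d = snd (s ! i)")
      case True
      then show ?thesis
        using si(3) by (cases d; cases "s ! i") (auto simp: ed_def Let_def split: if_splits)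
    next
      case False
      then have "d = dart_inv (s ! i)" "C = c (take i s @ [s ! i])" "C' = c (take i s)"
        using si(3) by (cases d; cases "s ! i"; auto simp: ed_def Let_def dart_inv_def split: if_splits)+
      moreover have "c ((take i s @ [s ! i]) @ [dart_inv (s ! i)]) = c (take i s)"
        using reduce_cancel(2)[of "take i s" "[s ! i]" "[]"] by (intro c_cong) simp
      ultimately show ?thesis by metis
    qed
  qed
  \<comment> \<open>A dart acts on cosets by right multiplication, so its target is a function of
    its source.\<close>
  then have traverse_eq: "C' = (\<lambda>k. reduce (k @ [d])) ` C" if "traverse D C d C'" for C d C'
    using that c_snoc by blast
  then have det: "det D" unfolding det_def by blast
  have walkD: "C = c (p @ q)" if "walk D (c p) q C" for p q C
    using that
  proof (induction q arbitrary: p)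
    case (Cons d q)
    then obtain C' where "traverse D (c p) d C'" "walk D C' q C" by auto
    with Cons.IH[of "p @ [d]"] traverse_eq c_snoc show ?case by simp
  qed simp
  have prefix: "walk D (c []) (take i s) (c (take i s))" if "s \<in> S" "i \<le> length s" for s i
    using that(2)
  proof (induction i)
    case (Suc i)
    have "ed (s, i) \<in> D" using that(1) Suc.prems by (auto simp: D_def)
    then have "traverse D (c (take i s)) (s ! i) (c (take i s @ [s ! i]))"
      by (auto simp: ed_def Let_def traverse_def split: if_splits)
    with Suc show ?case by (auto simp: take_Suc_conv_app_nth)
  qed simp
  have reach: "\<exists>p. walk D (c []) p v" if v: "v \<in> V" for v
  proof -
    consider "v = c []" | e where "e \<in> D" "v = fst e \<or> v = snd (snd e)"
      using v by (auto simp: V_def)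
    then show ?thesis
    proof cases
      case 1 then show ?thesis by (intro exI[of _ "[]"]) simp
    next
      case 2
      then obtain s i where si: "s \<in> S" "i < length s" "e = ed (s, i)" by (auto simp: D_def)
      then have "v = c (take i s) \<or> v = c (take (Suc i) s)"
        using 2(2) by (auto simp: ed_def Let_def take_Suc_conv_app_nth split: if_splits)
      then show ?thesis using prefix[OF si(1), of i] prefix[OF si(1), of "Suc i"] si(2) by auto
    qed
  qed
  have S_closed: "walk D (c []) s (c [])" if "s \<in> S" for s
    using prefix[OF that, of "length s"] c_mem[of s] that S(2) by auto
  have KD: "K = {k. reduced k \<and> walk D (c []) k (c [])}"
  proof (intro Set.set_eqI iffI)
    fix k assume k: "k \<in> K"
    have "walk D (c []) k (c [])"
      using k[folded S(3)] SG
    proof (induction rule: generate_induct_words)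
      case (eng p q)
      then have "walk D (c []) (p @ q) (c [])" by auto
      then show ?case by (rule walk_reduce[OF det])
    qed (use S_closed in auto)
    then show "k \<in> {k. reduced k \<and> walk D (c []) k (c [])}" using subgroup_memD[OF K k] by simp
  next
    fix k assume k: "k \<in> {k. reduced k \<and> walk D (c []) k (c [])}"
    then have "c k = c []" using walkD[of "[]" k "c []"] by simp
    with c_eqD[of k "[]"] k show "k \<in> K" by (simp add: reduce_reduced)
  qed
  have gen: "reduce p \<in> generate G S" if "walk D (c []) p (c [])" for p
    using walk_reduce[OF det that] by (simp add: S(3) KD reduced_reduce)
  have DV: "D \<subseteq> V \<times> UNIV \<times> V" by (force simp: V_def)
  have "x \<in> arcs B" if e: "(u, x, w) \<in> D" for u x w
  proof -
    obtain s i where si: "s \<in> S" "i < length s" "(u, x, w) = ed (s, i)" using e by (auto simp: D_def)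
    then have "x = fst (s ! i)" by (auto simp: ed_def Let_def split: if_splits)
    moreover have "fst ` set s \<subseteq> arcs B" using SG si(1) by (auto simp: carrier_G)
    ultimately show ?thesis using si(2) by auto
  qed
  then have DB: "D \<subseteq> V \<times> arcs B \<times> V" using DV by auto
  have zV: "c [] \<in> V" by (simp add: V_def)
  have card: "card D + 1 \<le> card V + card S"
    by (rule card_edges_le_generators[OF fin(1,2) det DV zV S(1) SG reach S_closed gen])
  show ?thesis
    by (rule that[OF fin det DB conn_if_reachable[OF reach] zV card KD])
qed

end

section \<open>Arcs and components of a finite graph\<close>

lemma conn_connected:
  assumes "Digraph_Component.connected \<Gamma>"
  shows "conn (verts \<Gamma>) ((\<lambda>e. (tail \<Gamma> e, l e, head \<Gamma> e)) ` arcs \<Gamma>)"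
  unfolding conn_def
proof (intro allI impI)
  fix U assume U: "U \<subseteq> verts \<Gamma>" "U \<noteq> {}"
    "\<forall>(u, x, w)\<in>(\<lambda>e. (tail \<Gamma> e, l e, head \<Gamma> e)) ` arcs \<Gamma>. u \<in> U \<longleftrightarrow> w \<in> U"
  obtain u where u: "u \<in> U" using U(2) by blast
  have "v \<in> U" if "v \<in> verts \<Gamma>" for v
  proof -
    have "(u, v) \<in> rtrancl_on (verts \<Gamma>) (parcs (mk_symmetric \<Gamma>))"
      using assms that u U(1) by (auto simp: connected_def strongly_connected_def reachable_def)
    then have "u \<in> U \<longrightarrow> v \<in> U"
      by induction (use U(3) in \<open>auto simp: parcs_mk_symmetric\<close>)
    with u show ?thesis by blast
  qed
  with U(1) show "U = verts \<Gamma>" by blast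
qed

context fin_digraph
begin

definition lab :: "('b \<Rightarrow> 'l) \<Rightarrow> 'b set \<Rightarrow> ('a \<times> 'l \<times> 'a) set" where
  "lab l A = (\<lambda>e. (tail G e, l e, head G e)) ` A"

lemma lab_iff: "(u, x, w) \<in> lab l A \<longleftrightarrow> (\<exists>e\<in>A. u = tail G e \<and> x = l e \<and> w = head G e)"
  by (auto simp: lab_def)

lemma lab_mono: "A \<subseteq> A' \<Longrightarrow> lab l A \<subseteq> lab l A'"
  by (auto simp: lab_def)

lemma lab_subset: "A \<subseteq> arcs G \<Longrightarrow> lab l A \<subseteq> verts G \<times> UNIV \<times> verts G"
  by (auto simp: lab_def)

text \<open>Each edge is its own label, so that, unlike in \<open>lab\<close>, a walk records which
  edges it uses.\<close>

definition edges :: "'b set \<Rightarrow> ('a \<times> 'b \<times> 'a) set" where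
  "edges A = (\<lambda>e. (tail G e, e, head G e)) ` A"

lemma edges_iff: "(u, e, w) \<in> edges A \<longleftrightarrow> e \<in> A \<and> u = tail G e \<and> w = head G e"
  by (auto simp: edges_def)

lemma walk_lab: "walk (lab l A) u p v \<Longrightarrow> \<exists>ds. walk (edges A) u ds v \<and> p = map (map_prod l (\<lambda>s. s)) ds"
proof (induction p arbitrary: u)
  case (Cons d p)
  then obtain w where "traverse (lab l A) u d w" "walk (lab l A) w p v" by auto
  with Cons.IH[of w] obtain ds where
    w: "traverse (lab l A) u d w" "walk (edges A) w ds v" "p = map (map_prod l (\<lambda>s. s)) ds"
    by blast
  obtain e where "traverse (edges A) u (e, snd d) w" "d = map_prod l (\<lambda>s. s) (e, snd d)"
    using w(1) by (cases d) (auto simp: traverse_def lab_iff edges_iff split: if_splits)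
  with w show ?case by (intro exI[of _ "(e, snd d) # ds"]) auto
qed auto

lemma walk_edges: "walk (edges A) u ds v \<Longrightarrow> walk (lab l A) u (map (map_prod l (\<lambda>s. s)) ds) v"
  using walk_morphism[of "edges A" "\<lambda>u. u" l "lab l A" u ds v] by (auto simp: lab_iff edges_iff id_def)

lemma walk_edges_arcs: "walk (edges A) u ds v \<Longrightarrow> fst ` set ds \<subseteq> A"
  by (induction ds arbitrary: u) (auto simp: traverse_def edges_iff split: if_splits)

lemma walk_edges_restrict:
  "walk (edges A) u ds v \<Longrightarrow> fst ` set ds \<subseteq> A' \<Longrightarrow> walk (edges A') u ds v"
proof (induction ds arbitrary: u)
  case (Cons d ds)
  then obtain w where w: "traverse (edges A) u d w" "walk (edges A) w ds v" by auto
  have "traverse (edges A') u d w" using w(1) Cons.prems(2) by (auto simp: traverse_def edges_iff)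
  moreover have "walk (edges A') w ds v" using Cons.IH[OF w(2)] Cons.prems(2) by simp
  ultimately show ?case by auto
qed simp

lemma component_subset: "component G X x \<subseteq> X"
  by (auto simp: component_def)

lemma finite_component: "X \<subseteq> cells G \<Longrightarrow> finite (Inl -` component G X x)" "X \<subseteq> cells G \<Longrightarrow> finite (Inr -` component G X x)"
proof -
  assume X: "X \<subseteq> cells G"
  have "Inl -` component G X x \<subseteq> verts G" "Inr -` component G X x \<subseteq> arcs G"
    using X component_subset[of X x] by (auto simp: cells_def)
  from this[THEN finite_subset] show "finite (Inl -` component G X x)" "finite (Inr -` component G X x)"
    by simp_all
qed

lemma component_closed:
  assumes "y \<in> component G X x" "(y, z) \<in> incidence G" "z \<in> X"
  shows "z \<in> component G X x"
  using assms by (auto simp: component_def intro: rtrancl_into_rtrancl)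

lemma component_edge_iff:
  assumes X: "X \<subseteq> cells G" "\<And>e. Inr e \<in> X \<Longrightarrow> Inl (tail G e) \<in> X \<and> Inl (head G e) \<in> X"
    and e: "Inr e \<in> X" and v: "v = tail G e \<or> v = head G e"
  shows "Inl v \<in> component G X x \<longleftrightarrow> Inr e \<in> component G X x"
proof -
  have "e \<in> arcs G" using X(1) e by (auto simp: cells_def)
  then have "(Inr e, Inl v) \<in> incidence G" "(Inl v, Inr e) \<in> incidence G" "Inl v \<in> X"
    using v X(2)[OF e] by (auto simp: incidence_def)
  then show ?thesis using component_closed[of _ X x] e by blast
qed

lemma conn_component:
  assumes X: "X \<subseteq> cells G" "\<And>e. Inr e \<in> X \<Longrightarrow> Inl (tail G e) \<in> X \<and> Inl (head G e) \<in> X"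
    and x: "x \<in> X"
  defines "C \<equiv> component G X x"
  shows "conn (Inl -` C) (lab l (Inr -` C))"
  unfolding conn_def
proof (intro allI impI)
  fix U assume U: "U \<subseteq> Inl -` C" "U \<noteq> {}" "\<forall>(u, y, w)\<in>lab l (Inr -` C). u \<in> U \<longleftrightarrow> w \<in> U"
  \<comment> \<open>An edge is judged by its origin, which lets closedness of \<open>U\<close> pass
    along chains of incident cells.\<close>
  define good where "good y \<longleftrightarrow> (case y of Inl v \<Rightarrow> v \<in> U | Inr e \<Rightarrow> tail G e \<in> U)" for y
  have U_edge: "tail G e \<in> U \<longleftrightarrow> head G e \<in> U" if "Inr e \<in> C" for e
    using U(3) that by (auto simp: lab_def)
  have good: "good y \<longleftrightarrow> good x" if "(x, y) \<in> (incidence G \<inter> X \<times> X)\<^sup>*" for y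
    using that
  proof induction
    case (step y z)
    have "y \<in> C" "z \<in> C"
      using step x unfolding C_def component_def by (auto intro: rtrancl_into_rtrancl)
    then have "good y \<longleftrightarrow> good z"
      using step(2) U_edge by (auto simp: incidence_def good_def)
    with step show ?case by simp
  qed simp
  obtain u where "u \<in> U" using U(2) by blast
  then have "good x" using good[of "Inl u"] U(1) by (auto simp: good_def C_def component_def)
  then have "v \<in> U" if "Inl v \<in> C" for v
    using good[of "Inl v"] that by (simp add: good_def C_def component_def)
  with U(1) show "U = Inl -` C" by blast
qed

lemma components_connected:
  assumes "Digraph_Component.connected G" "x \<in> cells G"
  shows "component G (cells G) x = cells G"
proof
  let ?C = "component G (cells G) x"
  have sub: "Inr e \<in> cells G \<Longrightarrow> Inl (tail G e) \<in> cells G \<and> Inl (head G e) \<in> cells G" for e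
    by (auto simp: cells_def)
  have edge: "Inl v \<in> ?C \<longleftrightarrow> Inr e \<in> ?C" if "e \<in> arcs G" "v = tail G e \<or> v = head G e" for e v
    using component_edge_iff[OF subset_refl sub] that by (simp add: cells_def)
  have x: "x \<in> ?C" using assms(2) by (simp add: component_def)
  have "Inl -` ?C = verts G"
  proof (rule connD[OF conn_connected[OF assms(1), of id]])
    show "Inl -` ?C \<subseteq> verts G" using component_subset[of "cells G" x] by (auto simp: cells_def)
    show "Inl -` ?C \<noteq> {}"
    proof (cases x)
      case (Inr e)
      then have "Inl (tail G e) \<in> ?C" using edge[of e "tail G e"] x assms(2) by (auto simp: cells_def)
      then show ?thesis by auto
    qed (use x in auto)
  qed (use edge in auto)
  moreover have "Inr e \<in> ?C" if "e \<in> arcs G" for e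
    using edge[of e "tail G e"] that calculation by auto
  ultimately show "cells G \<subseteq> ?C" by (auto simp: cells_def)
qed (rule component_subset)

lemma reduced_rank_connected:
  assumes "Digraph_Component.connected G"
  shows "reduced_rank G (cells G) = max 0 (int (card (arcs G)) - int (card (verts G)))"
proof -
  have "verts G \<noteq> {}" using assms by (auto simp: connected_def strongly_connected_def)
  then have "components G (cells G) = {cells G}"
    using components_connected[OF assms] by (auto simp: components_def cells_def)
  moreover have "Inl -` cells G = verts G" "Inr -` cells G = arcs G" by (auto simp: cells_def)
  ultimately show ?thesis by (simp add: reduced_rank_def euler_char_def)
qed

text \<open>Falling paths stay in the component of their edge. With an order-essential edge,
  \<open>card_ess_le\<close> would give this component more edges than vertices, and it would
  contribute to the reduced rank.\<close>

lemma ess_empty_if_reduced_rank_0: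
  assumes A: "A \<subseteq> arcs G" and det: "det (lab l A)"
    and inj: "inj_on (\<lambda>e. (tail G e, l e, head G e)) A"
    and rank: "reduced_rank G (cells G - Inr ` (arcs G - A)) = 0"
  shows "ess (lab l A) = {}"
proof (rule ccontr)
  assume "ess (lab l A) \<noteq> {}"
  then obtain u x w where ess: "(u, x, w) \<in> ess (lab l A)" by auto
  then have "(u, x, w) \<in> lab l A" using ess_subset by blast
  then obtain e where e: "e \<in> A" "u = tail G e" "x = l e" "w = head G e"
    by (auto simp: lab_iff)
  define X where "X = cells G - Inr ` (arcs G - A)"
  define C where "C = component G X (Inr e)"
  have X: "X \<subseteq> cells G" "\<And>e. Inr e \<in> X \<longleftrightarrow> e \<in> A" "\<And>v. Inl v \<in> X \<longleftrightarrow> v \<in> verts G"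
    using A by (auto simp: X_def cells_def)
  have sub: "Inl (tail G e) \<in> X \<and> Inl (head G e) \<in> X" if "Inr e \<in> X" for e
    using that A by (auto simp: X)
  note edge = component_edge_iff[OF X(1) sub, where x = "Inr e", folded C_def]
  have finC: "finite (Inl -` C)" "finite (Inr -` C)"
    unfolding C_def by (rule finite_component[OF X(1)])+
  have eC: "Inr e \<in> C" using e(1) by (simp add: C_def component_def X)
  have CA: "Inr -` C \<subseteq> A" using component_subset[of X "Inr e"] X(2) by (auto simp: C_def)
  have "finite (components G X)"
    using finite_subset[OF X(1)] by (simp add: components_def cells_def)
  moreover have "(\<Sum>C\<in>components G X. max 0 (- euler_char C)) = 0"
    using rank by (simp add: reduced_rank_def X_def)
  moreover have "C \<in> components G X" using e(1) by (auto simp: C_def components_def X)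
  ultimately have "max 0 (- euler_char C) = 0"
    by (subst (asm) sum_nonneg_eq_0_iff) auto
  then have card: "card (Inr -` C) \<le> card (Inl -` C)" by (simp add: euler_char_def)
  let ?E = "lab l (Inr -` C)"
  have stay: "walk ?E u p v" if "walk (lab l A) u p v" "Inl u \<in> C" for u p v
    using that
  proof (induction p arbitrary: u)
    case (Cons d p)
    then obtain w where w: "traverse (lab l A) u d w" "walk (lab l A) w p v" by auto
    then have "traverse ?E u d w \<and> Inl w \<in> C"
      using Cons.prems(2) edge by (auto simp: traverse_def lab_iff X split: if_splits)
    with Cons.IH[OF w(2)] show ?case by auto
  qed simp
  have "deep ?E d u" if "deep (lab l A) d u" "Inl u \<in> C" for d u
    using that stay unfolding deep_def falls_def by meson
  moreover have "Inl u \<in> C" "Inl w \<in> C" using edge[of e] e eC by (auto simp: X)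
  ultimately have "(u, x, w) \<in> ess ?E" using ess eC e by (auto simp: ess_def lab_iff)
  then have "ess ?E \<noteq> {}" by auto
  moreover have "finite ?E" using finC by (simp add: lab_def)
  moreover have "det ?E" using det lab_mono[OF CA] by (rule det_subset)
  moreover have "?E \<subseteq> (Inl -` C) \<times> UNIV \<times> (Inl -` C)"
    using edge CA by (auto simp: lab_def X)
  moreover have "conn (Inl -` C) ?E"
    unfolding C_def by (rule conn_component[OF X(1) sub]) (use e in \<open>auto simp: X\<close>)
  ultimately have "card (Inl -` C) + card (ess ?E) \<le> card ?E"
    using finC by (intro card_ess_le)
  moreover have "card ?E \<le> card (Inr -` C)" unfolding lab_def by (rule card_image_le[OF finC(2)])
  moreover have "card (ess ?E) > 0"
    using \<open>ess ?E \<noteq> {}\<close> \<open>finite ?E\<close> ess_subset[of ?E] by (simp add: card_gt_0_iff finite_subset)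
  ultimately show False using card by linarith
qed

section \<open>Reduced paths through arcs\<close>

text \<open>The reflexive transitive closure expresses, in terms of edges alone, that two edges lie
  in the same arc.\<close>

definition abut :: "'b rel" where
  "abut = {(e, f). e \<in> arcs G \<and> f \<in> arcs G \<and>
     (\<exists>v\<in>verts G - branch_vertices G. v \<in> {tail G e, head G e} \<and> v \<in> {tail G f, head G f})}"

lemma finite_abut: "finite abut"
  by (rule finite_subset[of _ "arcs G \<times> arcs G"]) (auto simp: abut_def)

lemma arc_of_abut:
  assumes "f \<in> arcs G" "y \<in> arc_of G f"
  shows "case y of Inr e \<Rightarrow> (e, f) \<in> abut\<^sup>*
    | Inl v \<Rightarrow> v \<in> verts G - branch_vertices G \<and>
        (\<exists>e\<in>arcs G. v \<in> {tail G e, head G e} \<and> (e, f) \<in> abut\<^sup>*)"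
proof -
  let ?X = "cells G - Inl ` branch_vertices G"
  have "(Inr f, y) \<in> (incidence G \<inter> ?X \<times> ?X)\<^sup>*"
    using assms(2) by (simp add: arc_of_def component_def)
  then show ?thesis
  proof induction
    case (step y z)
    show ?case
    proof (cases y)
      case (Inl v)
      then obtain e where e: "z = Inr e" "e \<in> arcs G" "v \<in> {tail G e, head G e}"
        using step(2) by (auto simp: incidence_def)
      obtain e' where "e' \<in> arcs G" "v \<in> {tail G e', head G e'}" "(e', f) \<in> abut\<^sup>*"
        "v \<in> verts G - branch_vertices G"
        using step.IH Inl by auto
      then have "(e, e') \<in> abut" using e by (auto simp: abut_def)
      then show ?thesis using \<open>(e', f) \<in> abut\<^sup>*\<close> e(1) by (auto intro: converse_rtrancl_into_rtrancl)
    next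
      case (Inr e)
      then obtain v where "z = Inl v" "e \<in> arcs G" "v \<in> {tail G e, head G e}"
        using step(2) by (auto simp: incidence_def)
      then show ?thesis using step(2) step.IH Inr by (auto simp: cells_def)
    qed
  qed simp
qed

text \<open>A loop gives two darts at its vertex, in accordance with its double count in the
  degree.\<close>

lemma card_darts_at:
  assumes "v \<in> verts G"
  shows "finite {d. \<exists>w. traverse (edges (arcs G)) v d w}"
    "card {d. \<exists>w. traverse (edges (arcs G)) v d w} = out_degree G v + in_degree G v"
proof -
  have eq: "{d. \<exists>w. traverse (edges (arcs G)) v d w} =
      (\<lambda>e. (e, True)) ` out_arcs G v \<union> (\<lambda>e. (e, False)) ` in_arcs G v"
    by (auto simp: traverse_def edges_iff split: if_splits)
  have fin: "finite (out_arcs G v)" "finite (in_arcs G v)"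
    by (simp_all add: out_arcs_def in_arcs_def)
  then show "finite {d. \<exists>w. traverse (edges (arcs G)) v d w}" unfolding eq by simp
  have "card ((\<lambda>e. (e, True)) ` out_arcs G v \<union> (\<lambda>e. (e, False)) ` in_arcs G v) =
      card ((\<lambda>e. (e, True)) ` out_arcs G v) + card ((\<lambda>e. (e, False)) ` in_arcs G v)"
    using fin by (intro card_Un_disjoint) auto
  then show "card {d. \<exists>w. traverse (edges (arcs G)) v d w} = out_degree G v + in_degree G v"
    unfolding eq by (simp add: out_degree_def in_degree_def card_image inj_on_def)
qed

text \<open>The inverse of the arriving dart and the departing dart already exhaust a vertex of
  degree at most 2; another edge would give a third dart.\<close>

lemma forced_dart:
  assumes v: "v \<in> verts G - branch_vertices G"
    and st: "traverse (edges (arcs G)) u c v" "traverse (edges (arcs G)) v d w" "d \<noteq> dart_inv c"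
    and f: "f \<in> arcs G" "v \<in> {tail G f, head G f}"
  shows "f = fst c \<or> f = fst d"
proof (rule ccontr)
  assume contra: "\<not> ?thesis"
  let ?D = "{d. \<exists>w. traverse (edges (arcs G)) v d w}"
  obtain s where "(f, s) \<in> ?D"
  proof (cases "v = tail G f")
    case True
    then have "(f, True) \<in> ?D" using f by (auto simp: traverse_def edges_iff)
    then show ?thesis using that by blast
  next
    case False
    then have "(f, False) \<in> ?D" using f by (auto simp: traverse_def edges_iff)
    then show ?thesis using that by blast
  qed
  moreover have "dart_inv c \<in> ?D" "d \<in> ?D" using st by auto
  ultimately have "{dart_inv c, d, (f, s)} \<subseteq> ?D" by blast
  then have "card {dart_inv c, d, (f, s)} \<le> card ?D" using v card_darts_at(1)[of v] by (intro card_mono) auto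
  moreover have "card {dart_inv c, d, (f, s)} = 3"
    using st(3) contra by (auto simp: card_insert_if dest: arg_cong[of _ _ fst])
  moreover have "card ?D \<le> 2" using v card_darts_at(2)[of v] by (auto simp: branch_vertices_def)
  ultimately show False by simp
qed

text \<open>By \<open>forced_dart\<close>, an edge abutting an edge of the path is that edge or one
  of its neighbours on the path. Each step of the chain therefore uses up at most one dart of the
  margin on either side.\<close>

lemma forced_edge:
  assumes "(e, f) \<in> abut ^^ n" "walk (edges (arcs G)) a (ds1 @ (e, s) # ds2) b"
    "reduced (ds1 @ (e, s) # ds2)" "n \<le> length ds1" "n \<le> length ds2"
  shows "f \<in> fst ` set (ds1 @ (e, s) # ds2)"
  using assms
proof (induction n arbitrary: e ds1 s ds2)
  case (Suc n)
  let ?E = "edges (arcs G)"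
  let ?z = "ds1 @ (e, s) # ds2"
  obtain g where g: "(e, g) \<in> abut" "(g, f) \<in> abut ^^ n" using Suc.prems(1) by (meson relpow_Suc_D2)
  obtain ds1' c where ds1: "ds1 = ds1' @ [c]" using Suc.prems(4) by (cases ds1 rule: rev_exhaust) auto
  obtain d ds2' where ds2: "ds2 = d # ds2'" using Suc.prems(5) by (cases ds2) auto
  from Suc.prems(2) obtain t u v w where st: "traverse ?E t c u" "traverse ?E u (e, s) v" "traverse ?E v d w"
    by (auto simp: ds1 ds2)
  have ne: "(e, s) \<noteq> dart_inv c" "d \<noteq> dart_inv (e, s)"
    using Suc.prems(3) by (auto simp: ds1 ds2 reduced_append reduced_Cons)
  have "g \<in> {e, fst c, fst d}"
  proof -
    obtain v' where v': "v' \<in> verts G - branch_vertices G" "v' \<in> {tail G e, head G e}"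
      "v' \<in> {tail G g, head G g}" "g \<in> arcs G" using g(1) by (auto simp: abut_def)
    have "v' = u \<or> v' = v" using v'(2) st(2) by (auto simp: traverse_def edges_iff split: if_splits)
    then show ?thesis
      using forced_dart[OF _ st(1,2) ne(1) v'(4)] forced_dart[OF _ st(2,3) ne(2) v'(4)] v'(1,3) by auto
  qed
  then consider "g = e" | "g = fst c" | "g = fst d" by blast
  then show ?case
  proof cases
    case 1
    then show ?thesis using Suc.IH[of e ds1 s ds2] g(2) Suc.prems by simp
  next
    case 2
    have "f \<in> fst ` set (ds1' @ (g, snd c) # (e, s) # ds2)"
      using Suc.prems(2-) g(2) by (intro Suc.IH) (simp_all add: 2 ds1)
    then show ?thesis by (auto simp: ds1 2)
  next
    case 3
    have "f \<in> fst ` set ((ds1 @ [(e, s)]) @ (g, snd d) # ds2')"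
      using Suc.prems(2-) g(2) by (intro Suc.IH) (simp_all add: 3 ds2)
    then show ?thesis by (auto simp: ds2 3)
  qed
qed auto

end

section \<open>Order-essential edges of generalized echelon immersions\<close>

lemma reduced_map_darts:
  "reduced (map (map_prod l (\<lambda>s. s)) ds) \<Longrightarrow> reduced ds"
proof (induction ds)
  case (Cons d ds)
  then show ?case by (cases ds) (auto simp: reduced_Cons dart_inv_def)
qed simp

lemma winv_map: "winv (map (map_prod l (\<lambda>s. s)) ds) = map (map_prod l (\<lambda>s. s)) (winv ds)"
  by (induction ds) (auto simp: dart_inv_def)

context fin_digraph
begin

text \<open>A chain of abutting edges can be shortened to at most \<open>card abut\<close> steps.
  With that margin on both sides, \<open>forced_edge\<close> would put \<open>f\<close> on the
  path.\<close>

lemma interior_avoids_arc: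
  assumes walk: "walk (edges A) a (ds1 @ ds @ ds2) b" and red: "reduced (ds1 @ ds @ ds2)"
    and A: "A \<subseteq> arcs G" "f \<notin> A"
    and len: "card abut \<le> length ds1" "card abut \<le> length ds2" and d: "d \<in> set ds"
  shows "(fst d, f) \<notin> abut\<^sup>*"
proof
  assume "(fst d, f) \<in> abut\<^sup>*"
  then obtain n where n: "n \<le> card abut" "(fst d, f) \<in> abut ^^ n"
    unfolding rtrancl_finite_eq_relpow[OF finite_abut] by blast
  obtain xs ys where ds: "ds = xs @ d # ys" using d by (meson split_list)
  have "walk (edges (arcs G)) a ((ds1 @ xs) @ (fst d, snd d) # (ys @ ds2)) b"
  proof -
    have "edges A \<subseteq> edges (arcs G)" using A(1) by (auto simp: edges_def)
    from walk_mono[OF walk this] show ?thesis by (simp add: ds)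
  qed
  then have "f \<in> fst ` set ((ds1 @ xs) @ (fst d, snd d) # (ys @ ds2))"
  proof (rule forced_edge[OF n(2)])
    show "n \<le> length (ds1 @ xs)" "n \<le> length (ys @ ds2)" using n(1) len by simp_all
  qed (use red ds in simp)
  with walk_edges_arcs[OF walk] A(2) show False by (auto simp: ds)
qed

lemma traverse_incidence:
  assumes "traverse (edges A) u d v" "A \<subseteq> arcs G" "w = u \<or> w = v"
  shows "(Inr (fst d), Inl w) \<in> incidence G \<and> (Inl w, Inr (fst d)) \<in> incidence G"
proof -
  have "fst d \<in> arcs G" "w \<in> {tail G (fst d), head G (fst d)}"
    using assms by (auto simp: traverse_def edges_iff split: if_splits)
  then show ?thesis unfolding incidence_def by blast
qed

lemma walk_incident:
  assumes "walk (edges A) a ds b" "A \<subseteq> arcs G" "d \<in> set ds"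
    and "\<And>d. d \<in> set ds \<Longrightarrow> Inr (fst d) \<in> X \<and> Inl (tail G (fst d)) \<in> X \<and> Inl (head G (fst d)) \<in> X"
  shows "(Inr (fst d), Inr (fst (hd ds))) \<in> (incidence G \<inter> X \<times> X)\<^sup>*"
  using assms(1,3,4)
proof (induction ds arbitrary: a)
  case (Cons d0 ds)
  let ?R = "incidence G \<inter> X \<times> X"
  show ?case
  proof (cases "d = d0")
    case False
    then have d: "d \<in> set ds" using Cons.prems(2) by simp
    then obtain d1 ds' where ds: "ds = d1 # ds'" by (cases ds) auto
    from Cons.prems(1) obtain v w where st: "traverse (edges A) a d0 v" "traverse (edges A) v d1 w" "walk (edges A) v ds b"
      by (auto simp: ds)
    have in_X: "\<And>d. d \<in> set ds \<Longrightarrow> Inr (fst d) \<in> X \<and> Inl (tail G (fst d)) \<in> X \<and> Inl (head G (fst d)) \<in> X"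
      "Inr (fst d0) \<in> X" "Inl v \<in> X"
      using Cons.prems(3)[of d0] Cons.prems(3) st(1) by (auto simp: traverse_def edges_iff split: if_splits)
    have "(Inr (fst d), Inr (fst d1)) \<in> ?R\<^sup>*"
      using Cons.IH[OF st(3) d in_X(1)] by (simp add: ds)
    moreover have "(Inr (fst d1), Inl v) \<in> ?R" "(Inl v, Inr (fst d0)) \<in> ?R"
      using traverse_incidence[OF st(1) assms(2)] traverse_incidence[OF st(2) assms(2)] in_X(1)[of d1] in_X(2,3)
      by (simp_all add: ds)
    ultimately show ?thesis by (auto intro: rtrancl_into_rtrancl)
  qed simp
qed simp

text \<open>
  A line through \<open>e\<close> on which \<open>e\<close> is largest must pass \<open>e\<^sub>i\<close>, and in its interior it cannot enter
  the arc of any other \<open>e\<^sub>j\<close>, since it would be forced to traverse \<open>e\<^sub>j\<close>.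
\<close>
lemma deep_dart_in_echelon_comp:
  assumes i: "i < length es" and es: "set es \<subseteq> arcs G" "distinct es"
    and e: "e \<in> arcs G - set es" "traverse (edges (arcs G)) a (e, s) t"
  defines "A \<equiv> arcs G - set es" and "Ai \<equiv> arcs G - (set es - {es ! i})"
  assumes deep: "deep (lab l Ai) (l e, s) t" "deep (lab l Ai) (l e, \<not> s) a" "\<not> deep (lab l A) (l e, s) t"
  shows "l (es ! i) \<le> l e" "Inr e \<in> echelon_comp G es i"
proof -
  let ?m = "map (map_prod l (\<lambda>s. s))"
  \<comment> \<open>Without \<open>es ! i\<close> no falling path has this length, so a falling path
    in \<open>Ai\<close> must cross \<open>es ! i\<close> within its first \<open>N0\<close>
    darts.\<close>
  obtain N0 where N0: "\<not> falls (lab l A) (l e, s) t N0" using deep(3) by (auto simp: deep_def)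
  \<comment> \<open>The extra \<open>card abut\<close> darts here, and those of \<open>p\<close> on
    the other side, are the margins for \<open>interior_avoids_arc\<close>.\<close>
  obtain q b where q: "length q = N0 + card abut" "walk (lab l Ai) t q b" "reduced ((l e, s) # q)" "fall (l e, s) q"
    using deep(1) unfolding deep_def falls_def by blast
  obtain p b' where p: "length p = card abut" "walk (lab l Ai) a p b'" "reduced ((l e, \<not> s) # p)"
    using deep(2) unfolding deep_def falls_def by blast
  obtain ds where ds: "walk (edges Ai) t ds b" "q = ?m ds" using walk_lab[OF q(2)] by blast
  obtain dp where dp: "walk (edges Ai) a dp b'" "p = ?m dp" using walk_lab[OF p(2)] by blast
  have "e \<in> Ai" using e(1) by (auto simp: Ai_def)
  then have st: "traverse (edges Ai) a (e, s) t" using e(2) by (auto simp: traverse_def edges_iff)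
  have Ai: "Ai \<subseteq> arcs G" by (auto simp: Ai_def)
  define mid where "mid = (e, s) # take N0 ds"
  let ?D = "winv dp @ mid @ drop N0 ds"
  have D: "?D = winv dp @ (e, s) # ds" by (simp add: mid_def)
  have walkD: "walk (edges Ai) b' ?D b" unfolding D using dp(1) st ds(1) by auto
  have "reduced (winv ((l e, \<not> s) # p))" using p(3) by (simp only: reduced_winv)
  then have "reduced (winv p @ [(l e, s)])" by (simp add: dart_inv_def)
  then have "reduced (winv p @ (l e, s) # q)" using q(3) by (rule reduced_glue)
  also have "winv p @ (l e, s) # q = ?m ?D"
    unfolding D ds(2) dp(2) winv_map by simp
  finally have redD: "reduced ?D" by (rule reduced_map_darts)
  have "\<exists>d\<in>set (take N0 ds). fst d \<notin> A"
  proof (rule ccontr)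
    assume "\<not> ?thesis"
    then have sub: "fst ` set (take N0 ds) \<subseteq> A" by auto
    obtain v where "walk (edges Ai) t (take N0 ds) v"
      using ds(1) walk_append[of "edges Ai" t "take N0 ds" "drop N0 ds" b] by auto
    from walk_edges[OF walk_edges_restrict[OF this sub], of l]
    have "walk (lab l A) t (take N0 q) v" by (simp add: ds(2) take_map)
    moreover have "reduced ((l e, s) # take N0 q)"
      using q(3) reduced_append[of "(l e, s) # take N0 q" "drop N0 q"] by simp
    moreover have "fall (l e, s) (take N0 q)"
      using q(4) fall_prefix[of _ "take N0 q" "drop N0 q"] by simp
    ultimately have "falls (lab l A) (l e, s) t N0"
      unfolding falls_def using q(1) by (intro exI[of _ "take N0 q"] exI[of _ v]) simp
    with N0 show False ..
  qed
  then obtain d where d: "d \<in> set (take N0 ds)" "fst d \<notin> A" by blast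
  have "fst d \<in> Ai" using walk_edges_arcs[OF ds(1)] d(1) by (auto dest: in_set_takeD)
  with d(2) have fst_d: "fst d = es ! i" by (auto simp: A_def Ai_def)
  obtain xs ys where "ds = xs @ d # ys" using d(1) by (meson in_set_takeD split_list)
  then have "q = ?m xs @ map_prod l (\<lambda>s. s) d # ?m ys" by (simp add: ds(2))
  with q(4) have "kless (ekey ((l e, s) # ?m xs) (map_prod l (\<lambda>s. s) d)) (ekey [] (l e, s))"
    by (auto dest: fallD)
  \<comment> \<open>Keys are compared by label before anything else, so a smaller key cannot have a
    larger label.\<close>
  then show "l (es ! i) \<le> l e" using fst_d by (cases d) (auto simp: kless_def ekey_def)
  define X where "X = cells G - (\<Union>j\<in>{..<length es} - {i}. arc_of G (es ! j))"
  have X: "Inr (fst d) \<in> X \<and> Inl (tail G (fst d)) \<in> X \<and> Inl (head G (fst d)) \<in> X" if "d \<in> set mid" for d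
  proof -
    have dG: "fst d \<in> arcs G" using walk_edges_arcs[OF walkD] Ai that by auto
    have "Inr (fst d) \<notin> arc_of G (es ! j) \<and> Inl (tail G (fst d)) \<notin> arc_of G (es ! j) \<and>
        Inl (head G (fst d)) \<notin> arc_of G (es ! j)" if j: "j < length es" "j \<noteq> i" for j
    proof -
      have "es ! j \<noteq> es ! i" using i j es(2) by (simp add: nth_eq_iff_index_eq)
      then have "es ! j \<notin> Ai" using j by (auto simp: Ai_def)
      then have no: "(fst d, es ! j) \<notin> abut\<^sup>*"
        using interior_avoids_arc[OF walkD redD Ai] q(1) p(1) ds(2) dp(2) \<open>d \<in> set mid\<close> by simp
      have f: "es ! j \<in> arcs G" using j es(1) by auto
      have "Inl v \<notin> arc_of G (es ! j)" if "v = tail G (fst d) \<or> v = head G (fst d)" for v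
      proof
        assume "Inl v \<in> arc_of G (es ! j)"
        from arc_of_abut[OF f this] obtain e' where "e' \<in> arcs G" "v \<in> {tail G e', head G e'}"
          "(e', es ! j) \<in> abut\<^sup>*" "v \<in> verts G - branch_vertices G" by auto
        moreover from this that dG have "(fst d, e') \<in> abut" by (auto simp: abut_def)
        ultimately show False using no by (auto intro: converse_rtrancl_into_rtrancl)
      qed
      moreover have "Inr (fst d) \<notin> arc_of G (es ! j)" using arc_of_abut[OF f, of "Inr (fst d)"] no by auto
      ultimately show ?thesis by blast
    qed
    then show ?thesis using dG by (auto simp: X_def cells_def)
  qed
  obtain v where "walk (edges Ai) a mid v"
    using st ds(1) walk_append[of "edges Ai" t "take N0 ds" "drop N0 ds" b] by (auto simp: mid_def)
  moreover have "d \<in> set mid" using d(1) by (simp add: mid_def)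
  ultimately have "(Inr (fst d), Inr (fst (hd mid))) \<in> (incidence G \<inter> X \<times> X)\<^sup>*"
    using X Ai by (intro walk_incident)
  moreover have "Inr e \<in> X" using X[of "(e, s)"] by (simp add: mid_def)
  ultimately show "Inr e \<in> echelon_comp G es i"
    by (simp add: echelon_comp_def component_def mid_def fst_d X_def)
qed

theorem inj_on_ess_labels:
  assumes conn: "Digraph_Component.connected G"
    and det: "det (lab l (arcs G))" and inj: "inj_on (\<lambda>e. (tail G e, l e, head G e)) (arcs G)"
    and es: "distinct es" "maximal_essential G (set es)"
    and incr: "\<And>i j. i < j \<Longrightarrow> j < length es \<Longrightarrow> l (es ! i) < l (es ! j)"
    and low: "\<And>e f. e \<in> arcs G \<Longrightarrow> f \<in> set es \<Longrightarrow> l e \<notin> l ` set es \<Longrightarrow> l e < l f"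
    and disj: "\<And>i. i < length es \<Longrightarrow>
      l ` (Inr -` echelon_part G es i) \<inter> l ` set (drop (Suc i) es) = {}"
  shows "inj_on (fst \<circ> snd) (ess (lab l (arcs G)))"
proof -
  let ?E = "lab l (arcs G)"
  have esG: "set es \<subseteq> arcs G" using es(2) by (simp add: maximal_essential_def essential_def)
  have m: "reduced_rank G (cells G) = int (length es)"
    using es distinct_card[OF es(1)] by (simp add: maximal_essential_def)
  have fin: "finite (lab l A)" if "A \<subseteq> arcs G" for A
    using finite_subset[OF that] by (simp add: lab_def)
  have cardE: "card (lab l A) = card A" if "A \<subseteq> arcs G" for A
    unfolding lab_def by (rule card_image) (rule inj_on_subset[OF inj that])
  have connE: "conn (verts G) ?E" unfolding lab_def by (rule conn_connected[OF conn])
  have none: "ess (lab l (arcs G - set es)) = {}"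
  proof (rule ess_empty_if_reduced_rank_0)
    show "det (lab l (arcs G - set es))" by (rule det_subset[OF det lab_mono]) auto
    have "arcs G - (arcs G - set es) = set es" using esG by auto
    then show "reduced_rank G (cells G - Inr ` (arcs G - (arcs G - set es))) = 0"
      using es(2) by (simp add: maximal_essential_def essential_def)
  qed (auto intro: inj_on_subset[OF inj])
  show ?thesis
  proof (cases "es = []")
    case True
    with none show ?thesis by simp
  next
    case False
    then have card: "card (arcs G) = card (verts G) + length es"
    proof -
      have "max 0 (int (card (arcs G)) - int (card (verts G))) = int (length es)" "0 < length es"
        using m reduced_rank_connected[OF conn] False by simp_all
      then show ?thesis by linarith
    qed
    have le: "card (ess ?E) \<le> length es"
    proof (cases "ess ?E = {}")
      case False
      then have "card (verts G) + card (ess ?E) \<le> card ?E"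
        by (intro card_ess_le[OF fin _ det lab_subset connE]) simp_all
      then show ?thesis using card cardE[of "arcs G"] by simp
    qed simp
    have "l (es ! i) \<in> (fst \<circ> snd) ` ess ?E" if i: "i < length es" for i
    proof -
      define Ai where "Ai = arcs G - (set es - {es ! i})"
      have Ai: "Ai \<subseteq> arcs G" by (auto simp: Ai_def)
      have "card (set es - {es ! i}) = length es - 1"
        using i distinct_card[OF es(1)] by simp
      \<comment> \<open>With \<open>es ! i\<close> put back there are |V| + 1 edges, just enough for
        \<open>ess_nonempty\<close>.\<close>
      then have "card Ai = card (arcs G) - (length es - 1)"
        unfolding Ai_def using esG by (subst card_Diff_subset) auto
      then have "card (verts G) < card (lab l Ai)" using card cardE[OF Ai] i by simp
      then have "ess (lab l Ai) \<noteq> {}"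
        using fin[OF Ai] lab_subset[OF Ai] det_subset[OF det lab_mono[OF Ai]]
        by (intro ess_nonempty[of _ "verts G"]) simp_all
      then obtain u x w where ess: "(u, x, w) \<in> ess (lab l Ai)" by auto
      then have "(u, x, w) \<in> lab l Ai" using ess_subset by blast
      then obtain e where e: "e \<in> Ai" "u = tail G e" "x = l e" "w = head G e"
        by (auto simp: lab_iff)
      have deep: "deep (lab l Ai) (l e, True) (head G e)" "deep (lab l Ai) (l e, False) (tail G e)"
        using ess e by (auto simp: ess_def)
      have "l e = l (es ! i)"
      proof (cases "e = es ! i")
        case False
        then have eA: "e \<in> arcs G - set es" using e(1) by (auto simp: Ai_def)
        let ?A = "lab l (arcs G - set es)"
        have st: "traverse (edges (arcs G)) (tail G e) (e, True) (head G e)"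
          "traverse (edges (arcs G)) (head G e) (e, False) (tail G e)"
          using eA by (auto simp: traverse_def edges_iff)
        have "(u, x, w) \<in> ?A" using eA e by (auto simp: lab_iff)
        \<comment> \<open>Without \<open>es ! i\<close> the edge \<open>e\<close> is not
          order-essential, so the falling paths on at least one of its sides depend on
          \<open>es ! i\<close>.\<close>
        then consider "\<not> deep ?A (l e, True) (head G e)" | "\<not> deep ?A (l e, False) (tail G e)"
          using none e by (auto simp: ess_def)
        then have *: "l (es ! i) \<le> l e \<and> Inr e \<in> echelon_comp G es i"
        proof cases
          case 1
          then show ?thesis
            using deep_dart_in_echelon_comp[OF i esG es(1) eA st(1), of l] deep by (simp add: Ai_def)
        next
          case 2
          then show ?thesis
            using deep_dart_in_echelon_comp[OF i esG es(1) eA st(2), of l] deep by (simp add: Ai_def)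
        qed
        \<comment> \<open>All other labels are smaller than those of \<open>es\<close>, so this
          label is that of some \<open>es ! j\<close>. The order excludes \<open>j < i\<close>, and
          the echelon condition excludes \<open>i < j\<close>.\<close>
        then have "l e \<in> l ` set es" using low[of e "es ! i"] eA i by fastforce
        then obtain j where j: "j < length es" "l e = l (es ! j)" by (auto simp: in_set_conv_nth)
        have "\<not> j < i" using * incr[of j i] i j by auto
        moreover have "\<not> i < j"
        proof
          assume "i < j"
          then have "es ! j \<in> set (drop (Suc i) es)"
            using j(1) by (auto simp: in_set_conv_nth intro!: exI[of _ "j - Suc i"])
          moreover have "e \<in> Inr -` echelon_part G es i" using * by (auto simp: echelon_part_def)
          ultimately show False using disj[OF i] j(2) by (metis disjoint_iff image_eqI)
        qed
        ultimately show ?thesis using j(2) by (simp add: linorder_neq_iff)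
      qed simp
      moreover have "(u, x, w) \<in> ess ?E" using ess ess_mono[OF lab_mono[OF Ai]] by blast
      ultimately show ?thesis using e(3) by force
    qed
    then have sub: "(\<lambda>i. l (es ! i)) ` {..<length es} \<subseteq> (fst \<circ> snd) ` ess ?E" by auto
    have finess: "finite (ess ?E)" using fin[OF subset_refl] ess_subset by (rule finite_subset[rotated])
    have "inj_on (\<lambda>i. l (es ! i)) {..<length es}"
      by (rule linorder_inj_onI) (auto dest: incr)
    \<comment> \<open>Every label of \<open>es\<close> occurs on an order-essential edge, and there
      are at most \<open>length es\<close> such edges; equality makes the labelling
      injective.\<close>
    then have "length es \<le> card ((fst \<circ> snd) ` ess ?E)"
      using card_mono[OF _ sub] finess by (simp add: card_image)
    then show ?thesis
      using le card_image_le[OF finess, of "fst \<circ> snd"] finess by (intro eq_card_imp_inj_on) auto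
  qed
qed

end

section \<open>Fibre products\<close>

definition fibre_product ::
  "('v \<times> 'l \<times> 'v) set \<Rightarrow> ('w \<times> 'l \<times> 'w) set \<Rightarrow> (('v \<times> 'w) \<times> 'l \<times> ('v \<times> 'w)) set" where
  "fibre_product E D = {((u, u'), x, (w, w')) |u u' x w w'. (u, x, w) \<in> E \<and> (u', x, w') \<in> D}"

lemma traverse_fibre_product:
  "traverse (fibre_product E D) (u, u') d (w, w') \<longleftrightarrow> traverse E u d w \<and> traverse D u' d w'"
  by (auto simp: traverse_def fibre_product_def)

lemma walk_fibre_product:
  "walk (fibre_product E D) (u, u') p (w, w') \<longleftrightarrow> walk E u p w \<and> walk D u' p w'"
  by (induction p arbitrary: u u') (auto simp: traverse_fibre_product)

lemma det_fibre_product: "det E \<Longrightarrow> det D \<Longrightarrow> det (fibre_product E D)"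
  unfolding det_def by (simp add: split_paired_all traverse_fibre_product) blast

lemma finite_fibre_product: "finite E \<Longrightarrow> finite D \<Longrightarrow> finite (fibre_product E D)"
  by (rule finite_subset[of _ "(\<lambda>((u, x, w), (u', x', w')). ((u, u'), x, (w, w'))) ` (E \<times> D)"])
    (force simp: fibre_product_def)+

text \<open>An edge crossed backwards starts at the vertex just reached, so the origin of every edge
  on the walk is reachable.\<close>

lemma walk_reachable_part:
  "walk E z p v \<Longrightarrow> walk {(u, x, w) \<in> E. \<exists>q. walk E z q u} z p v"
proof (induction p arbitrary: v rule: rev_induct)
  case (snoc d p)
  then obtain u where u: "walk E z p u" "traverse E u d v" by auto
  then have "walk E z (p @ [d]) v" by auto
  then have "\<exists>q. walk E z q v" "\<exists>q. walk E z q u" using u(1) by blast+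
  then have "traverse {(u, x, w) \<in> E. \<exists>q. walk E z q u} u d v" using u(2) by (auto simp: traverse_def)
  with snoc.IH[OF u(1)] show ?case unfolding walk_append walk.simps by blast
qed simp

text \<open>Moves labels of arbitrary type to natural numbers, where \<open>kless\<close> expresses
  the chosen order of labels.\<close>

definition relabel :: "('l \<Rightarrow> 'm) \<Rightarrow> ('v \<times> 'l \<times> 'v) set \<Rightarrow> ('v \<times> 'm \<times> 'v) set" where
  "relabel r E = (\<lambda>(u, x, w). (u, r x, w)) ` E"

lemma relabel_iff: "(u, y, w) \<in> relabel r E \<longleftrightarrow> (\<exists>x. (u, x, w) \<in> E \<and> y = r x)"
  by (force simp: relabel_def)

lemma card_relabel:
  assumes "inj_on r L" "E \<subseteq> UNIV \<times> L \<times> UNIV" shows "card (relabel r E) = card E"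
  unfolding relabel_def
proof (rule card_image, rule inj_onI)
  fix e e' assume e: "e \<in> E" "e' \<in> E" "(\<lambda>(u, x, w). (u, r x, w)) e = (\<lambda>(u, x, w). (u, r x, w)) e'"
  then have "fst (snd e) \<in> L" "fst (snd e') \<in> L" using assms(2) by auto
  with e(3) assms(1) show "e = e'" by (auto simp: split_def prod_eq_iff dest: inj_onD)
qed

lemma det_relabel:
  assumes "inj_on r L" "E \<subseteq> UNIV \<times> L \<times> UNIV" "det E" shows "det (relabel r E)"
  unfolding det_def
proof (intro allI impI)
  fix u d w w' assume st: "traverse (relabel r E) u d w" "traverse (relabel r E) u d w'"
  then obtain x x' where x: "traverse E u (x, snd d) w" "traverse E u (x', snd d) w'" "r x = r x'"
    by (auto simp: traverse_def relabel_iff split: if_splits)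
  then have "x \<in> L" "x' \<in> L" using assms(2) by (auto simp: traverse_def split: if_splits)
  with x(3) have "x = x'" using assms(1) by (simp add: inj_on_eq_iff)
  with x show "w = w'" using detD[OF assms(3)] by blast
qed

lemma conn_relabel: "conn V E \<Longrightarrow> conn V (relabel r E)"
  unfolding conn_def by (simp add: relabel_def split_def)

text \<open>
  An order-essential edge of the fibre product is determined by its image in \<open>D\<close>, because its
  image in \<open>E\<close> is determined by the label.
\<close>
lemma card_ess_fibre_product_le:
  assumes "P \<subseteq> fibre_product E D" "inj_on (fst \<circ> snd) (ess E)" "finite D"
  shows "card (ess P) \<le> card (ess D)"
proof (rule card_inj_on_le)
  let ?f = "\<lambda>((u, u'), x, (w, w')). (u', x, w')"
  have proj: "(u, x, w) \<in> ess E \<and> (u', x, w') \<in> ess D" if "((u, u'), x, (w, w')) \<in> ess P" for u u' x w w'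
    using ess_morphism[of P fst E "(u, u')" x "(w, w')"] ess_morphism[of P snd D "(u, u')" x "(w, w')"]
      that assms(1) by (auto simp: fibre_product_def subset_iff)
  then show "?f ` ess P \<subseteq> ess D" by auto
  show "inj_on ?f (ess P)"
  proof (rule inj_onI)
    fix e e' assume e: "e \<in> ess P" "e' \<in> ess P" "?f e = ?f e'"
    obtain u1 u' x w1 w' u2 w2 where eq: "e = ((u1, u'), x, (w1, w'))" "e' = ((u2, u'), x, (w2, w'))"
      using e(3) by (cases e, cases e') auto
    from e(1,2)[unfolded eq, THEN proj] have "(u1, x, w1) = (u2, x, w2)"
      using inj_onD[OF assms(2), of "(u1, x, w1)" "(u2, x, w2)"] by simp
    then show "e = e'" by (simp add: eq)
  qed
  show "finite (ess D)" using assms(3) ess_subset by (rule finite_subset[rotated])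
qed

text \<open>With \<open>P\<close> the base component of the fibre product and all order-essential
  edges taken after relabelling by \<open>r\<close>, the chain is: |P| - |VP| is at most the number
  for \<open>P\<close>, this at most the number for \<open>D\<close>, and this at most |S| - 1. The
  last step uses |D| - |W|, or just |S| >= 1 if \<open>D\<close> has no order-essential
  edge.\<close>

lemma (in bouquet_graph) group_rank_Int_le:
  assumes H: "subgroup H G" "H = {k. reduced k \<and> walk E v k v}"
    and E: "finite E" "det E" "E \<subseteq> V \<times> arcs B \<times> V" "finite V" "v \<in> V"
    and r: "inj_on r (arcs B)" and ess: "inj_on (fst \<circ> snd) (ess (relabel r E))"
    and K: "subgroup K G" and S: "finite S" "S \<subseteq> K" "generate G S = K"
  shows "group_rank (G\<lparr>carrier := H \<inter> K\<rparr>) \<le> enat (card S)"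
proof (cases "S = {}")
  \<comment> \<open>Here \<open>K\<close> is trivial and the rank is 0, whereas the edge count would
    only yield 1.\<close>
  case True
  have J: "subgroup (H \<inter> K) G" using group.subgroups_Inter_pair[OF group_G H(1) K] .
  have "generate G {} = H \<inter> K"
    using group.generate_subgroup_incl[OF group_G _ J, of "{}"] S(3) True by auto
  then have "generate (G\<lparr>carrier := H \<inter> K\<rparr>) {} = H \<inter> K"
    using group.generate_consistent[OF group_G _ J, of "{}"] by simp
  then show ?thesis
    unfolding group_rank_def by (intro INF_lower2[of "{}"]) (auto simp: zero_enat_def)
next
  case False
  then have S1: "card S \<ge> 1" using S(1) by (simp add: Suc_le_eq card_gt_0_iff)
  obtain D :: "('e dart list set \<times> 'e \<times> 'e dart list set) set" and W z where
    D: "finite D" "finite W" "det D" "D \<subseteq> W \<times> arcs B \<times> W" "conn W D" "z \<in> W"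
    and card: "card D + 1 \<le> card W + card S" and KD: "K = {k. reduced k \<and> walk D z k z}"
    by (rule ex_schreier_graph[OF K S])
  define P0 where "P0 = fibre_product E D"
  define VP where "VP = {y. \<exists>q. walk P0 (v, z) q y}"
  define P where "P = {(a, x, c) \<in> P0. \<exists>q. walk P0 (v, z) q a}"
  have P0: "finite P0" "det P0"
    unfolding P0_def using finite_fibre_product det_fibre_product E D by blast+
  have P0V: "P0 \<subseteq> (V \<times> W) \<times> UNIV \<times> (V \<times> W)"
    using E(3) D(4) by (auto simp: P0_def fibre_product_def)
  have PB: "P \<subseteq> UNIV \<times> arcs B \<times> UNIV" using E(3) by (auto simp: P_def P0_def fibre_product_def)
  have P: "finite P" "det P" using P0 by (auto simp: P_def intro: finite_subset det_subset)
  have "VP \<subseteq> V \<times> W"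
    using walk_subset[OF P0V, of "(v, z)"] E(5) D(6) unfolding VP_def by blast
  then have finVP: "finite VP" using E(4) D(2) by (auto intro: finite_subset)
  have PVP: "P \<subseteq> VP \<times> UNIV \<times> VP"
  proof
    fix e assume "e \<in> P"
    moreover obtain a x c where e: "e = (a, x, c)" by (cases e)
    ultimately obtain q where q: "walk P0 (v, z) q a" "(a, x, c) \<in> P0" by (auto simp: P_def)
    have "traverse P0 a (x, True) c" using q(2) by (simp add: traverse_def)
    with q(1) have "walk P0 (v, z) (q @ [(x, True)]) c" unfolding walk_append walk.simps by blast
    with q show "e \<in> VP \<times> UNIV \<times> VP" unfolding VP_def e by blast
  qed
  have reach: "walk P (v, z) q y" if "walk P0 (v, z) q y" for q y
    unfolding P_def using that by (rule walk_reachable_part)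
  have connP: "conn VP P" using reach by (intro conn_if_reachable[of _ _ "(v, z)"]) (auto simp: VP_def)
  have "(v, z) \<in> VP" by (auto simp: VP_def intro: exI[of _ "[]"])
  have "walk P (v, z) k (v, z) \<longleftrightarrow> walk E v k v \<and> walk D z k z" for k
  proof -
    have "P \<subseteq> P0" by (auto simp: P_def)
    then have "walk P (v, z) k (v, z) \<longleftrightarrow> walk P0 (v, z) k (v, z)"
      using walk_mono[of P "(v, z)" k "(v, z)" P0] reach[of k "(v, z)"] by blast
    then show ?thesis by (simp add: P0_def walk_fibre_product)
  qed
  then have "H \<inter> K = {k. reduced k \<and> walk P (v, z) k (v, z)}"
    using H(2) KD by auto
  then have rank: "group_rank (G\<lparr>carrier := H \<inter> K\<rparr>) \<le> enat (card P + 1 - card VP)"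
    using group.subgroups_Inter_pair[OF group_G H(1) K] P finVP PVP connP \<open>(v, z) \<in> VP\<close>
    by (intro group_rank_le)
  have "card (relabel r P) \<le> card VP + card (ess (relabel r P))"
    using P(1) finVP det_relabel[OF r PB P(2)] PVP
    by (intro card_le_ess) (auto simp: relabel_def)
  moreover have "card (relabel r P) = card P" by (rule card_relabel[OF r PB])
  moreover have "card (ess (relabel r P)) \<le> card (ess (relabel r D))"
  proof (rule card_ess_fibre_product_le[OF _ ess])
    show "relabel r P \<subseteq> fibre_product (relabel r E) (relabel r D)"
      by (force simp: relabel_def P_def P0_def fibre_product_def)
    show "finite (relabel r D)" using D(1) by (simp add: relabel_def)
  qed
  moreover have "card (ess (relabel r D)) + 1 \<le> card S"
  proof (cases "ess (relabel r D) = {}")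
    case False
    have DB: "D \<subseteq> UNIV \<times> arcs B \<times> UNIV" using D(4) by auto
    have "card W + card (ess (relabel r D)) \<le> card (relabel r D)"
      using D det_relabel[OF r DB D(3)] conn_relabel[OF D(5)] False
      by (intro card_ess_le) (auto simp: relabel_def)
    then show ?thesis using card card_relabel[OF r DB] by simp
  qed (use S1 in simp)
  ultimately have "card P + 1 - card VP \<le> card S" by linarith
  with rank show ?thesis by (meson enat_ord_simps(1) order_trans)
qed

section \<open>Ordering the labels and assembling the theorem\<close>

lemma ex_label_order:
  assumes "finite L" "distinct xs" "set xs \<subseteq> L"
  obtains r :: "'l \<Rightarrow> nat" where "inj_on r L"
    "\<And>i j. i < j \<Longrightarrow> j < length xs \<Longrightarrow> r (xs ! i) < r (xs ! j)"
    "\<And>x y. x \<in> L \<Longrightarrow> x \<notin> set xs \<Longrightarrow> y \<in> set xs \<Longrightarrow> r x < r y"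
proof -
  obtain ys where ys: "set ys = L - set xs" "distinct ys"
    using finite_distinct_list[of "L - set xs"] assms(1) by auto
  define zs where "zs = ys @ xs"
  define r where "r = inv_into {..<length zs} (nth zs)"
  have zs: "distinct zs" "set zs = L" using ys assms by (auto simp: zs_def)
  then have r: "r (zs ! i) = i" if "i < length zs" for i
    unfolding r_def using that by (intro inv_into_f_f inj_on_nth) auto
  have r_xs: "r (xs ! i) = length ys + i" if "i < length xs" for i
    using r[of "length ys + i"] that by (simp add: zs_def)
  show ?thesis
  proof
    show "inj_on r L"
      using r unfolding zs(2)[symmetric] by (intro inj_onI) (metis in_set_conv_nth)
    show "r (xs ! i) < r (xs ! j)" if "i < j" "j < length xs" for i j
      using that by (simp add: r_xs)
    show "r x < r y" if x: "x \<in> L" "x \<notin> set xs" and y: "y \<in> set xs" for x y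
    proof -
      obtain i where "i < length ys" "x = ys ! i" using x ys(1) by (metis DiffI in_set_conv_nth)
      then have "r x < length ys" using r[of i] by (simp add: zs_def nth_append)
      moreover obtain j where "j < length xs" "y = xs ! j" using y by (metis in_set_conv_nth)
      ultimately show ?thesis by (simp add: r_xs)
    qed
  qed
qed

context fin_digraph
begin

lemma det_lab:
  assumes "\<And>v. v \<in> verts G \<Longrightarrow> inj_on l (out_arcs G v) \<and> inj_on l (in_arcs G v)"
  shows "det (lab l (arcs G))" "inj_on (\<lambda>e. (tail G e, l e, head G e)) (arcs G)"
proof -
  have out: "e = e'" if "e \<in> arcs G" "e' \<in> arcs G" "tail G e = tail G e'" "l e = l e'" for e e'
    using assms[of "tail G e"] that by (auto dest: inj_onD)
  have inn: "e = e'" if "e \<in> arcs G" "e' \<in> arcs G" "head G e = head G e'" "l e = l e'" for e e'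
    using assms[of "head G e"] that by (auto dest: inj_onD)
  show "inj_on (\<lambda>e. (tail G e, l e, head G e)) (arcs G)"
    using out by (auto intro: inj_onI)
  show "det (lab l (arcs G))"
    unfolding det_def traverse_def lab_iff using out inn by (auto split: if_splits)
qed

lemma edge_path_iff_walk: "edge_path G u p w \<longleftrightarrow> u \<in> verts G \<and> walk (edges (arcs G)) u p w"
proof (induction p arbitrary: u)
  case (Cons d p)
  have eq: "traverse (edges (arcs G)) u d v \<longleftrightarrow>
      d \<in> arcs (double G) \<and> tail (double G) d = u \<and> head (double G) d = v" for v
    by (cases d) (auto simp: double_def traverse_def edges_iff)
  have "v \<in> verts G \<and> u \<in> verts G" if "traverse (edges (arcs G)) u d v" for v
    using that by (auto simp: traverse_def edges_iff split: if_splits)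
  then have "d \<in> arcs (double G) \<Longrightarrow> tail (double G) d = u \<Longrightarrow> head (double G) d \<in> verts G \<and> u \<in> verts G"
    unfolding eq by blast
  then show ?case
    unfolding edge_path_Cons[OF wf_digraph_axioms] Cons walk.simps eq by blast
qed (auto simp: edge_path_Nil)

text \<open>A reduced label word lifts to an edge path that is itself reduced, so reading its labels
  involves no cancellation; conversely determinism keeps the endpoints under reduction.\<close>

lemma pi1_map_image:
  assumes "det (lab l (arcs G))" "v \<in> verts G"
  shows "pi1_map l ` carrier (pi1 G v) = {k. reduced k \<and> walk (lab l (arcs G)) v k v}"
proof (intro Set.set_eqI iffI)
  have map_id: "map_prod l id = map_prod l (\<lambda>s. s)" by (simp add: id_def)
  fix k
  {
    assume "k \<in> pi1_map l ` carrier (pi1 G v)"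
    then obtain p where p: "k = reduce (map (map_prod l (\<lambda>s. s)) p)" "walk (edges (arcs G)) v p v"
      by (auto simp: pi1_def pi1_map_def map_id edge_path_iff_walk)
    with walk_reduce[OF assms(1) walk_edges[OF p(2)]]
    show "k \<in> {k. reduced k \<and> walk (lab l (arcs G)) v k v}" by (simp add: reduced_reduce)
  next
    assume k: "k \<in> {k. reduced k \<and> walk (lab l (arcs G)) v k v}"
    then obtain ds where ds: "walk (edges (arcs G)) v ds v" "k = map (map_prod l (\<lambda>s. s)) ds"
      using walk_lab by blast
    then have "ds \<in> carrier (pi1 G v)"
      using k assms(2) reduced_map_darts[of l ds] by (simp add: pi1_def edge_path_iff_walk)
    moreover have "k = pi1_map l ds" using k ds(2) by (simp add: pi1_map_def map_id reduce_reduced)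
    ultimately show "k \<in> pi1_map l ` carrier (pi1 G v)" by blast
  }
qed

end

theorem corollary4p13:
  fixes n :: nat
    and B :: "('w, 'e) pre_digraph" and b :: 'w and H :: "'e dart list set"
  assumes "bouquet n B b"
    and "subgroup H (pi1 B b)"
    and "finitely_generated ((pi1 B b)\<lparr>carrier := H\<rparr>)"
    and "generalized_echelon_subgroup B b H"
  shows "inert (pi1 B b) H"
proof -
  interpret bouquet_graph n B b by unfold_locales (rule assms(1))
  obtain \<Gamma> v where rep: "represents \<Gamma> v B b H" and ech: "generalized_echelon \<Gamma> wedge_label"
    using assms(4) by (auto simp: generalized_echelon_subgroup_def)
  interpret \<Gamma>: fin_digraph \<Gamma> using rep by (simp add: represents_def)
  let ?l = "wedge_label :: 'e dart list \<times> nat \<Rightarrow> 'e"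
  have conn: "Digraph_Component.connected \<Gamma>" and v: "v \<in> verts \<Gamma>"
    and H: "pi1_map ?l ` carrier (pi1 \<Gamma> v) = H"
    and imm: "immersion \<Gamma> B (\<lambda>_. b) ?l"
    using rep by (simp_all add: represents_def)
  have lB: "?l ` arcs \<Gamma> \<subseteq> arcs B"
    and inj: "\<And>v. v \<in> verts \<Gamma> \<Longrightarrow> inj_on ?l (out_arcs \<Gamma> v) \<and> inj_on ?l (in_arcs \<Gamma> v)"
    using imm by (simp_all add: immersion_def graph_morphism_def)
  obtain es where es: "distinct es" "maximal_essential \<Gamma> (set es)" "inj_on ?l (set es)"
    and disj: "\<And>i. i < length es \<Longrightarrow> ?l ` (Inr -` echelon_part \<Gamma> es i) \<inter> ?l ` set (drop (Suc i) es) = {}"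
    using ech by (auto simp: generalized_echelon_def)
  have esG: "set es \<subseteq> arcs \<Gamma>" using es(2) by (simp add: maximal_essential_def essential_def)
  have finB: "finite (arcs B)"
    using bouquet by (simp add: bouquet_def fin_digraph.finite_arcs)
  have lesB: "?l ` set es \<subseteq> arcs B" using image_mono[OF esG, of ?l] lB by (rule order_trans)
  obtain r :: "'e \<Rightarrow> nat" where r: "inj_on r (arcs B)"
    and incr: "\<And>i j. i < j \<Longrightarrow> j < length (map ?l es) \<Longrightarrow> r (map ?l es ! i) < r (map ?l es ! j)"
    and low: "\<And>x y. x \<in> arcs B \<Longrightarrow> x \<notin> set (map ?l es) \<Longrightarrow> y \<in> set (map ?l es) \<Longrightarrow> r x < r y"
    by (rule ex_label_order[OF finB, of "map ?l es"])
      (use es(1,3) lesB in \<open>simp_all add: distinct_map\<close>)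
  let ?E = "\<Gamma>.lab ?l (arcs \<Gamma>)"
  have det: "det ?E" by (rule \<Gamma>.det_lab[OF inj])
  have comp_inj: "inj_on (r \<circ> ?l) A" if "inj_on ?l A" "A \<subseteq> arcs \<Gamma>" for A
    using that lB by (intro comp_inj_on) (auto intro: inj_on_subset[OF r])
  have r_eq: "r (?l e) = r (?l f) \<longleftrightarrow> ?l e = ?l f" if "e \<in> arcs \<Gamma>" "f \<in> arcs \<Gamma>" for e f
    using inj_on_eq_iff[OF r] that lB by auto
  have inj': "inj_on (r \<circ> ?l) (out_arcs \<Gamma> v) \<and> inj_on (r \<circ> ?l) (in_arcs \<Gamma> v)" if "v \<in> verts \<Gamma>" for v
    using inj[OF that] by (auto intro!: comp_inj)
  have "inj_on (fst \<circ> snd) (ess (\<Gamma>.lab (r \<circ> ?l) (arcs \<Gamma>)))"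
  proof (rule \<Gamma>.inj_on_ess_labels[OF conn \<Gamma>.det_lab[OF inj'] es(1,2)])
    show "(r \<circ> ?l) (es ! i) < (r \<circ> ?l) (es ! j)" if "i < j" "j < length es" for i j
      using incr[of i j] that by simp
    show "(r \<circ> ?l) e < (r \<circ> ?l) f"
      if "e \<in> arcs \<Gamma>" "f \<in> set es" "(r \<circ> ?l) e \<notin> (r \<circ> ?l) ` set es" for e f
    proof -
      have "?l e \<notin> ?l ` set es" using that(3) by auto
      moreover have "?l e \<in> arcs B" using that(1) lB by blast
      ultimately show ?thesis using low[of "?l e" "?l f"] that(2) by simp
    qed
    show "(r \<circ> ?l) ` (Inr -` echelon_part \<Gamma> es i) \<inter> (r \<circ> ?l) ` set (drop (Suc i) es) = {}"
      if "i < length es" for i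
    proof -
      have "Inr -` echelon_part \<Gamma> es i \<subseteq> arcs \<Gamma>"
        unfolding echelon_part_def echelon_comp_def component_def by (auto simp: cells_def)
      moreover have "set (drop (Suc i) es) \<subseteq> arcs \<Gamma>" using esG set_drop_subset by fast
      ultimately have "r ` (?l ` (Inr -` echelon_part \<Gamma> es i) \<inter> ?l ` set (drop (Suc i) es)) =
          r ` ?l ` (Inr -` echelon_part \<Gamma> es i) \<inter> r ` ?l ` set (drop (Suc i) es)"
        using lB image_mono[of _ "arcs \<Gamma>" ?l] by (intro inj_on_image_Int[OF r]) blast+
      then show ?thesis using disj[OF that] by (simp add: image_comp)
    qed
  qed
  moreover have "\<Gamma>.lab (r \<circ> ?l) (arcs \<Gamma>) = relabel r ?E"
    by (auto simp: \<Gamma>.lab_def relabel_def image_image)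
  ultimately have ess: "inj_on (fst \<circ> snd) (ess (relabel r ?E))" by simp
  have HE: "H = {k. reduced k \<and> walk ?E v k v}" using \<Gamma>.pi1_map_image[OF det v] H by simp
  have finE: "finite ?E" by (simp add: \<Gamma>.lab_def)
  have EV: "?E \<subseteq> verts \<Gamma> \<times> arcs B \<times> verts \<Gamma>" using lB by (auto simp: \<Gamma>.lab_def)
  have "group_rank (G\<lparr>carrier := H \<inter> K\<rparr>) \<le> group_rank (G\<lparr>carrier := K\<rparr>)" if K: "subgroup K G" for K
    unfolding group_rank_def[of "G\<lparr>carrier := K\<rparr>"]
  proof (rule INF_greatest)
    fix S assume "S \<in> {S. S \<subseteq> carrier (G\<lparr>carrier := K\<rparr>) \<and> generate (G\<lparr>carrier := K\<rparr>) S = carrier (G\<lparr>carrier := K\<rparr>)}"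
    then have S: "S \<subseteq> K" "generate G S = K"
      using group.generate_consistent[OF group_G _ K, of S] by auto
    show "group_rank (G\<lparr>carrier := H \<inter> K\<rparr>) \<le> (if finite S then enat (card S) else \<infinity>)"
      using group_rank_Int_le[OF assms(2) HE finE det EV _ v r ess K _ S] by simp
  qed
  then show ?thesis by (simp add: inert_def)
qed

end
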